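(* Let $c$ be a positive integer, let $V_1$ be a complex vector space of dimension $c$ and $W=\mathbb{C}$, and let $X=(B_0,B_1,B_2,I)\in\mathcal{V}(3,c)^{st}$ be a stable ADHM datum on $V_1$. Let $[z_0:z_1:z_2:z_3]$ be homogeneous coordinates on $\mathbb{P}^3$ and let $\wp=\{z_3=0\}$. Then to $X$ one can associate the perfect extended monad $$0\to V_1\otimes\mathcal{O}_{\mathbb{P}^3}(-2)\xrightarrow{\alpha_{-2}}V_1^{\oplus3}\otimes\mathcal{O}_{\mathbb{P}^3}(-1)\xrightarrow{\alpha_{-1}}(V_1^{\oplus3}\oplus W)\otimes\mathcal{O}_{\mathbb{P}^3}\xrightarrow{\alpha_0}V_1\otimes\mathcal{O}_{\mathbb{P}^3}(1)\to0$$ with $$\alpha_{-2}=\begin{pmatrix}-B_2z_3+z_2\\ B_1z_3-z_1\\ -B_0z_3+z_0\end{pmatrix},\quad \alpha_{-1}=\begin{pmatrix}B_1z_3-z_1&B_2z_3-z_2&0\\ -B_0z_3+z_0&0&B_2z_3-z_2\\ 0&-B_0z_3+z_0&-B_1z_3+z_1\\ 0&0&0\end{pmatrix},$$ $$\alpha_0=\begin{pmatrix}B_0z_3-z_0&B_1z_3-z_1&B_2z_3-z_2&Iz_3\end{pmatrix},$$ and its cohomology is an ideal sheaf whose restriction to $\mathbb{C}^3=\mathbb{P}^3\setminus\wp$ is isomorphic to the one given by the ideal $\ker\Phi_X\subset\mathbb{C}[Z_0,Z_1,Z_2]$, where $\Phi_X:\mathbb{C}[Z_0,Z_1,Z_2]\to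 V_1$, $\Phi_X(p)=p(B_0,B_1,B_2)I(1)$.
   Context: $\mathcal{V}(3,c)$ is the set of tuples $(B_0,B_1,B_2,I)\in\mathrm{End}(V_1)^{\oplus3}\oplus\mathrm{Hom}(W,V_1)$ with $[B_i,B_j]=0$ for all $i,j$. Such a tuple (an ADHM datum) is stable if there is no proper subspace $S\subsetneq V_1$ with $B_0(S),B_1(S),B_2(S),I(W)\subset S$, and $\mathcal{V}(3,c)^{st}$ is the set of stable tuples. In the matrices, $z_i$ stands for $z_i\cdot\mathrm{id}_{V_1}$. The affine coordinates on $\mathbb{P}^3\setminus\wp\cong\mathbb{C}^3$ are $Z_i=z_i/z_3$, $i=0,1,2$. A perfect extended monad on $\mathbb{P}^3$ is a complex with terms $\mathcal{O}_{\mathbb{P}^3}(i)^{\oplus a_i}$ in degree $i$, $-2\le i\le1$, exact at all positions except possibly degree $0$. Its cohomology is $\ker\alpha_0/\mathrm{Im}\,\alpha_{-1}$. *)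

theory Defs
  imports "HOL-Analysis.Analysis" "HOL-Library.Poly_Mapping" "HOL-Algebra.Ideal" "HOL-Algebra.Module"
begin

section \<open>Sheaves of modules\<close>

record ('p, 'r) ring_presheaf =
  rsec :: "'p set \<Rightarrow> 'r ring"
  rres :: "'p set \<Rightarrow> 'p set \<Rightarrow> 'r \<Rightarrow> 'r"

text \<open>
  In both records the restriction from \<open>U\<close> to \<open>V\<close> is \<open>res F U V\<close>. A library module record carries
  the fields \<open>mult\<close> and \<open>one\<close> of a ring; these are meaningless for a module and are left \<open>undefined\<close>.
\<close>

record ('p, 'r, 'm) mod_presheaf =
  sec :: "'p set \<Rightarrow> ('r, 'm) module"
  res :: "'p set \<Rightarrow> 'p set \<Rightarrow> 'm \<Rightarrow> 'm"

text \<open>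
  The base space \<open>X\<close> is passed separately; the restriction of a sheaf to an open subset \<open>A\<close> is the same
  presheaf considered over \<open>subtopology X A\<close>, whose opens are the opens of \<open>X\<close> contained in \<open>A\<close>.
\<close>

definition sheaf_hom :: "'p topology \<Rightarrow> ('p, 'r) ring_presheaf \<Rightarrow> ('p, 'r, 'm) mod_presheaf \<Rightarrow>
    ('p, 'r, 'n) mod_presheaf \<Rightarrow> ('p set \<Rightarrow> 'm \<Rightarrow> 'n) \<Rightarrow> bool" where
  "sheaf_hom X \<O> F G \<phi> \<longleftrightarrow>
    (\<forall>U. openin X U \<longrightarrow>
      (\<forall>s\<in>carrier (sec F U). \<phi> U s \<in> carrier (sec G U)) \<and>
      (\<forall>s\<in>carrier (sec F U). \<forall>t\<in>carrier (sec F U).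
         \<phi> U (s \<oplus>\<^bsub>sec F U\<^esub> t) = \<phi> U s \<oplus>\<^bsub>sec G U\<^esub> \<phi> U t) \<and>
      (\<forall>f\<in>carrier (rsec \<O> U). \<forall>s\<in>carrier (sec F U).
         \<phi> U (f \<odot>\<^bsub>sec F U\<^esub> s) = f \<odot>\<^bsub>sec G U\<^esub> \<phi> U s) \<and>
      (\<forall>V. openin X V \<and> V \<subseteq> U \<longrightarrow>
         (\<forall>s\<in>carrier (sec F U). \<phi> V (res F U V s) = res G U V (\<phi> U s))))"

definition sheaf_iso :: "'p topology \<Rightarrow> ('p, 'r) ring_presheaf \<Rightarrow> ('p, 'r, 'm) mod_presheaf \<Rightarrow>
    ('p, 'r, 'n) mod_presheaf \<Rightarrow> bool" where
  "sheaf_iso X \<O> F G \<longleftrightarrow>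
    (\<exists>\<phi>. sheaf_hom X \<O> F G \<phi> \<and>
      (\<forall>U. openin X U \<longrightarrow> bij_betw (\<phi> U) (carrier (sec F U)) (carrier (sec G U))))"

text \<open>The direct sum of \<open>k\<close> copies of \<open>F\<close>.\<close>

definition sheaf_power :: "('p, 'r, 'm) mod_presheaf \<Rightarrow> nat \<Rightarrow> ('p, 'r, nat \<Rightarrow> 'm) mod_presheaf" where
  "sheaf_power F k =
    \<lparr> sec = \<lambda>U. \<lparr> carrier = {..<k} \<rightarrow>\<^sub>E carrier (sec F U), mult = undefined, one = undefined,
                   zero = (\<lambda>i\<in>{..<k}. \<zero>\<^bsub>sec F U\<^esub>),
                   add = (\<lambda>s t. \<lambda>i\<in>{..<k}. s i \<oplus>\<^bsub>sec F U\<^esub> t i),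
                   smult = (\<lambda>f s. \<lambda>i\<in>{..<k}. f \<odot>\<^bsub>sec F U\<^esub> s i) \<rparr>,
      res = \<lambda>U V s. \<lambda>i\<in>{..<k}. res F U V (s i) \<rparr>"

definition ker_sheaf :: "('p, 'r, 'm) mod_presheaf \<Rightarrow> ('p, 'r, 'n) mod_presheaf \<Rightarrow>
    ('p set \<Rightarrow> 'm \<Rightarrow> 'n) \<Rightarrow> 'p set \<Rightarrow> 'm set" where
  "ker_sheaf F G \<phi> U = a_kernel (sec F U) (sec G U) (\<phi> U)"

text \<open>The image sheaf: sections that are locally images of sections.\<close>

definition im_sheaf :: "'p topology \<Rightarrow> ('p, 'r, 'm) mod_presheaf \<Rightarrow> ('p, 'r, 'n) mod_presheaf \<Rightarrow>
    ('p set \<Rightarrow> 'm \<Rightarrow> 'n) \<Rightarrow> 'p set \<Rightarrow> 'n set" where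
  "im_sheaf X F G \<phi> U =
    {s \<in> carrier (sec G U). \<forall>p\<in>U. \<exists>V. openin X V \<and> p \<in> V \<and> V \<subseteq> U \<and>
       (\<exists>t\<in>carrier (sec F V). res G U V s = \<phi> V t)}"

text \<open>The presheaf \<open>U \<mapsto> K(U) / N(U)\<close> for subsheaves \<open>N \<subseteq> K\<close> of \<open>F\<close>.\<close>

definition quot_presheaf :: "('p, 'r, 'm) mod_presheaf \<Rightarrow> ('p set \<Rightarrow> 'm set) \<Rightarrow> ('p set \<Rightarrow> 'm set) \<Rightarrow>
    ('p, 'r, 'm set) mod_presheaf" where
  "quot_presheaf F K N =
    \<lparr> sec = \<lambda>U. let M = (sec F U)\<lparr>carrier := K U\<rparr> in
        \<lparr> carrier = a_rcosets\<^bsub>M\<^esub> (N U), mult = undefined, one = undefined,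
          zero = N U,
          add = set_add M,
          smult = (\<lambda>f C. \<Union>c\<in>C. N U +>\<^bsub>M\<^esub> (f \<odot>\<^bsub>M\<^esub> c)) \<rparr>,
      res = \<lambda>U V C. \<Union>c\<in>C. N V +>\<^bsub>sec F V\<^esub> res F U V c \<rparr>"

text \<open>
  The germ at \<open>p\<close> of \<open>s \<in> F(V)\<close>, as the class of all pairs \<open>(W, t)\<close> with \<open>t \<in> F(W)\<close>, \<open>p \<in> W\<close>, that
  agree with \<open>s\<close> near \<open>p\<close>. The operations on germs are computed on representatives.
\<close>

definition germ :: "'p topology \<Rightarrow> ('p, 'r, 'm) mod_presheaf \<Rightarrow> 'p \<Rightarrow> 'p set \<Rightarrow> 'm \<Rightarrow> ('p set \<times> 'm) set" where
  "germ X F p V s = {(W, t). openin X W \<and> p \<in> W \<and> t \<in> carrier (sec F W) \<and>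
     (\<exists>N. openin X N \<and> p \<in> N \<and> N \<subseteq> V \<inter> W \<and> res F V N s = res F W N t)}"

definition stalk_add :: "'p topology \<Rightarrow> ('p, 'r, 'm) mod_presheaf \<Rightarrow> 'p \<Rightarrow>
    ('p set \<times> 'm) set \<Rightarrow> ('p set \<times> 'm) set \<Rightarrow> ('p set \<times> 'm) set" where
  "stalk_add X F p a b = (\<Union>(V, s)\<in>a. \<Union>(W, t)\<in>b.
     germ X F p (V \<inter> W) (res F V (V \<inter> W) s \<oplus>\<^bsub>sec F (V \<inter> W)\<^esub> res F W (V \<inter> W) t))"

definition stalk_smult :: "'p topology \<Rightarrow> ('p, 'r) ring_presheaf \<Rightarrow> ('p, 'r, 'm) mod_presheaf \<Rightarrow> 'p \<Rightarrow>
    'p set \<Rightarrow> 'r \<Rightarrow> ('p set \<times> 'm) set \<Rightarrow> ('p set \<times> 'm) set" where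
  "stalk_smult X \<O> F p U f a = (\<Union>(V, s)\<in>a.
     germ X F p (U \<inter> V) (rres \<O> U (U \<inter> V) f \<odot>\<^bsub>sec F (U \<inter> V)\<^esub> res F V (U \<inter> V) s))"

text \<open>
  The sheaf associated with a presheaf: families of germs that are locally induced by sections,
  extended by \<open>{}\<close> (which is not a germ) outside of \<open>U\<close>.
\<close>

definition sheafify :: "'p topology \<Rightarrow> ('p, 'r) ring_presheaf \<Rightarrow> ('p, 'r, 'm) mod_presheaf \<Rightarrow>
    ('p, 'r, 'p \<Rightarrow> ('p set \<times> 'm) set) mod_presheaf" where
  "sheafify X \<O> F =
    \<lparr> sec = \<lambda>U. \<lparr> carrier = {\<sigma>. (\<forall>p. p \<notin> U \<longrightarrow> \<sigma> p = {}) \<and>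
                      (\<forall>p\<in>U. \<exists>V. openin X V \<and> p \<in> V \<and> V \<subseteq> U \<and>
                         (\<exists>t\<in>carrier (sec F V). \<forall>q\<in>V. \<sigma> q = germ X F q V t))},
                   mult = undefined, one = undefined,
                   zero = (\<lambda>p. if p \<in> U then germ X F p U \<zero>\<^bsub>sec F U\<^esub> else {}),
                   add = (\<lambda>\<sigma> \<tau> p. stalk_add X F p (\<sigma> p) (\<tau> p)),
                   smult = (\<lambda>f \<sigma> p. stalk_smult X \<O> F p U f (\<sigma> p)) \<rparr>,
      res = \<lambda>U V \<sigma> p. if p \<in> V then \<sigma> p else {} \<rparr>"

text \<open>The cohomology sheaf \<open>ker \<beta> / Im \<alpha>\<close> at the middle term of \<open>E \<rightarrow> F \<rightarrow> G\<close>.\<close>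

definition cohomology_sheaf :: "'p topology \<Rightarrow> ('p, 'r) ring_presheaf \<Rightarrow>
    ('p, 'r, 'l) mod_presheaf \<Rightarrow> ('p set \<Rightarrow> 'l \<Rightarrow> 'm) \<Rightarrow> ('p, 'r, 'm) mod_presheaf \<Rightarrow>
    ('p set \<Rightarrow> 'm \<Rightarrow> 'n) \<Rightarrow> ('p, 'r, 'n) mod_presheaf \<Rightarrow>
    ('p, 'r, 'p \<Rightarrow> ('p set \<times> 'm set) set) mod_presheaf" where
  "cohomology_sheaf X \<O> E \<alpha> F \<beta> G =
     sheafify X \<O> (quot_presheaf F (ker_sheaf F G \<beta>) (im_sheaf X E F \<alpha>))"

text \<open>Ideal sheaves: subsheaves of \<open>\<O>\<close> that are ideals over every open set.\<close>

definition ideal_sheaf :: "'p topology \<Rightarrow> ('p, 'r) ring_presheaf \<Rightarrow> ('p set \<Rightarrow> 'r set) \<Rightarrow> bool" where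
  "ideal_sheaf X \<O> J \<longleftrightarrow>
    (\<forall>U. openin X U \<longrightarrow>
      ideal (J U) (rsec \<O> U) \<and>
      (\<forall>V. openin X V \<and> V \<subseteq> U \<longrightarrow> rres \<O> U V ` J U \<subseteq> J V) \<and>
      (\<forall>f\<in>carrier (rsec \<O> U).
         (\<forall>p\<in>U. \<exists>V. openin X V \<and> p \<in> V \<and> V \<subseteq> U \<and> rres \<O> U V f \<in> J V) \<longrightarrow> f \<in> J U))"

definition ideal_module :: "('p, 'r) ring_presheaf \<Rightarrow> ('p set \<Rightarrow> 'r set) \<Rightarrow> ('p, 'r, 'r) mod_presheaf" where
  "ideal_module \<O> J =
    \<lparr> sec = \<lambda>U. \<lparr> carrier = J U, mult = undefined, one = undefined,
                   zero = \<zero>\<^bsub>rsec \<O> U\<^esub>, add = add (rsec \<O> U), smult = mult (rsec \<O> U) \<rparr>,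
      res = rres \<O> \<rparr>"


section \<open>Polynomials\<close>

text \<open>
  Polynomials in variables indexed by \<open>'i\<close>, with coefficients in a vector space \<open>V\<close> of type \<open>'v\<close>; this
  is \<open>V \<otimes> \<complex>[z\<^sub>i]\<close>, and for \<open>'v = complex\<close> the polynomial ring itself. Numeral types are used for the
  index: \<open>4\<close> has the elements \<open>0, 1, 2, 3\<close> and \<open>3\<close> has the elements \<open>0, 1, 2\<close>.
\<close>

type_synonym ('i, 'v) polynomials = "('i \<Rightarrow>\<^sub>0 nat) \<Rightarrow>\<^sub>0 'v"

definition poly_eval :: "(complex \<Rightarrow> 'v \<Rightarrow> 'v) \<Rightarrow> ('i::finite, 'v::ab_group_add) polynomials \<Rightarrow>
    complex ^ 'i \<Rightarrow> 'v" where
  "poly_eval scl F x = (\<Sum>m\<in>Poly_Mapping.keys F.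
    scl (\<Prod>i\<in>UNIV. (x $ i) ^ Poly_Mapping.lookup m i) (Poly_Mapping.lookup F m))"

definition homogeneous :: "nat \<Rightarrow> ('i::finite, 'v::zero) polynomials \<Rightarrow> bool" where
  "homogeneous d F \<longleftrightarrow> (\<forall>m\<in>Poly_Mapping.keys F. (\<Sum>i\<in>UNIV. Poly_Mapping.lookup m i) = d)"


section \<open>Projective space\<close>

text \<open>
  Points of \<open>\<P>\<^sup>3\<close> are the lines \<open>vec.span {x}\<close>, \<open>x \<noteq> 0\<close>, in \<open>\<complex>\<^sup>4\<close>; the topology is the Zariski topology,
  whose basic open sets are the non-vanishing loci of homogeneous polynomials.
\<close>

type_synonym point = "(complex ^ 4) set"

definition P3 :: "point topology" where
  "P3 = topology_generated_by
     {{vec.span {x} | x. x \<noteq> 0 \<and> poly_eval (*) f x \<noteq> 0} | f d. homogeneous d f}"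

definition cone :: "point set \<Rightarrow> (complex ^ 4) set" where
  "cone U = {x. x \<noteq> 0 \<and> vec.span {x} \<in> U}"

text \<open>
  A section of \<open>V \<otimes> \<O>(n)\<close> over \<open>U\<close> is a \<open>V\<close>-valued function on the cone over \<open>U\<close> that is locally of
  the form \<open>F / g\<close> with \<open>F\<close>, \<open>g\<close> homogeneous, \<open>deg F - deg g = n\<close>, and \<open>g\<close> without zeros. Functions are
  extended by \<open>0\<close> outside of the cone.
\<close>

definition is_section :: "(complex \<Rightarrow> 'v \<Rightarrow> 'v) \<Rightarrow> int \<Rightarrow> point set \<Rightarrow>
    (complex ^ 4 \<Rightarrow> 'v::ab_group_add) \<Rightarrow> bool" where
  "is_section scl n U s \<longleftrightarrow>
    (\<forall>x. x \<notin> cone U \<longrightarrow> s x = 0) \<and>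
    (\<forall>p\<in>U. \<exists>V. openin P3 V \<and> p \<in> V \<and> V \<subseteq> U \<and>
      (\<exists>F g d e. homogeneous d F \<and> homogeneous e g \<and> int d = int e + n \<and>
        (\<forall>x\<in>cone V. poly_eval (*) g x \<noteq> 0 \<and>
           s x = scl (inverse (poly_eval (*) g x)) (poly_eval scl F x))))"

definition O_P3 :: "(point, complex ^ 4 \<Rightarrow> complex) ring_presheaf" where
  "O_P3 =
    \<lparr> rsec = \<lambda>U. \<lparr> carrier = {f. is_section (*) 0 U f},
                    mult = (\<lambda>f g x. f x * g x), one = (\<lambda>x. if x \<in> cone U then 1 else 0),
                    zero = (\<lambda>x. 0), add = (\<lambda>f g x. f x + g x) \<rparr>,
      rres = \<lambda>U V f x. if x \<in> cone V then f x else 0 \<rparr>"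

text \<open>\<open>V \<otimes> \<O>(n)\<close>, where \<open>V\<close> is the type \<open>'v\<close> with scalar multiplication \<open>scl\<close>.\<close>

definition twist :: "(complex \<Rightarrow> 'v \<Rightarrow> 'v) \<Rightarrow> int \<Rightarrow>
    (point, complex ^ 4 \<Rightarrow> complex, complex ^ 4 \<Rightarrow> 'v::ab_group_add) mod_presheaf" where
  "twist scl n =
    \<lparr> sec = \<lambda>U. \<lparr> carrier = {s. is_section scl n U s}, mult = undefined, one = undefined,
                   zero = (\<lambda>x. 0), add = (\<lambda>s t x. s x + t x), smult = (\<lambda>f s x. scl (f x) (s x)) \<rparr>,
      res = \<lambda>U V s x. if x \<in> cone V then s x else 0 \<rparr>"

definition twist_sum :: "int \<Rightarrow> nat \<Rightarrow>
    (point, complex ^ 4 \<Rightarrow> complex, nat \<Rightarrow> complex ^ 4 \<Rightarrow> complex) mod_presheaf" where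
  "twist_sum n a = sheaf_power (twist (*) n) a"

text \<open>The morphism given by a matrix whose entries depend on the homogeneous coordinates.\<close>

definition matrix_hom :: "(complex ^ 4 \<Rightarrow> 'v \<Rightarrow> 'w) \<Rightarrow> point set \<Rightarrow>
    (complex ^ 4 \<Rightarrow> 'v) \<Rightarrow> (complex ^ 4 \<Rightarrow> 'w)" where
  "matrix_hom A U s = (\<lambda>x. A x (s x))"

text \<open>
  The four exactness conditions are exactness in degrees \<open>-2\<close>, \<open>-1\<close>, the complex condition in
  degree \<open>0\<close>, and exactness in degree \<open>1\<close>.
\<close>

definition perfect_extended_monad ::
    "(point, complex ^ 4 \<Rightarrow> complex, 'a) mod_presheaf \<Rightarrow> (point set \<Rightarrow> 'a \<Rightarrow> 'b) \<Rightarrow>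
     (point, complex ^ 4 \<Rightarrow> complex, 'b) mod_presheaf \<Rightarrow> (point set \<Rightarrow> 'b \<Rightarrow> 'c) \<Rightarrow>
     (point, complex ^ 4 \<Rightarrow> complex, 'c) mod_presheaf \<Rightarrow> (point set \<Rightarrow> 'c \<Rightarrow> 'd) \<Rightarrow>
     (point, complex ^ 4 \<Rightarrow> complex, 'd) mod_presheaf \<Rightarrow> bool" where
  "perfect_extended_monad E2 \<alpha>2 E1 \<alpha>1 E0 \<alpha>0 F1 \<longleftrightarrow>
    (\<exists>a. sheaf_iso P3 O_P3 E2 (twist_sum (-2) a)) \<and>
    (\<exists>a. sheaf_iso P3 O_P3 E1 (twist_sum (-1) a)) \<and>
    (\<exists>a. sheaf_iso P3 O_P3 E0 (twist_sum 0 a)) \<and>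
    (\<exists>a. sheaf_iso P3 O_P3 F1 (twist_sum 1 a)) \<and>
    sheaf_hom P3 O_P3 E2 E1 \<alpha>2 \<and>
    sheaf_hom P3 O_P3 E1 E0 \<alpha>1 \<and>
    sheaf_hom P3 O_P3 E0 F1 \<alpha>0 \<and>
    (\<forall>U. openin P3 U \<longrightarrow>
      ker_sheaf E2 E1 \<alpha>2 U = {\<zero>\<^bsub>sec E2 U\<^esub>} \<and>
      ker_sheaf E1 E0 \<alpha>1 U = im_sheaf P3 E2 E1 \<alpha>2 U \<and>
      im_sheaf P3 E1 E0 \<alpha>1 U \<subseteq> ker_sheaf E0 F1 \<alpha>0 U \<and>
      im_sheaf P3 E0 F1 \<alpha>0 U = carrier (sec F1 U))"


section \<open>The affine chart\<close>

definition hyperplane :: "point set" where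
  "hyperplane = {vec.span {x} | x. x \<noteq> 0 \<and> x $ 3 = 0}"

definition affine_chart :: "point topology" where
  "affine_chart = subtopology P3 (topspace P3 - hyperplane)"

definition affine_coords :: "complex ^ 4 \<Rightarrow> complex ^ 3" where
  "affine_coords x = (\<chi> i. if i = 0 then x $ 0 / x $ 3 else if i = 1 then x $ 1 / x $ 3 else x $ 2 / x $ 3)"

text \<open>
  The sheaf of ideals on \<open>\<complex>\<^sup>3 = \<P>\<^sup>3 - \<wp>\<close> associated with an ideal \<open>A\<close> of \<open>\<complex>[Z\<^sub>0, Z\<^sub>1, Z\<^sub>2]\<close>: functions
  that are locally fractions \<open>f(Z) / g(Z)\<close> with \<open>f \<in> A\<close>.
\<close>

definition affine_ideal_sheaf :: "(3, complex) polynomials set \<Rightarrow> point set \<Rightarrow> (complex ^ 4 \<Rightarrow> complex) set" where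
  "affine_ideal_sheaf A U =
    {s. (\<forall>x. x \<notin> cone U \<longrightarrow> s x = 0) \<and>
        (\<forall>p\<in>U. \<exists>V. openin affine_chart V \<and> p \<in> V \<and> V \<subseteq> U \<and>
          (\<exists>f\<in>A. \<exists>g. \<forall>x\<in>cone V. poly_eval (*) g (affine_coords x) \<noteq> 0 \<and>
             s x = poly_eval (*) f (affine_coords x) / poly_eval (*) g (affine_coords x)))}"


section \<open>ADHM data\<close>

text \<open>\<open>V\<^sub>1\<close> is the type \<open>'v\<close> with scalar multiplication \<open>scl\<close>, and \<open>W = \<complex>\<close>.\<close>

definition adhm_data :: "(complex \<Rightarrow> 'v \<Rightarrow> 'v) \<Rightarrow>
    (('v::ab_group_add \<Rightarrow> 'v) \<times> ('v \<Rightarrow> 'v) \<times> ('v \<Rightarrow> 'v) \<times> (complex \<Rightarrow> 'v)) set" where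
  "adhm_data scl = {(B0, B1, B2, I).
     Vector_Spaces.linear scl scl B0 \<and> Vector_Spaces.linear scl scl B1 \<and>
     Vector_Spaces.linear scl scl B2 \<and> Vector_Spaces.linear (*) scl I \<and>
     B0 \<circ> B1 = B1 \<circ> B0 \<and> B0 \<circ> B2 = B2 \<circ> B0 \<and> B1 \<circ> B2 = B2 \<circ> B1}"

definition stable_adhm_data :: "(complex \<Rightarrow> 'v \<Rightarrow> 'v) \<Rightarrow>
    (('v::ab_group_add \<Rightarrow> 'v) \<times> ('v \<Rightarrow> 'v) \<times> ('v \<Rightarrow> 'v) \<times> (complex \<Rightarrow> 'v)) set" where
  "stable_adhm_data scl = {(B0, B1, B2, I). (B0, B1, B2, I) \<in> adhm_data scl \<and>
     \<not> (\<exists>S. Modules.module.subspace scl S \<and> S \<noteq> UNIV \<and>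
          B0 ` S \<subseteq> S \<and> B1 ` S \<subseteq> S \<and> B2 ` S \<subseteq> S \<and> range I \<subseteq> S)}"

definition poly_operator :: "(complex \<Rightarrow> 'v \<Rightarrow> 'v) \<Rightarrow> ('v::ab_group_add \<Rightarrow> 'v) \<Rightarrow> ('v \<Rightarrow> 'v) \<Rightarrow> ('v \<Rightarrow> 'v) \<Rightarrow>
    (3, complex) polynomials \<Rightarrow> 'v \<Rightarrow> 'v" where
  "poly_operator scl B0 B1 B2 p v =
    (\<Sum>m\<in>Poly_Mapping.keys p. scl (Poly_Mapping.lookup p m)
       ((B0 ^^ Poly_Mapping.lookup m 0) ((B1 ^^ Poly_Mapping.lookup m 1) ((B2 ^^ Poly_Mapping.lookup m 2) v))))"

definition Phi :: "(complex \<Rightarrow> 'v \<Rightarrow> 'v) \<Rightarrow> ('v::ab_group_add \<Rightarrow> 'v) \<Rightarrow> ('v \<Rightarrow> 'v) \<Rightarrow> ('v \<Rightarrow> 'v) \<Rightarrow>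
    (complex \<Rightarrow> 'v) \<Rightarrow> (3, complex) polynomials \<Rightarrow> 'v" where
  "Phi scl B0 B1 B2 I p = poly_operator scl B0 B1 B2 p (I 1)"

definition scale3 :: "(complex \<Rightarrow> 'v \<Rightarrow> 'v) \<Rightarrow> complex \<Rightarrow>
    'v \<times> 'v \<times> 'v \<Rightarrow> 'v \<times> 'v \<times> ('v::ab_group_add)" where
  "scale3 scl = module_prod.scale scl (module_prod.scale scl scl)"

text \<open>The scalar multiplication of \<open>V\<^sub>1\<^sup>3 \<oplus> W\<close>.\<close>

definition scale3W :: "(complex \<Rightarrow> 'v \<Rightarrow> 'v) \<Rightarrow> complex \<Rightarrow>
    ('v \<times> 'v \<times> 'v) \<times> complex \<Rightarrow> ('v \<times> 'v \<times> ('v::ab_group_add)) \<times> complex" where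
  "scale3W scl = module_prod.scale (scale3 scl) (*)"

text \<open>The matrices of the monad at a point with homogeneous coordinates \<open>z\<close>.\<close>

definition alpha_m2 :: "(complex \<Rightarrow> 'v \<Rightarrow> 'v) \<Rightarrow> ('v::ab_group_add \<Rightarrow> 'v) \<Rightarrow> ('v \<Rightarrow> 'v) \<Rightarrow> ('v \<Rightarrow> 'v) \<Rightarrow>
    complex ^ 4 \<Rightarrow> 'v \<Rightarrow> 'v \<times> 'v \<times> 'v" where
  "alpha_m2 scl B0 B1 B2 z v =
    (- scl (z $ 3) (B2 v) + scl (z $ 2) v,
     scl (z $ 3) (B1 v) - scl (z $ 1) v,
     - scl (z $ 3) (B0 v) + scl (z $ 0) v)"

definition alpha_m1 :: "(complex \<Rightarrow> 'v \<Rightarrow> 'v) \<Rightarrow> ('v::ab_group_add \<Rightarrow> 'v) \<Rightarrow> ('v \<Rightarrow> 'v) \<Rightarrow> ('v \<Rightarrow> 'v) \<Rightarrow>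
    complex ^ 4 \<Rightarrow> 'v \<times> 'v \<times> 'v \<Rightarrow> ('v \<times> 'v \<times> 'v) \<times> complex" where
  "alpha_m1 scl B0 B1 B2 z = (\<lambda>(u, v, w).
    (((scl (z $ 3) (B1 u) - scl (z $ 1) u) + (scl (z $ 3) (B2 v) - scl (z $ 2) v),
      (- scl (z $ 3) (B0 u) + scl (z $ 0) u) + (scl (z $ 3) (B2 w) - scl (z $ 2) w),
      (- scl (z $ 3) (B0 v) + scl (z $ 0) v) + (- scl (z $ 3) (B1 w) + scl (z $ 1) w)),
     0))"

definition alpha_0 :: "(complex \<Rightarrow> 'v \<Rightarrow> 'v) \<Rightarrow> ('v::ab_group_add \<Rightarrow> 'v) \<Rightarrow> ('v \<Rightarrow> 'v) \<Rightarrow> ('v \<Rightarrow> 'v) \<Rightarrow>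
    (complex \<Rightarrow> 'v) \<Rightarrow> complex ^ 4 \<Rightarrow> ('v \<times> 'v \<times> 'v) \<times> complex \<Rightarrow> 'v" where
  "alpha_0 scl B0 B1 B2 I z = (\<lambda>((u, v, w), c).
    (scl (z $ 3) (B0 u) - scl (z $ 0) u) + (scl (z $ 3) (B1 v) - scl (z $ 1) v) +
    (scl (z $ 3) (B2 w) - scl (z $ 2) w) + scl (z $ 3) (I c))"

end

theory Submission
  imports Defs
begin

text \<open>
  Put \<open>A\<^sub>i(z) = z\<^sub>3 B\<^sub>i - z\<^sub>i\<close> for \<open>i = 0, 1, 2\<close>. These operators commute, and up to the summand \<open>W\<close> the complex
  of the theorem is the Koszul complex of \<open>(A\<^sub>0, A\<^sub>1, A\<^sub>2)\<close> on \<open>V\<^sub>1 \<otimes> \<O>\<close>; the summand adds the column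
  \<open>z\<^sub>3 I\<close> to the last map.

  A section of a twist is locally a fraction \<open>F / h\<close> with \<open>F\<close> a vector-valued homogeneous polynomial
  function, here called a form. A polynomial identity that holds where \<open>h\<close> does not vanish holds
  everywhere (\<open>form_density\<close>), so exactness over an open set follows from exactness for forms, with the
  same denominator.

  Modulo the image of \<open>A\<^sub>i\<close> the coordinate \<open>z\<^sub>i\<close> acts as \<open>z\<^sub>3 B\<^sub>i\<close>. Hence every form is \<open>A\<^sub>i G + r\<close> for unique
  forms \<open>G\<close> and \<open>r\<close> such that \<open>r\<close> does not involve \<open>z\<^sub>i\<close> (\<open>division\<close>, \<open>division_unique\<close>). In other words
  \<open>A\<^sub>0, A\<^sub>1, A\<^sub>2\<close> is a regular sequence on \<open>V\<^sub>1 \<otimes> \<complex>[z\<^sub>0, \<dots>, z\<^sub>3]\<close> with quotient \<open>V\<^sub>1 \<otimes> \<complex>[z\<^sub>3]\<close>, and its Koszul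
  complex is exact (\<open>koszul_exact_1\<close>, \<open>koszul_exact_2\<close>, \<open>koszul_exact_3\<close>). This is exactness in the
  degrees \<open>-2\<close> and \<open>-1\<close>.

  The last map is surjective near every point (\<open>liftable_const\<close>). Away from \<open>z\<^sub>3 = 0\<close> the constant vectors
  that it reaches form a subspace that contains the image of \<open>I\<close> and is stable under the \<open>B\<^sub>i\<close>, so stability
  makes it everything. At a point with \<open>z\<^sub>3 = 0\<close> some \<open>z\<^sub>i\<close> is not zero there, and \<open>A\<^sub>i\<close> is invertible nearby
  because \<open>B\<^sub>i\<close> satisfies a polynomial equation.

  Exactness of the Koszul complex at \<open>V\<^sub>1\<^sup>3 \<otimes> \<O>\<close> says that an element of the kernel of the last map lies in
  the image of the previous one as soon as its \<open>W\<close>-component is zero (\<open>image_al1_iff\<close>). So the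
  \<open>W\<close>-component embeds the cohomology presheaf into \<open>\<O>\<close>, and the cohomology sheaf is the ideal sheaf \<open>J\<close>
  of the functions \<open>c\<close> that locally occur as \<open>W\<close>-components, that is, such that \<open>z\<^sub>3 c I(1)\<close> is locally in
  the image of the \<open>A\<^sub>i\<close>.

  Finally, if the form \<open>f\<close> of degree \<open>d\<close> homogenizes the polynomial \<open>p\<close>, then \<open>z\<^sub>3 f I(1)\<close> is congruent
  to \<open>z\<^sub>3\<^sup>d\<^sup>+\<^sup>1 p(B\<^sub>0, B\<^sub>1, B\<^sub>2) I(1)\<close> modulo the image of the \<open>A\<^sub>i\<close> (\<open>homogenization_reduces\<close>). Since nonzero
  forms in \<open>z\<^sub>3\<close> alone are not in that image, a fraction \<open>p / q\<close> on the affine chart belongs to \<open>J\<close> exactly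
  when it can be written with \<open>p \<in> ker \<Phi>\<^sub>X\<close> (\<open>coh_J_eq_affine\<close>).
\<close>

section \<open>Homogeneous polynomial functions\<close>

lemma UNIV_4': "(UNIV :: 4 set) = {0, 1, 2, 3}"
  using UNIV_4 by auto

locale complex_vector_space = vector_space scl
  for scl :: "complex \<Rightarrow> 'v \<Rightarrow> 'v::ab_group_add"

lemma complex_vector_space_self: "complex_vector_space ((*) :: complex \<Rightarrow> complex \<Rightarrow> complex)"
  by unfold_locales (auto simp: algebra_simps)

context complex_vector_space
begin

text \<open>
  Reading off the coordinates with respect to a basis reduces the claim to scalar polynomials, which
  have finitely many zeros.
\<close>

lemma vpoly_zero:
  assumes inf: "infinite {t. (\<Sum>k\<le>n. scl (t ^ k) (a k)) = 0}" and "k \<le> n"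
  shows "a k = 0"
proof -
  define B where "B = extend_basis {}"
  have ind: "independent B" and sp: "span B = UNIV"
    unfolding B_def by (rule independent_extend_basis[OF independent_empty], rule span_extend_basis[OF independent_empty])
  have "representation B (a k) b = 0" for b
  proof -
    define p where "p = (\<Sum>k\<le>n. monom (representation B (a k) b) k)"
    have "poly p t = representation B (\<Sum>k\<le>n. scl (t ^ k) (a k)) b" for t
      using ind sp by (simp add: p_def poly_sum poly_monom representation_sum representation_scale mult.commute)
    then have "{t. (\<Sum>k\<le>n. scl (t ^ k) (a k)) = 0} \<subseteq> {t. poly p t = 0}"
      by (auto simp: representation_zero)
    then have "infinite {t. poly p t = 0}"
      using inf finite_subset by blast
    then have "p = 0" using poly_roots_finite by blast
    then have "coeff p k = 0" by simp
    then show ?thesis using \<open>k \<le> n\<close> by (simp add: p_def coeff_sum)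
  qed
  then show ?thesis
    using sum_nonzero_representation_eq[OF ind, of "a k"] sp by simp
qed

end

text \<open>
  \<open>form scl S d f\<close> says that \<open>f\<close> is a vector-valued homogeneous polynomial function of degree \<open>d\<close> in the
  coordinates \<open>z\<^sub>i\<close> with \<open>i \<in> S\<close>. The recursion writes a form of positive degree as a combination of the
  coordinates, which is the shape that inductions on the degree need. The set \<open>S\<close> records which
  variables are left after dividing by some of the \<open>A\<^sub>i\<close>.
\<close>

primrec form :: "(complex \<Rightarrow> 'v \<Rightarrow> 'v) \<Rightarrow> 4 set \<Rightarrow> nat \<Rightarrow> (complex ^ 4 \<Rightarrow> 'v::ab_group_add) \<Rightarrow> bool" where
  "form scl S 0 f = (\<exists>v. f = (\<lambda>x. v))"
| "form scl S (Suc d) f = (\<exists>g. (\<forall>i\<in>S. form scl S d (g i)) \<and> f = (\<lambda>x. \<Sum>i\<in>S. scl (x $ i) (g i x)))"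

lemmas form_Suc = form.simps(2)
declare form_Suc [simp del]

lemma form_constant [simp]: "form scl S 0 (\<lambda>x. v)"
  by auto

lemma form_comp_linear:
  assumes "Vector_Spaces.linear scl scl' T"
  shows "form scl S d f \<Longrightarrow> form scl' S d (\<lambda>x. T (f x))"
proof (induction d arbitrary: f)
  case 0
  then show ?case by auto
next
  case (Suc d)
  interpret T: Vector_Spaces.linear scl scl' T by fact
  obtain g where g: "\<forall>i\<in>S. form scl S d (g i)" and f: "f = (\<lambda>x. \<Sum>i\<in>S. scl (x $ i) (g i x))"
    using Suc.prems by (auto simp: form_Suc)
  have "(\<lambda>x. T (f x)) = (\<lambda>x. \<Sum>i\<in>S. scl' (x $ i) (T (g i x)))"
    by (simp add: f T.sum T.scale)
  then show ?case using g Suc.IH by (auto simp: form_Suc intro!: exI[of _ "\<lambda>i x. T (g i x)"])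
qed

context complex_vector_space
begin

lemma form_0 [simp, intro]: "form scl S d (\<lambda>x. 0)"
  by (induction d) (auto simp: form_Suc intro!: exI[of _ "\<lambda>i x. 0"])

lemma form_add: "form scl S d f \<Longrightarrow> form scl S d g \<Longrightarrow> form scl S d (\<lambda>x. f x + g x)"
proof (induction d arbitrary: f g)
  case 0
  then show ?case by auto
next
  case (Suc d)
  obtain f' where f': "\<forall>i\<in>S. form scl S d (f' i)" "f = (\<lambda>x. \<Sum>i\<in>S. scl (x $ i) (f' i x))"
    using Suc.prems by (auto simp: form_Suc)
  obtain g' where g': "\<forall>i\<in>S. form scl S d (g' i)" "g = (\<lambda>x. \<Sum>i\<in>S. scl (x $ i) (g' i x))"
    using Suc.prems by (auto simp: form_Suc)
  show ?case
    using f' g' Suc.IH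
    by (auto intro!: exI[of _ "\<lambda>i x. f' i x + g' i x"] simp: form_Suc scale_right_distrib sum.distrib)
qed

lemma form_sum: "finite J \<Longrightarrow> (\<And>j. j \<in> J \<Longrightarrow> form scl S d (f j)) \<Longrightarrow> form scl S d (\<lambda>x. \<Sum>j\<in>J. f j x)"
  by (induction J rule: finite_induct) (auto intro: form_add)

lemma linear_scale_const: "Vector_Spaces.linear scl scl (scl a)"
  by unfold_locales (simp_all add: scale_right_distrib mult.commute)

lemma form_scale: "form scl S d f \<Longrightarrow> form scl S d (\<lambda>x. scl a (f x))"
  by (rule form_comp_linear[OF linear_scale_const])

lemma form_minus: "form scl S d f \<Longrightarrow> form scl S d (\<lambda>x. - f x)"
  using form_scale[of S d f "-1"] by simp

lemma form_diff: "form scl S d f \<Longrightarrow> form scl S d g \<Longrightarrow> form scl S d (\<lambda>x. f x - g x)"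
  using form_add[of S d f "\<lambda>x. - g x"] form_minus by simp

lemma form_coord:
  assumes "i \<in> S" "form scl S d f"
  shows "form scl S (Suc d) (\<lambda>x. scl (x $ i) (f x))"
proof -
  have "(\<lambda>x. scl (x $ i) (f x)) = (\<lambda>x. \<Sum>j\<in>S. scl (x $ j) (if j = i then f x else 0))"
    using assms(1) by (simp add: if_distrib[of "scl _"] cong: if_cong)
  moreover have "form scl S d (\<lambda>x. if j = i then f x else 0)" for j
    using assms(2) by (cases "j = i") auto
  ultimately show ?thesis unfolding form_Suc by (auto intro!: exI[of _ "\<lambda>j x. if j = i then f x else 0"])
qed

lemma form_mono: "S \<subseteq> S' \<Longrightarrow> form scl S d f \<Longrightarrow> form scl S' d f"
proof (induction d arbitrary: f)
  case 0
  then show ?case by auto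
next
  case (Suc d)
  obtain f' where f': "\<forall>i\<in>S. form scl S d (f' i)" "f = (\<lambda>x. \<Sum>i\<in>S. scl (x $ i) (f' i x))"
    using Suc.prems by (auto simp: form_Suc)
  have "form scl S' (Suc d) (\<lambda>x. scl (x $ i) (f' i x))" if "i \<in> S" for i
    using that f' Suc by (intro form_coord) auto
  then show ?case unfolding f'(2) by (intro form_sum) auto
qed

lemma form_mult:
  "form (*) S d g \<Longrightarrow> form scl S e f \<Longrightarrow> form scl S (d + e) (\<lambda>x. scl (g x) (f x))"
proof (induction d arbitrary: g)
  case 0
  then show ?case by (auto intro: form_scale)
next
  case (Suc d)
  obtain g' where g': "\<forall>i\<in>S. form (*) S d (g' i)" "g = (\<lambda>x. \<Sum>i\<in>S. x $ i * g' i x)"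
    using Suc.prems by (auto simp: form_Suc)
  have "form scl S (Suc (d + e)) (\<lambda>x. scl (x $ i) (scl (g' i x) (f x)))" if "i \<in> S" for i
    using that g' Suc by (intro form_coord) auto
  then have "form scl S (Suc (d + e)) (\<lambda>x. \<Sum>i\<in>S. scl (x $ i) (scl (g' i x) (f x)))"
    by (intro form_sum) auto
  then show ?case by (simp add: g'(2) scale_sum_left)
qed

lemma form_scale_point: "form scl S d f \<Longrightarrow> f (c *s x) = scl (c ^ d) (f x)"
proof (induction d arbitrary: f)
  case 0
  then show ?case by auto
next
  case (Suc d)
  obtain f' where f': "\<forall>i\<in>S. form scl S d (f' i)" "f = (\<lambda>x. \<Sum>i\<in>S. scl (x $ i) (f' i x))"
    using Suc.prems by (auto simp: form_Suc)
  show ?case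
    unfolding f'(2) scale_sum_right
  proof (rule sum.cong[OF refl])
    fix i assume "i \<in> S"
    then have "f' i (c *s x) = scl (c ^ d) (f' i x)" using f'(1) Suc.IH by blast
    then show "scl ((c *s x) $ i) (f' i (c *s x)) = scl (c ^ Suc d) (scl (x $ i) (f' i x))"
      by (simp add: mult_ac)
  qed
qed

lemma form_line: "form scl S d f \<Longrightarrow> \<exists>a. \<forall>t. f (x + t *s y) = (\<Sum>k\<le>d. scl (t ^ k) (a k))"
proof (induction d arbitrary: f)
  case 0
  then show ?case by auto
next
  case (Suc d)
  obtain f' where f': "\<forall>i\<in>S. form scl S d (f' i)" "f = (\<lambda>x. \<Sum>i\<in>S. scl (x $ i) (f' i x))"
    using Suc.prems by (auto simp: form_Suc)
  have "\<forall>i\<in>S. \<exists>a. \<forall>t. f' i (x + t *s y) = (\<Sum>k\<le>d. scl (t ^ k) (a k))"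
    using f'(1) Suc.IH by blast
  then obtain a where a: "\<forall>i\<in>S. \<forall>t. f' i (x + t *s y) = (\<Sum>k\<le>d. scl (t ^ k) (a i k))"
    by (rule bchoice[THEN exE])
  define b where "b i k = (if k \<le> d then scl (x $ i) (a i k) else 0) + (case k of 0 \<Rightarrow> 0 | Suc k' \<Rightarrow> scl (y $ i) (a i k'))" for i k
  have b: "scl ((x + t *s y) $ i) (f' i (x + t *s y)) = (\<Sum>k\<le>Suc d. scl (t ^ k) (b i k))" if "i \<in> S" for i t
  proof -
    have "(\<Sum>k\<le>Suc d. scl (t ^ k) (if k \<le> d then scl (x $ i) (a i k) else 0)) = scl (x $ i) (\<Sum>k\<le>d. scl (t ^ k) (a i k))"
      by (simp add: scale_sum_right mult.commute)
    moreover have "(\<Sum>k\<le>Suc d. scl (t ^ k) (case k of 0 \<Rightarrow> 0 | Suc k' \<Rightarrow> scl (y $ i) (a i k'))) = scl (t * y $ i) (\<Sum>k\<le>d. scl (t ^ k) (a i k))"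
      by (simp only: sum.atMost_Suc_shift) (simp add: scale_sum_right mult_ac)
    ultimately show ?thesis
      using a[rule_format, OF that, of t] by (simp only: b_def scale_right_distrib sum.distrib) (simp add: scale_left_distrib)
  qed
  have "f (x + t *s y) = (\<Sum>k\<le>Suc d. scl (t ^ k) (\<Sum>i\<in>S. b i k))" for t
  proof -
    have "f (x + t *s y) = (\<Sum>i\<in>S. \<Sum>k\<le>Suc d. scl (t ^ k) (b i k))"
      unfolding f'(2) using b by (intro sum.cong) auto
    also have "\<dots> = (\<Sum>k\<le>Suc d. scl (t ^ k) (\<Sum>i\<in>S. b i k))"
      by (subst sum.swap) (simp only: scale_sum_right)
    finally show ?thesis .
  qed
  then show ?case by (intro exI[of _ "\<lambda>k. \<Sum>i\<in>S. b i k"] allI)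
qed

text \<open>
  The complement of a hypersurface meets the line through \<open>x\<close> and \<open>w\<close> in all but finitely many points, and on
  that line \<open>f\<close> is a polynomial in one variable.
\<close>

lemma form_density:
  assumes g: "form (*) UNIV e g" and f: "form scl UNIV d f" and w: "g w \<noteq> 0"
    and zero: "\<And>x. g x \<noteq> 0 \<Longrightarrow> f x = 0"
  shows "f x = 0"
proof -
  interpret C: complex_vector_space "(*) :: complex \<Rightarrow> complex \<Rightarrow> complex"
    by (rule complex_vector_space_self)
  obtain a where a: "\<And>t. f (x + t *s (w - x)) = (\<Sum>k\<le>d. scl (t ^ k) (a k))"
    using form_line[OF f] by metis
  obtain b where b: "\<And>t. g (x + t *s (w - x)) = (\<Sum>k\<le>e. t ^ k * b k)"
    using C.form_line[OF g] by metis
  have fin: "finite {t. (\<Sum>k\<le>e. t ^ k * b k) = 0}"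
  proof (rule ccontr)
    assume "\<not> ?thesis"
    then have "b k = 0" if "k \<le> e" for k using C.vpoly_zero that by blast
    then have "g (x + 1 *s (w - x)) = 0" unfolding b by simp
    then show False using w by simp
  qed
  have "- {t. (\<Sum>k\<le>e. t ^ k * b k) = 0} \<subseteq> {t. (\<Sum>k\<le>d. scl (t ^ k) (a k)) = 0}"
  proof
    fix t assume "t \<in> - {t. (\<Sum>k\<le>e. t ^ k * b k) = 0}"
    then have "g (x + t *s (w - x)) \<noteq> 0" using b[of t] by simp
    then have "f (x + t *s (w - x)) = 0" by (rule zero)
    then show "t \<in> {t. (\<Sum>k\<le>d. scl (t ^ k) (a k)) = 0}" using a[of t] by simp
  qed
  then have "infinite {t. (\<Sum>k\<le>d. scl (t ^ k) (a k)) = 0}"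
    using fin finite_subset finite_compl infinite_UNIV_char_0 by blast
  then have "a k = 0" if "k \<le> d" for k using vpoly_zero that by blast
  then show ?thesis using a[of 0] by simp
qed

lemma form_indep: "form scl S d f \<Longrightarrow> i \<notin> S \<Longrightarrow> f (x + t *s axis i 1) = f x"
proof (induction d arbitrary: f)
  case 0
  then show ?case by auto
next
  case (Suc d)
  obtain f' where f': "\<forall>i\<in>S. form scl S d (f' i)" "f = (\<lambda>x. \<Sum>i\<in>S. scl (x $ i) (f' i x))"
    using Suc.prems by (auto simp: form_Suc)
  have "(x + t *s axis i 1) $ j = x $ j" if "j \<in> S" for j
    using that Suc.prems by (auto simp: axis_def)
  moreover have "f' j (x + t *s axis i 1) = f' j x" if "j \<in> S" for j
    using that f'(1) Suc.IH Suc.prems(2) by blast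
  ultimately show ?case
    unfolding f'(2) by (intro sum.cong) auto
qed

section \<open>Division and the Koszul complex\<close>

text \<open>
  The operators \<open>A\<^sub>i(z) = z\<^sub>3 B\<^sub>i - z\<^sub>i\<close> that build the matrices of the monad.
\<close>

definition A :: "4 \<Rightarrow> ('v \<Rightarrow> 'v) \<Rightarrow> complex ^ 4 \<Rightarrow> 'v \<Rightarrow> 'v" where
  "A i T z v = scl (z $ 3) (T v) - scl (z $ i) v"

lemma linear_A: "Vector_Spaces.linear scl scl T \<Longrightarrow> Vector_Spaces.linear scl scl (A i T z)"
proof -
  assume "Vector_Spaces.linear scl scl T"
  then interpret T: Vector_Spaces.linear scl scl T .
  show ?thesis
    by unfold_locales (simp_all add: A_def T.add T.scale scale_right_distrib scale_right_diff_distrib mult.commute)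
qed

lemma form_A:
  assumes "Vector_Spaces.linear scl scl T" "i \<in> S" "3 \<in> S" "form scl S d f"
  shows "form scl S (Suc d) (\<lambda>x. A i T x (f x))"
  unfolding A_def using assms by (intro form_diff form_coord form_comp_linear[OF assms(1)])

lemma A_commute:
  assumes "Vector_Spaces.linear scl scl T" "Vector_Spaces.linear scl scl T'" "T \<circ> T' = T' \<circ> T"
  shows "A i T x (A j T' x v) = A j T' x (A i T x v)"
proof -
  interpret T: Vector_Spaces.linear scl scl T by fact
  interpret T': Vector_Spaces.linear scl scl T' by fact
  have "T (T' v) = T' (T v)" using assms(3) by (metis comp_apply)
  then show ?thesis
    by (simp add: A_def T.diff T.scale T'.diff T'.scale scale_right_diff_distrib mult.commute)
qed

text \<open>
  Along the direction of \<open>z\<^sub>i\<close> the operator multiplies the leading coefficient of \<open>G\<close> by \<open>-z\<^sub>i\<close>, so \<open>A\<^sub>i G\<close>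
  cannot be independent of \<open>z\<^sub>i\<close> unless \<open>G\<close> vanishes.
\<close>

lemma division_unique:
  assumes T: "Vector_Spaces.linear scl scl T" and i: "i \<noteq> 3"
    and G: "form scl S d G" and r: "\<And>x t. r (x + t *s axis i 1) = r x"
    and eq: "\<And>x. A i T x (G x) + r x = 0"
  shows "G x = 0" and "r x = 0"
proof -
  interpret T: Vector_Spaces.linear scl scl T by fact
  interpret A: Vector_Spaces.linear scl scl "A i T x" using linear_A[OF T] .
  obtain a where a: "\<And>t. G (x + t *s axis i 1) = (\<Sum>k\<le>d. scl (t ^ k) (a k))"
    using form_line[OF G] by metis
  \<comment> \<open>The coefficients in \<open>t\<close> of the relation at \<open>x + t e\<^sub>i\<close>. The top one says \<open>a d = 0\<close> and the middle ones
    \<open>a (k - 1) = A i T x (a k)\<close>, so the \<open>a k\<close> vanish one after the other.\<close>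
  define b where "b k = (if k \<le> d then A i T x (a k) else 0) - (case k of 0 \<Rightarrow> - r x | Suc k' \<Rightarrow> a k')" for k
  have "(\<Sum>k\<le>Suc d. scl (t ^ k) (b k)) = 0" for t
  proof -
    have "(\<Sum>k\<le>Suc d. scl (t ^ k) (if k \<le> d then A i T x (a k) else 0)) = A i T x (\<Sum>k\<le>d. scl (t ^ k) (a k))"
      by (simp add: A.sum A.scale)
    moreover have "(\<Sum>k\<le>Suc d. scl (t ^ k) (case k of 0 \<Rightarrow> - r x | Suc k' \<Rightarrow> a k')) = scl t (\<Sum>k\<le>d. scl (t ^ k) (a k)) - r x"
      by (simp only: sum.atMost_Suc_shift) (simp add: scale_sum_right mult_ac)
    moreover have "A i T (x + t *s axis i 1) v = A i T x v - scl t v" for v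
      using i by (simp add: A_def scale_left_distrib axis_def)
    ultimately show ?thesis
      using eq[of "x + t *s axis i 1"] unfolding a r
      by (simp only: b_def scale_right_diff_distrib sum_subtractf) (simp only: algebra_simps)
  qed
  then have b: "b k = 0" if "k \<le> Suc d" for k
    by (intro vpoly_zero[OF _ that]) (simp add: infinite_UNIV_char_0 del: sum.atMost_Suc)
  have "a (d - k) = 0" if "k \<le> d" for k using that
  proof (induction k)
    case 0
    then show ?case using b[of "Suc d"] by (simp add: b_def)
  next
    case (Suc k)
    then have "Suc (d - Suc k) = d - k" by simp
    then obtain m where "d - k = Suc m" "d - Suc k = m" by (metis)
    moreover have "m \<le> d" using calculation by linarith
    ultimately show ?case using b[of "d - k"] Suc by (simp add: b_def A.zero split: if_splits)
  qed
  then have "a k = 0" if "k \<le> d" for k using that by (metis diff_diff_cancel diff_le_self)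
  then show "G x = 0" using a[of 0] by simp
  then show "r x = 0" using eq[of x] by simp
qed

text \<open>
  Division with remainder by \<open>A\<^sub>i\<close>: since \<open>z\<^sub>i v = - A\<^sub>i v + z\<^sub>3 B\<^sub>i v\<close>, each occurrence of \<open>z\<^sub>i\<close> can be traded for
  an occurrence of \<open>z\<^sub>3\<close>.
\<close>

lemma division:
  assumes T: "Vector_Spaces.linear scl scl T" and S: "i \<in> S" "3 \<in> S" "i \<noteq> 3"
  shows "form scl S (Suc d) f \<Longrightarrow> \<exists>G r. form scl S d G \<and> form scl (S - {i}) (Suc d) r \<and> (\<forall>x. f x = A i T x (G x) + r x)"
proof -
  interpret T: Vector_Spaces.linear scl scl T by fact
  have reduce: "\<exists>r'. form scl (S - {i}) (Suc d) r' \<and> (\<forall>x. (\<Sum>j\<in>S. scl (x $ j) (r j x)) = A i T x (- r i x) + r' x)"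
    if "\<And>j. j \<in> S \<Longrightarrow> form scl (S - {i}) d (r j)" for r d
  proof (intro exI conjI allI)
    show "form scl (S - {i}) (Suc d) (\<lambda>x. (\<Sum>j\<in>S - {i}. scl (x $ j) (r j x)) + scl (x $ 3) (T (r i x)))"
      using S that by (intro form_add form_sum form_coord form_comp_linear[OF T]) auto
    show "(\<Sum>j\<in>S. scl (x $ j) (r j x)) = A i T x (- r i x) + ((\<Sum>j\<in>S - {i}. scl (x $ j) (r j x)) + scl (x $ 3) (T (r i x)))" for x
      using S by (subst sum.remove[of S i]) (auto simp: A_def T.neg)
  qed
  show "form scl S (Suc d) f \<Longrightarrow> ?thesis"
  proof (induction d arbitrary: f)
    case 0
    obtain f' where f': "\<forall>j\<in>S. form scl S 0 (f' j)" "f = (\<lambda>x. \<Sum>j\<in>S. scl (x $ j) (f' j x))"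
      using 0 by (auto simp: form_Suc)
    obtain r where "form scl (S - {i}) (Suc 0) r" "\<And>x. f x = A i T x (- f' i x) + r x"
      using reduce[of 0 f'] f' by auto
    then show ?case using f' S(1) form_minus by blast
  next
    case (Suc d)
    obtain f' where f': "\<forall>j\<in>S. form scl S (Suc d) (f' j)" "f = (\<lambda>x. \<Sum>j\<in>S. scl (x $ j) (f' j x))"
      using Suc.prems by (subst (asm) form_Suc) blast
    obtain G r where G: "\<And>j. j \<in> S \<Longrightarrow> form scl S d (G j)" and r: "\<And>j. j \<in> S \<Longrightarrow> form scl (S - {i}) (Suc d) (r j)"
      and eq: "\<And>j x. j \<in> S \<Longrightarrow> f' j x = A i T x (G j x) + r j x"
    proof -
      have "\<forall>j\<in>S. \<exists>p. form scl S d (fst p) \<and> form scl (S - {i}) (Suc d) (snd p) \<and> (\<forall>x. f' j x = A i T x (fst p x) + snd p x)"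
        using f'(1) Suc.IH by fastforce
      then obtain p where "\<forall>j\<in>S. form scl S d (fst (p j)) \<and> form scl (S - {i}) (Suc d) (snd (p j)) \<and> (\<forall>x. f' j x = A i T x (fst (p j) x) + snd (p j) x)"
        by (rule bchoice[THEN exE])
      then show thesis by (intro that[of "\<lambda>j. fst (p j)" "\<lambda>j. snd (p j)"]) auto
    qed
    obtain r' where r': "form scl (S - {i}) (Suc (Suc d)) r'"
      and eq': "\<And>x. (\<Sum>j\<in>S. scl (x $ j) (r j x)) = A i T x (- r i x) + r' x"
      using reduce[of "Suc d" r] r by blast
    define G' where "G' x = (\<Sum>j\<in>S. scl (x $ j) (G j x)) + - r i x" for x
    have "form scl S (Suc d) G'"
      unfolding G'_def using G r[OF S(1)] S(1)
      by (intro form_add form_minus form_sum form_coord) (auto intro: form_mono[of "S - {i}"])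
    moreover have "f x = A i T x (G' x) + r' x" for x
    proof -
      interpret A: Vector_Spaces.linear scl scl "A i T x" using linear_A[OF T] .
      have "f x = (\<Sum>j\<in>S. scl (x $ j) (A i T x (G j x) + r j x))"
        unfolding f'(2) using eq by (intro sum.cong) auto
      also have "\<dots> = A i T x (\<Sum>j\<in>S. scl (x $ j) (G j x)) + (\<Sum>j\<in>S. scl (x $ j) (r j x))"
        by (simp add: A.sum A.scale scale_right_distrib sum.distrib)
      also have "\<dots> = A i T x (G' x) + r' x"
        unfolding eq' G'_def A.add by (simp add: add.assoc)
      finally show ?thesis .
    qed
    ultimately show ?case using r' by blast
  qed
qed

lemma koszul_step:
  assumes T: "Vector_Spaces.linear scl scl T" and i: "i \<noteq> 3"
    and f: "form scl UNIV d f" and r: "form scl S e r" "i \<notin> S"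
    and eq: "\<And>x. A i T x (f x) + r x = 0"
  shows "f = (\<lambda>x. 0)" and "r = (\<lambda>x. 0)"
  using division_unique[OF T i f form_indep[OF r] eq] by (simp_all add: fun_eq_iff)

text \<open>
  Exactness of the Koszul complex at its last but one term. Dividing \<open>v\<close> and \<open>w\<close> by \<open>A\<^sub>0\<close> turns the relation
  into \<open>A\<^sub>0 (\<dots>) + (A\<^sub>1 v\<^sub>1 + A\<^sub>2 w\<^sub>1 + r) = 0\<close>, whose second summand does not involve \<open>z\<^sub>0\<close>; so both summands vanish
  and the relation has one operator less. The additional summand \<open>r\<close> in \<open>z\<^sub>3\<close> alone survives all steps and
  has to be zero at the end: this is how forms in \<open>z\<^sub>3\<close> alone are seen to meet the image of the \<open>A\<^sub>i\<close> only in \<open>0\<close>.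
\<close>

lemma koszul_exact_1:
  assumes T: "Vector_Spaces.linear scl scl T0" "Vector_Spaces.linear scl scl T1" "Vector_Spaces.linear scl scl T2"
    and comm: "T0 \<circ> T1 = T1 \<circ> T0" "T0 \<circ> T2 = T2 \<circ> T0" "T1 \<circ> T2 = T2 \<circ> T1"
    and f: "form scl UNIV (Suc d) u" "form scl UNIV (Suc d) v" "form scl UNIV (Suc d) w" "form scl {3} (Suc (Suc d)) r"
    and eq: "\<And>x. A 0 T0 x (u x) + A 1 T1 x (v x) + A 2 T2 x (w x) + r x = 0"
  obtains a b c where "form scl UNIV d a" "form scl UNIV d b" "form scl UNIV d c"
    "\<And>x. u x = A 1 T1 x (a x) + A 2 T2 x (b x)"
    "\<And>x. v x = - A 0 T0 x (a x) + A 2 T2 x (c x)"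
    "\<And>x. w x = - A 0 T0 x (b x) - A 1 T1 x (c x)"
    "\<And>x. r x = 0"
proof -
  interpret A0: Vector_Spaces.linear scl scl "A 0 T0 x" for x by (rule linear_A[OF T(1)])
  interpret A1: Vector_Spaces.linear scl scl "A 1 T1 x" for x by (rule linear_A[OF T(2)])
  interpret A2: Vector_Spaces.linear scl scl "A 2 T2 x" for x by (rule linear_A[OF T(3)])
  note c01 = A_commute[OF T(1,2) comm(1), of 0 _ 1]
  note c02 = A_commute[OF T(1,3) comm(2), of 0 _ 2]
  note c12 = A_commute[OF T(2,3) comm(3), of 1 _ 2]
  obtain v' v1 where v': "form scl UNIV d v'" and v1: "form scl (UNIV - {0}) (Suc d) v1"
    and v: "\<And>x. v x = A 0 T0 x (v' x) + v1 x"
    using division[OF T(1) _ _ _ f(2), of 0] by auto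
  obtain w' w1 where w': "form scl UNIV d w'" and w1: "form scl (UNIV - {0}) (Suc d) w1"
    and w: "\<And>x. w x = A 0 T0 x (w' x) + w1 x"
    using division[OF T(1) _ _ _ f(3), of 0] by auto
  obtain w'' w2 where w'': "form scl (UNIV - {0}) d w''" and w2: "form scl (UNIV - {0} - {1}) (Suc d) w2"
    and w1_eq: "\<And>x. w1 x = A 1 T1 x (w'' x) + w2 x"
    using division[OF T(2) _ _ _ w1, of 1] by auto
  have S: "(UNIV :: 4 set) - {0} - {1} - {2} = {3}"
    unfolding UNIV_4' by auto
  have r0: "form scl (UNIV - {0}) (Suc (Suc d)) r" and r1: "form scl (UNIV - {0} - {1}) (Suc (Suc d)) r"
    by (rule form_mono[OF _ f(4)], auto)+
  have 1: "(\<lambda>x. u x + A 1 T1 x (v' x) + A 2 T2 x (w' x)) = (\<lambda>x. 0)"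
    "(\<lambda>x. A 1 T1 x (v1 x) + A 2 T2 x (w1 x) + r x) = (\<lambda>x. 0)"
  proof -
    have f: "form scl UNIV (Suc d) (\<lambda>x. u x + A 1 T1 x (v' x) + A 2 T2 x (w' x))"
      by (intro form_add f form_A T v' w') auto
    have r: "form scl (UNIV - {0}) (Suc (Suc d)) (\<lambda>x. A 1 T1 x (v1 x) + A 2 T2 x (w1 x) + r x)"
      by (intro form_add form_A T v1 w1 r0) auto
    have e: "A 0 T0 x (u x + A 1 T1 x (v' x) + A 2 T2 x (w' x)) + (A 1 T1 x (v1 x) + A 2 T2 x (w1 x) + r x) = 0" for x
      using eq[of x] unfolding v w A0.add A1.add A2.add c01 c02 by (simp add: algebra_simps)
    show "(\<lambda>x. u x + A 1 T1 x (v' x) + A 2 T2 x (w' x)) = (\<lambda>x. 0)"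
      by (rule koszul_step(1)[OF T(1) _ f r _ e]) simp_all
    show "(\<lambda>x. A 1 T1 x (v1 x) + A 2 T2 x (w1 x) + r x) = (\<lambda>x. 0)"
      by (rule koszul_step(2)[OF T(1) _ f r _ e]) simp_all
  qed
  have 2: "(\<lambda>x. v1 x + A 2 T2 x (w'' x)) = (\<lambda>x. 0)" "(\<lambda>x. A 2 T2 x (w2 x) + r x) = (\<lambda>x. 0)"
  proof -
    have f: "form scl UNIV (Suc d) (\<lambda>x. v1 x + A 2 T2 x (w'' x))"
      using v1 w'' by (intro form_add form_A T) (auto intro: form_mono[of "UNIV - {0}"])
    have r: "form scl (UNIV - {0} - {1}) (Suc (Suc d)) (\<lambda>x. A 2 T2 x (w2 x) + r x)"
      by (intro form_add form_A T w2 r1) auto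
    have e: "A 1 T1 x (v1 x + A 2 T2 x (w'' x)) + (A 2 T2 x (w2 x) + r x) = 0" for x
      using fun_cong[OF 1(2), of x] unfolding w1_eq A1.add A2.add c12 by (simp add: algebra_simps)
    show "(\<lambda>x. v1 x + A 2 T2 x (w'' x)) = (\<lambda>x. 0)"
      by (rule koszul_step(1)[OF T(2) _ f r _ e]) simp_all
    show "(\<lambda>x. A 2 T2 x (w2 x) + r x) = (\<lambda>x. 0)"
      by (rule koszul_step(2)[OF T(2) _ f r _ e]) simp_all
  qed
  have w2': "form scl UNIV (Suc d) w2" by (rule form_mono[OF _ w2]) simp
  have 3: "w2 = (\<lambda>x. 0)"
    by (rule koszul_step(1)[OF T(3) _ w2' f(4) _ fun_cong[OF 2(2)]]) simp_all
  have 4: "r = (\<lambda>x. 0)"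
    by (rule koszul_step(2)[OF T(3) _ w2' f(4) _ fun_cong[OF 2(2)]]) simp_all
  show thesis
  proof (rule that[of "\<lambda>x. - v' x" "\<lambda>x. - w' x" "\<lambda>x. - w'' x"])
    show "form scl UNIV d (\<lambda>x. - w'' x)"
      by (rule form_minus, rule form_mono[OF _ w'']) simp
    fix x
    show "u x = A 1 T1 x (- v' x) + A 2 T2 x (- w' x)"
      using fun_cong[OF 1(1), of x] unfolding A1.neg A2.neg
      by (metis (no_types, lifting) add.assoc add_eq_0_iff2 minus_add_distrib)
    have "v1 x = - A 2 T2 x (w'' x)"
      using fun_cong[OF 2(1), of x] by (simp only: eq_neg_iff_add_eq_0)
    then show "v x = - A 0 T0 x (- v' x) + A 2 T2 x (- w'' x)"
      unfolding v A0.neg A2.neg by simp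
    show "w x = - A 0 T0 x (- w' x) - A 1 T1 x (- w'' x)"
      unfolding w w1_eq 3 A0.neg A1.neg by simp
    show "r x = 0" by (simp add: 4)
  qed (rule form_minus[OF v'], rule form_minus[OF w'])
qed

text \<open>
  The relation \<open>A\<^sub>0 v = - A\<^sub>1 w\<close> forces \<open>w\<close> to be divisible by \<open>A\<^sub>0\<close>, since \<open>A\<^sub>1\<close> is injective on the forms that do
  not involve \<open>z\<^sub>0\<close>. Up to sign the quotient is the preimage.
\<close>

lemma koszul_exact_2:
  assumes T: "Vector_Spaces.linear scl scl T0" "Vector_Spaces.linear scl scl T1" "Vector_Spaces.linear scl scl T2"
    and comm: "T0 \<circ> T1 = T1 \<circ> T0" "T0 \<circ> T2 = T2 \<circ> T0" "T1 \<circ> T2 = T2 \<circ> T1"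
    and f: "form scl UNIV (Suc d) u" "form scl UNIV (Suc d) v" "form scl UNIV (Suc d) w"
    and eq: "\<And>x. - A 0 T0 x (u x) + A 2 T2 x (w x) = 0" "\<And>x. - A 0 T0 x (v x) - A 1 T1 x (w x) = 0"
  obtains t where "form scl UNIV d t"
    "\<And>x. u x = - A 2 T2 x (t x)" "\<And>x. v x = A 1 T1 x (t x)" "\<And>x. w x = - A 0 T0 x (t x)"
proof -
  interpret A0: Vector_Spaces.linear scl scl "A 0 T0 x" for x by (rule linear_A[OF T(1)])
  interpret A1: Vector_Spaces.linear scl scl "A 1 T1 x" for x by (rule linear_A[OF T(2)])
  interpret A2: Vector_Spaces.linear scl scl "A 2 T2 x" for x by (rule linear_A[OF T(3)])
  note c01 = A_commute[OF T(1,2) comm(1), of 0 _ 1]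
  note c02 = A_commute[OF T(1,3) comm(2), of 0 _ 2]
  obtain w' w1 where w': "form scl UNIV d w'" and w1: "form scl (UNIV - {0}) (Suc d) w1"
    and w: "\<And>x. w x = A 0 T0 x (w' x) + w1 x"
    using division[OF T(1) _ _ _ f(3), of 0] by auto
  have 1: "(\<lambda>x. v x + A 1 T1 x (w' x)) = (\<lambda>x. 0)" "(\<lambda>x. A 1 T1 x (w1 x)) = (\<lambda>x. 0)"
  proof -
    have f: "form scl UNIV (Suc d) (\<lambda>x. v x + A 1 T1 x (w' x))"
      by (intro form_add f form_A T w') auto
    have r: "form scl (UNIV - {0}) (Suc (Suc d)) (\<lambda>x. A 1 T1 x (w1 x))"
      by (intro form_A T w1) auto
    have e: "A 0 T0 x (v x + A 1 T1 x (w' x)) + A 1 T1 x (w1 x) = 0" for x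
      using arg_cong[OF eq(2), of uminus x] unfolding w A0.add A1.add c01 by (simp add: algebra_simps)
    show "(\<lambda>x. v x + A 1 T1 x (w' x)) = (\<lambda>x. 0)"
      by (rule koszul_step(1)[OF T(1) _ f r _ e]) simp_all
    show "(\<lambda>x. A 1 T1 x (w1 x)) = (\<lambda>x. 0)"
      by (rule koszul_step(2)[OF T(1) _ f r _ e]) simp_all
  qed
  have w1': "form scl UNIV (Suc d) w1" by (rule form_mono[OF _ w1]) simp
  have w1_0: "w1 = (\<lambda>x. 0)"
  proof (rule koszul_step(1)[OF T(2) _ w1' form_0[of "{}" 0]])
    show "A 1 T1 x (w1 x) + 0 = 0" for x using fun_cong[OF 1(2), of x] by simp
  qed simp_all
  have f2: "form scl UNIV (Suc d) (\<lambda>x. u x - A 2 T2 x (w' x))"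
    by (intro form_diff f form_A T w') auto
  have 2: "(\<lambda>x. u x - A 2 T2 x (w' x)) = (\<lambda>x. 0)"
  proof (rule koszul_step(1)[OF T(1) _ f2 form_0[of "{}" 0]])
    show "A 0 T0 x (u x - A 2 T2 x (w' x)) + 0 = 0" for x
      using eq(1)[of x] unfolding w w1_0 A0.diff c02 by simp
  qed simp_all
  have u: "u x = - A 2 T2 x (- w' x)" for x using fun_cong[OF 2, of x] unfolding A2.neg by simp
  have v: "v x = A 1 T1 x (- w' x)" for x
    using fun_cong[OF 1(1), of x] unfolding A1.neg eq_neg_iff_add_eq_0 .
  have w: "w x = - A 0 T0 x (- w' x)" for x unfolding w w1_0 A0.neg by simp
  show thesis by (rule that[OF form_minus[OF w'] u v w])
qed

lemma koszul_exact_3: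
  assumes T: "Vector_Spaces.linear scl scl T0" and f: "form scl UNIV d f" and eq: "\<And>x. A 0 T0 x (f x) = 0"
  shows "f = (\<lambda>x. 0)"
proof (rule koszul_step(1)[OF T _ f form_0[of "{}" 0]])
  show "A 0 T0 x (f x) + 0 = 0" for x using eq by simp
qed simp_all

end

interpretation scalars: complex_vector_space "(*) :: complex \<Rightarrow> complex \<Rightarrow> complex"
  by (rule complex_vector_space_self)

section \<open>Forms and polynomials\<close>

lemma coordinate_power_form:
  assumes "j \<in> S"
  shows "form (*) S n (\<lambda>x. (x $ j) ^ n)"
proof (induction n)
  case (Suc n)
  show ?case using scalars.form_coord[OF assms Suc] by simp
qed auto

lemma coordinate_form: "form (*) UNIV (Suc 0) (\<lambda>x. x $ j)"
  using coordinate_power_form[of j UNIV "Suc 0"] by simp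

lemma prod_coord_single_add:
  fixes x :: "complex ^ 'i::finite"
  shows "(\<Prod>j\<in>UNIV. (x $ j) ^ Poly_Mapping.lookup (m + Poly_Mapping.single i 1) j) =
    x $ i * (\<Prod>j\<in>UNIV. (x $ j) ^ Poly_Mapping.lookup m j)"
proof -
  have "(\<Prod>j\<in>UNIV. (x $ j) ^ Poly_Mapping.lookup (Poly_Mapping.single i (1::nat)) j) = (\<Prod>j\<in>UNIV. if j = i then x $ j else 1)"
    by (intro prod.cong) (auto simp: lookup_single)
  then show ?thesis
    by (simp add: lookup_add power_add prod.distrib mult.commute)
qed

lemma sum_lookup_single_add:
  "(\<Sum>j\<in>UNIV. Poly_Mapping.lookup (m + Poly_Mapping.single i 1) j) = Suc (\<Sum>j\<in>UNIV. Poly_Mapping.lookup m j)"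
  for m :: "'i::finite \<Rightarrow>\<^sub>0 nat"
  by (simp add: lookup_add sum.distrib lookup_single when_def)

lemma monomial_form:
  "form (*) UNIV (\<Sum>j\<in>UNIV. Poly_Mapping.lookup m j) (\<lambda>x. \<Prod>j\<in>UNIV. (x $ j) ^ Poly_Mapping.lookup m j)"
proof -
  have "form (*) UNIV (\<Sum>j\<in>J. Poly_Mapping.lookup m j) (\<lambda>x. \<Prod>j\<in>J. (x $ j) ^ Poly_Mapping.lookup m j)" if "finite J" for J
    using that by induction (auto intro!: scalars.form_mult coordinate_power_form)
  then show ?thesis by simp
qed

context complex_vector_space
begin

lemma poly_eval_add: "poly_eval scl (F + G) x = poly_eval scl F x + poly_eval scl G x"
  for F :: "('i::finite, 'v) polynomials"
proof -
  let ?p = "\<lambda>m. \<Prod>i\<in>UNIV. (x $ i) ^ Poly_Mapping.lookup m i"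
  let ?K = "Poly_Mapping.keys F \<union> Poly_Mapping.keys G"
  have ext: "poly_eval scl H x = (\<Sum>m\<in>?K. scl (?p m) (Poly_Mapping.lookup H m))"
    if "Poly_Mapping.keys H \<subseteq> ?K" for H
    unfolding poly_eval_def using that
    by (intro sum.mono_neutral_left) (auto simp: in_keys_iff)
  show ?thesis
    using ext[of F] ext[of G] ext[of "F + G"] Poly_Mapping.keys_add[of F G]
    by (simp add: lookup_add scale_right_distrib sum.distrib)
qed

lemma poly_eval_0 [simp]: "poly_eval scl 0 x = 0"
  by (simp add: poly_eval_def)

lemma poly_eval_single:
  "poly_eval scl (Poly_Mapping.single m v) x = scl (\<Prod>i\<in>UNIV. (x $ i) ^ Poly_Mapping.lookup m i) v"
  by (cases "v = 0") (auto simp: poly_eval_def)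

lemma poly_eval_sum: "poly_eval scl (\<Sum>j\<in>J. F j) x = (\<Sum>j\<in>J. poly_eval scl (F j) x)"
  by (induction J rule: infinite_finite_induct) (auto simp: poly_eval_add)

lemma homogeneous_add: "homogeneous d F \<Longrightarrow> homogeneous d G \<Longrightarrow> homogeneous d (F + G)"
  for F :: "('i::finite, 'v) polynomials"
  using Poly_Mapping.keys_add[of F G] by (auto simp: homogeneous_def)

lemma homogeneous_sum: "(\<And>j. j \<in> J \<Longrightarrow> homogeneous d (F j)) \<Longrightarrow> homogeneous d (\<Sum>j\<in>J. F j)"
  for F :: "'j \<Rightarrow> ('i::finite, 'v) polynomials"
  by (induction J rule: infinite_finite_induct) (auto intro: homogeneous_add simp: homogeneous_def[of _ 0])

text \<open>
  Links the recursive notion to the polynomials in terms of which sections and open sets are defined.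
\<close>

lemma form_iff_homogeneous: "form scl UNIV d f \<longleftrightarrow> (\<exists>F. homogeneous d F \<and> f = poly_eval scl F)"
proof
  assume "\<exists>F. homogeneous d F \<and> f = poly_eval scl F"
  then obtain F where F: "homogeneous d F" "f = poly_eval scl F" by blast
  have "form scl UNIV d (\<lambda>x. scl (\<Prod>j\<in>UNIV. (x $ j) ^ Poly_Mapping.lookup m j) (Poly_Mapping.lookup F m))"
    if "m \<in> Poly_Mapping.keys F" for m
  proof -
    have "(\<Sum>j\<in>UNIV. Poly_Mapping.lookup m j) + 0 = d"
      using F(1) that unfolding homogeneous_def by auto
    then show ?thesis
      using form_mult[OF monomial_form[of m] form_constant[of scl UNIV "Poly_Mapping.lookup F m"]] by metis
  qed
  then show "form scl UNIV d f"
    unfolding F(2) poly_eval_def by (intro form_sum) auto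
next
  show "form scl UNIV d f \<Longrightarrow> \<exists>F. homogeneous d F \<and> f = poly_eval scl F"
  proof (induction d arbitrary: f)
    case 0
    then obtain v where f: "f = (\<lambda>x. v)" unfolding form.simps(1) by blast
    have "homogeneous 0 (Poly_Mapping.single (0 :: 4 \<Rightarrow>\<^sub>0 nat) v)"
      unfolding homogeneous_def by (simp add: keys_single)
    moreover have "f = poly_eval scl (Poly_Mapping.single 0 v)"
      by (rule ext) (simp add: poly_eval_single f)
    ultimately show ?case by (intro exI conjI)
  next
    case (Suc d)
    obtain g where g: "\<forall>i\<in>UNIV. form scl UNIV d (g i)" "f = (\<lambda>x. \<Sum>i\<in>UNIV. scl (x $ i) (g i x))"
      using Suc.prems unfolding form_Suc by (elim exE conjE)
    have "\<forall>i. \<exists>F. homogeneous d F \<and> g i = poly_eval scl F" using g(1) Suc.IH by blast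
    from choice[OF this] obtain F where F: "\<forall>i. homogeneous d (F i) \<and> g i = poly_eval scl (F i)" ..
    define G where "G = (\<Sum>i\<in>UNIV. \<Sum>m\<in>Poly_Mapping.keys (F i).
      Poly_Mapping.single (m + Poly_Mapping.single i 1) (Poly_Mapping.lookup (F i) m))"
    have "homogeneous (Suc d) G"
      unfolding G_def using F
      by (intro homogeneous_sum) (auto simp: homogeneous_def sum_lookup_single_add[simplified])
    moreover have "f = poly_eval scl G"
    proof
      fix x
      show "f x = poly_eval scl G x"
        unfolding g(2)
      proof -
        have "scl (x $ i) (g i x) = (\<Sum>m\<in>Poly_Mapping.keys (F i).
            scl (\<Prod>j\<in>UNIV. (x $ j) ^ Poly_Mapping.lookup (m + Poly_Mapping.single i 1) j) (Poly_Mapping.lookup (F i) m))" for i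
        proof -
          have "g i x = poly_eval scl (F i) x" using F by simp
          then show ?thesis
            by (simp only: poly_eval_def scale_sum_right prod_coord_single_add scale_scale)
        qed
        then show "(\<Sum>i\<in>UNIV. scl (x $ i) (g i x)) = poly_eval scl G x"
          by (simp only: G_def poly_eval_sum poly_eval_single)
      qed
    qed
    ultimately show ?case by blast
  qed
qed

end

section \<open>The Zariski topology\<close>

definition nonvanishing :: "(complex ^ 4 \<Rightarrow> complex) \<Rightarrow> point set" where
  "nonvanishing h = {vec.span {x} | x. x \<noteq> 0 \<and> h x \<noteq> 0}"

lemma span_singleton_eqD:
  fixes x y :: "complex ^ 4"
  assumes "vec.span {x} = vec.span {y}" "y \<noteq> 0"
  obtains c where "c \<noteq> 0" "y = c *s x"
proof -
  have "y \<in> vec.span {x}" using assms(1) vec.span_base[of y "{y}"] by auto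
  then obtain c where "y = c *s x" by (auto simp: vec.span_singleton)
  then show thesis using assms(2) that[of c] by (cases "c = 0") auto
qed

lemma openin_nonvanishing:
  assumes "form (*) UNIV d h"
  shows "openin P3 (nonvanishing h)"
proof -
  obtain F where "homogeneous d F" "h = poly_eval (*) F"
    using assms scalars.form_iff_homogeneous by auto
  then have "nonvanishing h \<in> {{vec.span {x} | x. x \<noteq> 0 \<and> poly_eval (*) f x \<noteq> 0} | f d. homogeneous d f}"
    unfolding nonvanishing_def by blast
  then show ?thesis
    unfolding P3_def by (rule topology_generated_by_Basis)
qed

text \<open>
  Whether a form vanishes at \<open>x\<close> depends only on the line through \<open>x\<close>, by homogeneity.
\<close>

lemma cone_nonvanishing:
  assumes "form (*) UNIV d h"
  shows "cone (nonvanishing h) = {x. x \<noteq> 0 \<and> h x \<noteq> 0}"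
proof -
  have "h x \<noteq> 0" if x: "x \<noteq> 0" and y: "h y \<noteq> 0" and eq: "vec.span {x} = vec.span {y}" for x y
  proof -
    obtain c where "y = c *s x"
    proof (cases "y = 0")
      case True
      then have "y = 0 *s x" by simp
      then show thesis using that by blast
    qed (use eq that span_singleton_eqD in blast)
    then show ?thesis using y scalars.form_scale_point[OF assms, of c x] by auto
  qed
  then show ?thesis
    by (auto simp: cone_def nonvanishing_def)
qed

lemma form_mult_scalar:
  "form (*) S d g \<Longrightarrow> form (*) S e f \<Longrightarrow> form (*) S (d + e) (\<lambda>x. g x * f x)"
  for g f :: "complex ^ 4 \<Rightarrow> complex"
  by (rule scalars.form_mult)

lemma form_zero_at_0:
  assumes "form (*) UNIV d h" "0 < d"
  shows "h 0 = (0::complex)"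
  using scalars.form_scale_point[OF assms(1), of 0 0] assms(2) by (simp add: zero_power)

lemma cone_nonvanishing':
  assumes "form (*) UNIV d h" "0 < d"
  shows "x \<in> cone (nonvanishing h) \<longleftrightarrow> h x \<noteq> 0"
  using cone_nonvanishing[OF assms(1)] form_zero_at_0[OF assms] by auto

lemma coordinate_power_nonzero:
  fixes x :: "complex ^ 4"
  assumes "x \<noteq> 0"
  obtains g where "form (*) UNIV k g" "g x \<noteq> (0::complex)"
proof -
  obtain j where j: "x $ j \<noteq> 0" using assms by (auto simp: vec_eq_iff)
  then show thesis using that[OF coordinate_power_form[of j UNIV k]] by simp
qed

lemma cone_mono: "U \<subseteq> V \<Longrightarrow> cone U \<subseteq> cone V"
  by (auto simp: cone_def)

lemma cone_Int: "cone (U \<inter> V) = cone U \<inter> cone V"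
  by (auto simp: cone_def)

lemma zero_notin_cone [simp]: "0 \<notin> cone U"
  by (simp add: cone_def)

lemma open_point:
  assumes "openin P3 U" "p \<in> U"
  obtains x where "x \<in> cone U" "p = vec.span {x}"
proof -
  have "p \<in> topspace P3" using assms openin_subset by blast
  then show thesis using that assms unfolding P3_def cone_def by auto
qed

lemma span_in_cone: "x \<in> cone U \<Longrightarrow> vec.span {x} \<in> U"
  by (simp add: cone_def)

text \<open>
  The nonvanishing loci form a basis and not only a subbasis, because \<open>D(h) \<inter> D(h') = D(h h')\<close>. The degree
  of \<open>h\<close> is made positive by multiplying with a coordinate, so that \<open>h 0 = 0\<close> and \<open>h y \<noteq> 0\<close> already says
  that \<open>y\<close> lies in the cone.
\<close>

lemma open_basis:
  assumes U: "openin P3 U" and x: "x \<in> cone U"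
  obtains h e where "form (*) UNIV e h" "0 < e" "h x \<noteq> 0" "nonvanishing h \<subseteq> U"
proof -
  have x0: "x \<noteq> 0" using x by auto
  have "generate_topology_on {{vec.span {x} | x. x \<noteq> 0 \<and> poly_eval (*) f x \<noteq> 0} | f d. homogeneous d f} U"
    using U unfolding P3_def by (rule openin_topology_generated_by)
  then have "vec.span {x} \<in> U \<longrightarrow> (\<exists>h e. form (*) UNIV e h \<and> h x \<noteq> (0::complex) \<and> (\<forall>y. y \<noteq> 0 \<longrightarrow> h y \<noteq> 0 \<longrightarrow> vec.span {y} \<in> U))"
  proof induction
    case Empty
    then show ?case by simp
  next
    case (Int a b)
    show ?case
    proof
      assume "vec.span {x} \<in> a \<inter> b"
      then obtain h e h' e' where h: "form (*) UNIV e h" "h x \<noteq> 0" "\<And>y. y \<noteq> 0 \<Longrightarrow> h y \<noteq> 0 \<Longrightarrow> vec.span {y} \<in> a"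
        and h': "form (*) UNIV e' h'" "h' x \<noteq> 0" "\<And>y. y \<noteq> 0 \<Longrightarrow> h' y \<noteq> 0 \<Longrightarrow> vec.span {y} \<in> b"
        using Int.IH by blast
      show "\<exists>h e. form (*) UNIV e h \<and> h x \<noteq> (0::complex) \<and> (\<forall>y. y \<noteq> 0 \<longrightarrow> h y \<noteq> 0 \<longrightarrow> vec.span {y} \<in> a \<inter> b)"
        using h h' form_mult_scalar[OF h(1) h'(1)] by (intro exI[of _ "\<lambda>y. h y * h' y"] exI[of _ "e + e'"]) simp
    qed
  next
    case (UN K)
    show ?case
    proof
      assume "vec.span {x} \<in> \<Union> K"
      then obtain k where "k \<in> K" "vec.span {x} \<in> k" by blast
      then show "\<exists>h e. form (*) UNIV e h \<and> h x \<noteq> (0::complex) \<and> (\<forall>y. y \<noteq> 0 \<longrightarrow> h y \<noteq> 0 \<longrightarrow> vec.span {y} \<in> \<Union> K)"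
        using UN.IH[of k] by blast
    qed
  next
    case (Basis s)
    then obtain f d where f: "s = {vec.span {x} | x. x \<noteq> 0 \<and> poly_eval (*) f x \<noteq> 0}" "homogeneous d f" by blast
    have form: "form (*) UNIV d (poly_eval (*) f)" using f(2) scalars.form_iff_homogeneous by blast
    have s: "s = nonvanishing (poly_eval (*) f)" unfolding f(1) nonvanishing_def ..
    show ?case
      using cone_nonvanishing[OF form] x0 form unfolding s cone_def by blast
  qed
  then obtain h e where h: "form (*) UNIV e h" "h x \<noteq> (0::complex)" "\<forall>y. y \<noteq> 0 \<longrightarrow> h y \<noteq> 0 \<longrightarrow> vec.span {y} \<in> U"
    using span_in_cone[OF x] by blast
  \<comment> \<open>a coordinate that does not vanish at \<open>x\<close>, to make the degree positive\<close>
  obtain g where g: "form (*) UNIV 1 g" "g x \<noteq> (0::complex)"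
    using coordinate_power_nonzero[OF x0] .
  show thesis
  proof (rule that[OF form_mult_scalar[OF h(1) g(1)]])
    show "nonvanishing (\<lambda>x. h x * g x) \<subseteq> U"
      using h(3) by (auto simp: nonvanishing_def)
  qed (use h g in auto)
qed

section \<open>Sections\<close>

definition restrict_to :: "point set \<Rightarrow> (complex ^ 4 \<Rightarrow> 'a) \<Rightarrow> complex ^ 4 \<Rightarrow> 'a::zero" where
  "restrict_to V s = (\<lambda>x. if x \<in> cone V then s x else 0)"

context complex_vector_space
begin

definition fraction :: "(complex ^ 4 \<Rightarrow> complex) \<Rightarrow> (complex ^ 4 \<Rightarrow> 'v) \<Rightarrow> complex ^ 4 \<Rightarrow> 'v" where
  "fraction h F = (\<lambda>y. scl (inverse (h y)) (F y))"

definition fraction_near :: "int \<Rightarrow> point set \<Rightarrow> (complex ^ 4 \<Rightarrow> 'v) \<Rightarrow> complex ^ 4 \<Rightarrow> bool" where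
  "fraction_near n U s x \<longleftrightarrow> (\<exists>h F d e. form (*) UNIV e h \<and> form scl UNIV d F \<and> int d = int e + n \<and> h x \<noteq> 0 \<and>
      (\<forall>y\<in>cone U. h y \<noteq> 0 \<longrightarrow> s y = fraction h F y))"

lemma fraction_nearI:
  assumes "form (*) UNIV e h" "form scl UNIV d F" "int d = int e + n" "h x \<noteq> 0"
    "\<And>y. y \<in> cone U \<Longrightarrow> h y \<noteq> 0 \<Longrightarrow> s y = fraction h F y"
  shows "fraction_near n U s x"
  unfolding fraction_near_def using assms by blast

lemma fraction_zero: "h y = 0 \<Longrightarrow> fraction h F y = 0"
  by (simp add: fraction_def)

lemma section_supp: "is_section scl n U s \<Longrightarrow> x \<notin> cone U \<Longrightarrow> s x = 0"
  by (simp add: is_section_def)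

text \<open>
  By multiplying numerator and denominator with the same form, the denominator can be made to vanish
  outside of a given neighbourhood of \<open>x\<close>, so the neighbourhood on which \<open>s\<close> is a fraction becomes the
  locus where the denominator does not vanish. In the same way the degrees can be raised: exactness for
  forms lowers the degree of the numerator, which must therefore not be too small.
\<close>

lemma section_local:
  assumes U: "openin P3 U" and s: "is_section scl n U s" and x: "x \<in> cone U"
  obtains h F d e where "form (*) UNIV e h" "form scl UNIV d F" "int d = int e + n" "k \<le> d" "0 < e"
    "h x \<noteq> 0" "nonvanishing h \<subseteq> U" "\<And>y. h y \<noteq> 0 \<Longrightarrow> s y = fraction h F y"
proof -
  obtain V F g d e where V: "openin P3 V" "vec.span {x} \<in> V" "V \<subseteq> U"
    and F: "homogeneous d F" "homogeneous e g" "int d = int e + n"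
    and eq: "\<And>y. y \<in> cone V \<Longrightarrow> poly_eval (*) g y \<noteq> 0 \<and> s y = scl (inverse (poly_eval (*) g y)) (poly_eval scl F y)"
    using s span_in_cone[OF x] unfolding is_section_def by metis
  have x0: "x \<noteq> 0" using x by auto
  have F': "form scl UNIV d (poly_eval scl F)" and g': "form (*) UNIV e (poly_eval (*) g)"
    using F form_iff_homogeneous scalars.form_iff_homogeneous by blast+
  have xV: "x \<in> cone V" using V(2) x0 by (simp add: cone_def)
  \<comment> \<open>\<open>b\<close> shrinks the neighbourhood, \<open>q\<close> raises the degree\<close>
  obtain b m where b: "form (*) UNIV m b" "0 < m" "b x \<noteq> 0" "nonvanishing b \<subseteq> V"
    using open_basis[OF V(1) xV] .
  obtain q where q: "form (*) UNIV k q" "q x \<noteq> (0::complex)"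
    using coordinate_power_nonzero[OF x0] .
  have r: "form (*) UNIV (m + k) (\<lambda>y. b y * q y)" by (rule form_mult_scalar[OF b(1) q(1)])
  show thesis
  proof (rule that[OF form_mult_scalar[OF r g'] form_mult[OF r F']])
    show "int (m + k + d) = int (m + k + e) + n" using F(3) by simp
    show "b x * q x * poly_eval (*) g x \<noteq> 0" using b q eq[OF xV] by simp
    have sub: "nonvanishing (\<lambda>y. b y * q y * poly_eval (*) g y) \<subseteq> V"
      using b(4) by (auto simp: nonvanishing_def)
    then show "nonvanishing (\<lambda>y. b y * q y * poly_eval (*) g y) \<subseteq> U" using V(3) by blast
    show "s y = fraction (\<lambda>y. b y * q y * poly_eval (*) g y) (\<lambda>x. scl (b x * q x) (poly_eval scl F x)) y"
      if y: "b y * q y * poly_eval (*) g y \<noteq> 0" for y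
    proof -
      have "y \<in> cone V"
        using sub cone_nonvanishing'[OF form_mult_scalar[OF r g']] cone_mono[OF sub] y b(2) by auto
      then have "s y = scl (inverse (poly_eval (*) g y)) (poly_eval scl F y)" using eq by blast
      then show ?thesis using y by (simp add: fraction_def field_simps)
    qed
  qed (use b(2) in auto)
qed

lemma section_intro:
  assumes U: "openin P3 U" and supp: "\<And>x. x \<notin> cone U \<Longrightarrow> s x = 0"
    and loc: "\<And>x. x \<in> cone U \<Longrightarrow> fraction_near n U s x"
  shows "is_section scl n U s"
  unfolding is_section_def
proof (intro conjI allI impI ballI)
  fix x assume "x \<notin> cone U" then show "s x = 0" by (rule supp)
next
  fix p assume "p \<in> U"
  then obtain x where x: "x \<in> cone U" "p = vec.span {x}" using open_point[OF U] by blast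
  obtain h F d e where h: "form (*) UNIV e h" "form scl UNIV d F" "int d = int e + n" "h x \<noteq> 0"
    and eq: "\<And>y. y \<in> cone U \<Longrightarrow> h y \<noteq> 0 \<Longrightarrow> s y = fraction h F y"
    using loc[OF x(1)] unfolding fraction_near_def by blast
  obtain h' F' where h': "homogeneous e h'" "h = poly_eval (*) h'" and F': "homogeneous d F'" "F = poly_eval scl F'"
    using h(1,2) form_iff_homogeneous scalars.form_iff_homogeneous by blast
  show "\<exists>V. openin P3 V \<and> p \<in> V \<and> V \<subseteq> U \<and>
      (\<exists>F g d e. homogeneous d F \<and> homogeneous e g \<and> int d = int e + n \<and>
        (\<forall>x\<in>cone V. poly_eval (*) g x \<noteq> 0 \<and> s x = scl (inverse (poly_eval (*) g x)) (poly_eval scl F x)))"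
  proof (intro exI conjI)
    show "openin P3 (U \<inter> nonvanishing h)" using U openin_nonvanishing[OF h(1)] by blast
    show "p \<in> U \<inter> nonvanishing h" using \<open>p \<in> U\<close> x h(4) by (auto simp: nonvanishing_def cone_def)
    show "\<forall>x\<in>cone (U \<inter> nonvanishing h). poly_eval (*) h' x \<noteq> 0 \<and> s x = scl (inverse (poly_eval (*) h' x)) (poly_eval scl F' x)"
      using eq cone_nonvanishing[OF h(1)] by (auto simp: cone_Int fraction_def h' F')
  qed (use h h' F' in auto)
qed

lemma section_near:
  assumes "openin P3 U" "is_section scl n U s" "x \<in> cone U"
  obtains h F d e where "form (*) UNIV e h" "form scl UNIV d F" "int d = int e + n"
    "h x \<noteq> 0" "\<And>y. h y \<noteq> 0 \<Longrightarrow> s y = fraction h F y"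
  by (rule section_local[OF assms, of 0], rule that)

lemma section_fraction:
  assumes "form (*) UNIV e h" "0 < e" "form scl UNIV d F" "int d = int e + n"
  shows "is_section scl n (nonvanishing h) (fraction h F)"
proof (rule section_intro)
  show "openin P3 (nonvanishing h)" by (rule openin_nonvanishing[OF assms(1)])
  show "fraction h F x = 0" if "x \<notin> cone (nonvanishing h)" for x
    using that cone_nonvanishing'[OF assms(1,2)] by (auto simp: fraction_zero)
  show "fraction_near n (nonvanishing h) (fraction h F) x" if "x \<in> cone (nonvanishing h)" for x
    using that unfolding cone_nonvanishing'[OF assms(1,2)] by (rule fraction_nearI[OF assms(1,3,4) _ refl])
qed

lemma section_glue:
  assumes U: "openin P3 U" and supp: "\<And>x. x \<notin> cone U \<Longrightarrow> s x = 0"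
    and loc: "\<And>x. x \<in> cone U \<Longrightarrow> \<exists>V t. openin P3 V \<and> x \<in> cone V \<and> is_section scl n V t \<and> (\<forall>y\<in>cone V. s y = t y)"
  shows "is_section scl n U s"
proof (rule section_intro[OF U supp])
  fix x assume "x \<in> cone U"
  then obtain V t where V: "openin P3 V" "x \<in> cone V" "is_section scl n V t" and eq: "\<forall>y\<in>cone V. s y = t y"
    using loc[OF \<open>x \<in> cone U\<close>] by (elim exE conjE)
  obtain h F d e where h: "form (*) UNIV e h" "form scl UNIV d F" "int d = int e + n" "0 < e"
    "h x \<noteq> 0" "nonvanishing h \<subseteq> V" "\<And>y. h y \<noteq> 0 \<Longrightarrow> t y = fraction h F y"
    by (rule section_local[OF V(1) V(3) V(2), of 0], rule that)
  have "s y = fraction h F y" if "h y \<noteq> 0" for y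
  proof -
    have "y \<in> cone V" using that cone_nonvanishing'[OF h(1,4)] cone_mono[OF h(6)] by blast
    then show ?thesis using eq h(7)[OF that] by simp
  qed
  then show "fraction_near n U s x"
    by (rule fraction_nearI[OF h(1,2,3,5)])
qed

lemma section_restrict:
  assumes U: "openin P3 U" and V: "openin P3 V" "V \<subseteq> U" and s: "is_section scl n U s"
  shows "is_section scl n V (restrict_to V s)"
proof (rule section_intro[OF V(1)])
  show "restrict_to V s x = 0" if "x \<notin> cone V" for x using that by (simp add: restrict_to_def)
  fix x assume x: "x \<in> cone V"
  then have xU: "x \<in> cone U" using cone_mono[OF V(2)] by blast
  obtain h F d e where h: "form (*) UNIV e h" "form scl UNIV d F" "int d = int e + n"
    "h x \<noteq> 0" "\<And>y. h y \<noteq> 0 \<Longrightarrow> s y = fraction h F y"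
    by (rule section_near[OF U s xU], rule that)
  show "fraction_near n V (restrict_to V s) x"
    by (rule fraction_nearI[OF h(1-4)]) (simp add: restrict_to_def h(5))
qed

text \<open>
  The numerator \<open>0\<close> has every degree, but for \<open>n < 0\<close> the denominator needs degree at least \<open>- n\<close>.
\<close>

lemma section_0 [simp]: "openin P3 U \<Longrightarrow> is_section scl n U (\<lambda>x. 0)"
proof (rule section_intro)
  fix x :: "complex ^ 4" assume "x \<in> cone U"
  then obtain g where g: "form (*) UNIV (nat (- n)) g" "g x \<noteq> (0::complex)"
    using coordinate_power_nonzero[of x "nat (- n)"] by (metis zero_notin_cone)
  have "int (nat n) = int (nat (- n)) + n" by simp
  then show "fraction_near n U (\<lambda>x. 0) x"
    by (rule fraction_nearI[OF g(1) form_0 _ g(2)]) (simp add: fraction_def)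
qed auto

lemma section_add:
  assumes U: "openin P3 U" and s: "is_section scl n U s" and t: "is_section scl n U t"
  shows "is_section scl n U (\<lambda>x. s x + t x)"
proof (rule section_intro[OF U])
  show "s x + t x = 0" if "x \<notin> cone U" for x using that section_supp[OF s] section_supp[OF t] by simp
  fix x assume x: "x \<in> cone U"
  obtain h F d e where h: "form (*) UNIV e h" "form scl UNIV d F" "int d = int e + n"
    "h x \<noteq> 0" "\<And>y. h y \<noteq> 0 \<Longrightarrow> s y = fraction h F y"
    by (rule section_near[OF U s x], rule that)
  obtain h' F' d' e' where h': "form (*) UNIV e' h'" "form scl UNIV d' F'" "int d' = int e' + n"
    "h' x \<noteq> 0" "\<And>y. h' y \<noteq> 0 \<Longrightarrow> t y = fraction h' F' y"
    by (rule section_near[OF U t x], rule that)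
  have e: "e' + d = e + d'" using h(3) h'(3) by simp
  have FF: "form scl UNIV (e' + d) (\<lambda>y. scl (h' y) (F y) + scl (h y) (F' y))"
    by (rule form_add[OF form_mult[OF h'(1) h(2)] form_mult[OF h(1) h'(2), folded e]])
  have hh: "form (*) UNIV (e' + e) (\<lambda>y. h' y * h y)"
    by (rule form_mult_scalar[OF h'(1) h(1)])
  have dd: "int (e' + d) = int (e' + e) + n" using h(3) by simp
  have nz: "h' x * h x \<noteq> 0" using h(4) h'(4) by simp
  have eq: "s y + t y = fraction (\<lambda>y. h' y * h y) (\<lambda>y. scl (h' y) (F y) + scl (h y) (F' y)) y" if "h' y * h y \<noteq> 0" for y
  proof -
    have "inverse (h' y * h y) * h' y = inverse (h y)" "inverse (h' y * h y) * h y = inverse (h' y)"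
      using that by (auto simp: field_simps)
    then show ?thesis using that h(5) h'(5) by (simp only: fraction_def scale_right_distrib scale_scale) auto
  qed
  show "fraction_near n U (\<lambda>x. s x + t x) x"
    by (rule fraction_nearI[OF hh FF dd nz eq])
qed

lemma section_smult:
  assumes U: "openin P3 U" and f: "is_section (*) m U f" and s: "is_section scl n U s"
  shows "is_section scl (m + n) U (\<lambda>x. scl (f x) (s x))"
proof (rule section_intro[OF U])
  show "scl (f x) (s x) = 0" if "x \<notin> cone U" for x using that section_supp[OF s] by simp
  fix x assume x: "x \<in> cone U"
  obtain h F d e where h: "form (*) UNIV e h" "form scl UNIV d F" "int d = int e + n"
    "h x \<noteq> 0" "\<And>y. h y \<noteq> 0 \<Longrightarrow> s y = fraction h F y"
    by (rule section_near[OF U s x], rule that)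
  obtain h' F' d' e' where h': "form (*) UNIV e' h'" "form (*) UNIV d' F'" "int d' = int e' + m"
    "h' x \<noteq> 0" "\<And>y. h' y \<noteq> 0 \<Longrightarrow> f y = scalars.fraction h' F' y"
    by (rule scalars.section_near[OF U f x], rule that)
  have FF: "form scl UNIV (d' + d) (\<lambda>y. scl (F' y) (F y))"
    by (rule form_mult[OF h'(2) h(2)])
  have hh: "form (*) UNIV (e' + e) (\<lambda>y. h' y * h y)"
    by (rule form_mult_scalar[OF h'(1) h(1)])
  have dd: "int (d' + d) = int (e' + e) + (m + n)" using h(3) h'(3) by simp
  have nz: "h' x * h x \<noteq> 0" using h(4) h'(4) by simp
  have eq: "scl (f y) (s y) = fraction (\<lambda>y. h' y * h y) (\<lambda>y. scl (F' y) (F y)) y" if "h' y * h y \<noteq> 0" for y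
    using that h(5) h'(5) by (auto simp: fraction_def scalars.fraction_def mult_ac)
  show "fraction_near (m + n) U (\<lambda>x. scl (f x) (s x)) x"
    by (rule fraction_nearI[OF hh FF dd nz eq])
qed

lemma section_coord:
  assumes U: "openin P3 U" and s: "is_section scl n U s"
  shows "is_section scl (n + 1) U (\<lambda>x. scl (x $ i) (s x))"
proof (rule section_intro[OF U])
  show "scl (x $ i) (s x) = 0" if "x \<notin> cone U" for x using that section_supp[OF s] by simp
  fix x assume x: "x \<in> cone U"
  obtain h F d e where h: "form (*) UNIV e h" "form scl UNIV d F" "int d = int e + n"
    "h x \<noteq> 0" "\<And>y. h y \<noteq> 0 \<Longrightarrow> s y = fraction h F y"
    by (rule section_near[OF U s x], rule that)
  have FF: "form scl UNIV (Suc d) (\<lambda>y. scl (y $ i) (F y))" using form_coord[OF _ h(2)] by simp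
  have dd: "int (Suc d) = int e + (n + 1)" using h(3) by simp
  have eq: "scl (y $ i) (s y) = fraction h (\<lambda>y. scl (y $ i) (F y)) y" if "h y \<noteq> 0" for y
    using that h(5) by (simp add: fraction_def mult.commute)
  show "fraction_near (n + 1) U (\<lambda>x. scl (x $ i) (s x)) x"
    by (rule fraction_nearI[OF h(1) FF dd h(4) eq])
qed

end

lemma section_comp_linear:
  assumes "complex_vector_space scl" "complex_vector_space scl'" and T: "Vector_Spaces.linear scl scl' T"
    and U: "openin P3 U" and s: "is_section scl n U s"
  shows "is_section scl' n U (\<lambda>x. T (s x))"
proof -
  interpret V: complex_vector_space scl by fact
  interpret W: complex_vector_space scl' by fact
  interpret T: Vector_Spaces.linear scl scl' T by fact
  show ?thesis
  proof (rule W.section_intro[OF U])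
    show "T (s x) = 0" if "x \<notin> cone U" for x using that V.section_supp[OF s] T.zero by simp
    fix x assume x: "x \<in> cone U"
    obtain h F d e where h: "form (*) UNIV e h" "form scl UNIV d F" "int d = int e + n"
      "h x \<noteq> 0" "\<And>y. h y \<noteq> 0 \<Longrightarrow> s y = V.fraction h F y"
      by (rule V.section_near[OF U s x], rule that)
    have FF: "form scl' UNIV d (\<lambda>y. T (F y))" by (rule form_comp_linear[OF T h(2)])
    have eq: "T (s y) = W.fraction h (\<lambda>y. T (F y)) y" if "h y \<noteq> 0" for y
      using that h(5) by (simp add: V.fraction_def W.fraction_def T.scale)
    show "W.fraction_near n U (\<lambda>x. T (s x)) x"
      by (rule W.fraction_nearI[OF h(1) FF h(3,4) eq])
  qed
qed

context complex_vector_space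
begin

lemma section_minus:
  assumes "openin P3 U" "is_section scl n U s"
  shows "is_section scl n U (\<lambda>x. - s x)"
  using section_comp_linear[OF complex_vector_space_axioms complex_vector_space_axioms linear_scale_const assms, of "-1"]
  by simp

lemma section_diff:
  assumes "openin P3 U" "is_section scl n U s" "is_section scl n U t"
  shows "is_section scl n U (\<lambda>x. s x - t x)"
  using section_add[OF assms(1,2) section_minus[OF assms(1,3)]] by simp

lemma section_sum:
  assumes "openin P3 U" "\<And>j. j \<in> J \<Longrightarrow> is_section scl n U (s j)"
  shows "is_section scl n U (\<lambda>x. \<Sum>j\<in>J. s j x)"
  using assms(2)
proof (induction J rule: infinite_finite_induct)
  case (insert j J)
  have "is_section scl n U (\<lambda>x. s j x + (\<Sum>j\<in>J. s j x))"
    by (rule section_add[OF assms(1)]) (use insert in auto)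
  then show ?case using insert(1,2) by simp
qed (use assms(1) in simp_all)

end

section \<open>Direct sums of coefficient spaces\<close>

context
  fixes s1 :: "complex \<Rightarrow> 'a \<Rightarrow> 'a::ab_group_add" and s2 :: "complex \<Rightarrow> 'b \<Rightarrow> 'b::ab_group_add"
  assumes s1: "complex_vector_space s1" and s2: "complex_vector_space s2"
begin

interpretation V1: complex_vector_space s1 by (rule s1)
interpretation V2: complex_vector_space s2 by (rule s2)
interpretation P: vector_space_prod s1 s2 ..

lemma prod_scale_apply: "module_prod.scale s1 s2 c p = (s1 c (fst p), s2 c (snd p))"
  by (simp add: P.scale_def)

lemma complex_vector_space_prod: "complex_vector_space (module_prod.scale s1 s2)"
  by (intro complex_vector_space.intro) (rule P.p.vector_space_axioms)

interpretation VP: complex_vector_space "module_prod.scale s1 s2" by (rule complex_vector_space_prod)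

lemma linear_fst: "Vector_Spaces.linear (module_prod.scale s1 s2) s1 fst"
  by unfold_locales (simp_all add: prod_scale_apply)

lemma linear_snd: "Vector_Spaces.linear (module_prod.scale s1 s2) s2 snd"
  by unfold_locales (simp_all add: prod_scale_apply)

lemma linear_inl: "Vector_Spaces.linear s1 (module_prod.scale s1 s2) (\<lambda>u. (u, 0))"
  by unfold_locales (simp_all add: prod_scale_apply)

lemma linear_inr: "Vector_Spaces.linear s2 (module_prod.scale s1 s2) (\<lambda>v. (0, v))"
  by unfold_locales (simp_all add: prod_scale_apply)

lemma form_prod_iff:
  "form (module_prod.scale s1 s2) S d f \<longleftrightarrow> form s1 S d (\<lambda>x. fst (f x)) \<and> form s2 S d (\<lambda>x. snd (f x))"
proof
  assume "form (module_prod.scale s1 s2) S d f"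
  then show "form s1 S d (\<lambda>x. fst (f x)) \<and> form s2 S d (\<lambda>x. snd (f x))"
    by (intro conjI form_comp_linear[OF linear_fst] form_comp_linear[OF linear_snd])
next
  assume f: "form s1 S d (\<lambda>x. fst (f x)) \<and> form s2 S d (\<lambda>x. snd (f x))"
  have "form (module_prod.scale s1 s2) S d (\<lambda>x. (fst (f x), 0) + (0, snd (f x)))"
    by (rule VP.form_add[OF form_comp_linear[OF linear_inl conjunct1[OF f]] form_comp_linear[OF linear_inr conjunct2[OF f]]])
  then show "form (module_prod.scale s1 s2) S d f" by simp
qed

lemma section_prod_iff:
  assumes U: "openin P3 U"
  shows "is_section (module_prod.scale s1 s2) n U f \<longleftrightarrow>
    is_section s1 n U (\<lambda>x. fst (f x)) \<and> is_section s2 n U (\<lambda>x. snd (f x))"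
proof
  assume "is_section (module_prod.scale s1 s2) n U f"
  then show "is_section s1 n U (\<lambda>x. fst (f x)) \<and> is_section s2 n U (\<lambda>x. snd (f x))"
    by (intro conjI section_comp_linear[OF complex_vector_space_prod s1 linear_fst U]
        section_comp_linear[OF complex_vector_space_prod s2 linear_snd U])
next
  assume f: "is_section s1 n U (\<lambda>x. fst (f x)) \<and> is_section s2 n U (\<lambda>x. snd (f x))"
  have "is_section (module_prod.scale s1 s2) n U (\<lambda>x. (fst (f x), 0) + (0, snd (f x)))"
    by (rule VP.section_add[OF U
          section_comp_linear[OF s1 complex_vector_space_prod linear_inl U conjunct1[OF f]]
          section_comp_linear[OF s2 complex_vector_space_prod linear_inr U conjunct2[OF f]]])
  then show "is_section (module_prod.scale s1 s2) n U f" by simp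
qed

lemma finite_span_prod:
  assumes "finite b1" "module.span s1 b1 = UNIV" "finite b2" "module.span s2 b2 = UNIV"
  shows "\<exists>b. finite b \<and> module.span (module_prod.scale s1 s2) b = UNIV"
proof (intro exI conjI)
  show "finite ((\<lambda>u. (u, 0)) ` b1 \<union> (\<lambda>v. (0, v)) ` b2)" using assms by simp
  have "p \<in> P.p.span ((\<lambda>u. (u, 0)) ` b1 \<union> (\<lambda>v. (0, v)) ` b2)" for p
  proof -
    interpret i1: Vector_Spaces.linear s1 "module_prod.scale s1 s2" "\<lambda>u. (u, 0)" by (rule linear_inl)
    interpret i2: Vector_Spaces.linear s2 "module_prod.scale s1 s2" "\<lambda>v. (0, v)" by (rule linear_inr)
    have "(fst p, 0) \<in> P.p.span ((\<lambda>u. (u, 0)) ` b1)" "(0, snd p) \<in> P.p.span ((\<lambda>v. (0, v)) ` b2)"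
      unfolding i1.span_image i2.span_image using assms by auto
    then have "(fst p, 0) + (0, snd p) \<in> P.p.span ((\<lambda>u. (u, 0)) ` b1 \<union> (\<lambda>v. (0, v)) ` b2)"
      by (intro P.p.span_add) (auto intro: P.p.span_mono[THEN subsetD, rotated])
    then show ?thesis by simp
  qed
  then show "P.p.span ((\<lambda>u. (u, 0)) ` b1 \<union> (\<lambda>v. (0, v)) ` b2) = UNIV" by blast
qed

end

section \<open>The sheaves and morphisms of the monad\<close>

lemma twist_simps [simp]:
  "carrier (sec (twist scl n) U) = {s. is_section scl n U s}"
  "\<zero>\<^bsub>sec (twist scl n) U\<^esub> = (\<lambda>x. 0)"
  "add (sec (twist scl n) U) = (\<lambda>s t x. s x + t x)"
  "smult (sec (twist scl n) U) = (\<lambda>f s x. scl (f x) (s x))"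
  "res (twist scl n) U V s = restrict_to V s"
  by (simp_all add: twist_def restrict_to_def)

lemma O_P3_simps [simp]:
  "carrier (rsec O_P3 U) = {f. is_section (*) 0 U f}"
  "\<zero>\<^bsub>rsec O_P3 U\<^esub> = (\<lambda>x. 0)"
  "\<one>\<^bsub>rsec O_P3 U\<^esub> = (\<lambda>x. if x \<in> cone U then 1 else 0)"
  "add (rsec O_P3 U) = (\<lambda>f g x. f x + g x)"
  "mult (rsec O_P3 U) = (\<lambda>f g x. f x * g x)"
  "rres O_P3 U V f = restrict_to V f"
  by (simp_all add: O_P3_def restrict_to_def)

lemma sheaf_hom_matrix:
  assumes sect: "\<And>U s. openin P3 U \<Longrightarrow> is_section s1 n U s \<Longrightarrow> is_section s2 m U (\<lambda>x. M x (s x))"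
    and lin: "\<And>x. Vector_Spaces.linear s1 s2 (M x)"
  shows "sheaf_hom P3 O_P3 (twist s1 n) (twist s2 m) (matrix_hom M)"
proof -
  have add: "M x (u + v) = M x u + M x v" and scale: "M x (s1 c u) = s2 c (M x u)" and zero: "M x 0 = 0" for x u v c
  proof -
    interpret Vector_Spaces.linear s1 s2 "M x" by (rule lin)
    show "M x (u + v) = M x u + M x v" "M x (s1 c u) = s2 c (M x u)" "M x 0 = 0"
      by (rule add, rule scale, rule zero)
  qed
  show ?thesis
    using sect unfolding sheaf_hom_def matrix_hom_def
    by (auto simp: add scale zero restrict_to_def fun_eq_iff)
qed

text \<open>
  The form in which exactness for forms is applied: a preimage with the same denominator \<open>h\<close> gives
  a preimage over the locus where \<open>h\<close> does not vanish.
\<close>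

lemma im_sheaf_matrixI:
  assumes U: "openin P3 U" and s: "is_section s2 m U s"
    and vs: "complex_vector_space s1" and zero: "\<And>y. M y 0 = 0"
    and loc: "\<And>x. x \<in> cone U \<Longrightarrow> \<exists>h F e d. form (*) UNIV e h \<and> 0 < e \<and> h x \<noteq> 0 \<and> nonvanishing h \<subseteq> U \<and>
      form s1 UNIV d F \<and> int d = int e + n \<and> (\<forall>y. h y \<noteq> 0 \<longrightarrow> s y = M y (s1 (inverse (h y)) (F y)))"
  shows "s \<in> im_sheaf P3 (twist s1 n) (twist s2 m) (matrix_hom M) U"
  unfolding im_sheaf_def
proof (intro CollectI conjI ballI)
  interpret V: complex_vector_space s1 by (rule vs)
  show "s \<in> carrier (sec (twist s2 m) U)" using s by simp
  fix p assume "p \<in> U"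
  then obtain x where x: "x \<in> cone U" "p = vec.span {x}" using open_point[OF U] by blast
  obtain h F e d where h: "form (*) UNIV e h" "0 < e" "h x \<noteq> 0" "nonvanishing h \<subseteq> U"
    and F: "form s1 UNIV d F" "int d = int e + n"
    and eq: "\<forall>y. h y \<noteq> 0 \<longrightarrow> s y = M y (s1 (inverse (h y)) (F y))"
    using loc[OF x(1)] by (elim exE conjE)
  have "restrict_to (nonvanishing h) s = matrix_hom M (nonvanishing h) (V.fraction h F)"
    using eq by (auto simp: fun_eq_iff restrict_to_def matrix_hom_def V.fraction_def cone_nonvanishing'[OF h(1,2)] zero)
  moreover have "is_section s1 n (nonvanishing h) (V.fraction h F)"
    by (rule V.section_fraction[OF h(1,2) F])
  ultimately show "\<exists>V. openin P3 V \<and> p \<in> V \<and> V \<subseteq> U \<and>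
       (\<exists>t\<in>carrier (sec (twist s1 n) V). res (twist s2 m) U V s = matrix_hom M V t)"
    using openin_nonvanishing[OF h(1)] h(3,4) x span_in_cone[of x "nonvanishing h"] cone_nonvanishing'[OF h(1,2), of x]
    by (intro exI[of _ "nonvanishing h"] conjI bexI[of _ "V.fraction h F"]) auto
qed

lemma im_sheaf_matrixD:
  assumes U: "openin P3 U" and s: "s \<in> im_sheaf P3 (twist s1 n) (twist s2 m) (matrix_hom M) U"
    and x: "x \<in> cone U"
  obtains t V where "is_section s1 n V t" "x \<in> cone V" "V \<subseteq> U" "openin P3 V" "\<And>y. y \<in> cone V \<Longrightarrow> s y = M y (t y)"
proof -
  obtain V t where V: "openin P3 V" "vec.span {x} \<in> V" "V \<subseteq> U" "is_section s1 n V t" "restrict_to V s = matrix_hom M V t"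
    using s span_in_cone[OF x] unfolding im_sheaf_def by auto
  have "s y = M y (t y)" if "y \<in> cone V" for y
    using fun_cong[OF V(5), of y] that by (simp add: restrict_to_def matrix_hom_def)
  moreover have "x \<in> cone V" using V(2) x by (auto simp: cone_def)
  ultimately show thesis using that V by blast
qed

text \<open>
  A linear relation between fractions, multiplied by the denominator, is a relation between forms
  on a nonempty open set, hence everywhere.
\<close>

lemma fraction_relation:
  assumes vs: "complex_vector_space s2" and lin: "\<And>y. Vector_Spaces.linear s1 s2 (M y)"
    and h: "form (*) UNIV e h" "h x \<noteq> (0::complex)" and F: "form s2 UNIV d (\<lambda>y. M y (F y))"
    and zero: "\<And>y. h y \<noteq> 0 \<Longrightarrow> M y (s1 (inverse (h y)) (F y)) = 0"
  shows "M y (F y) = 0"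
proof -
  interpret V: complex_vector_space s2 by (rule vs)
  show ?thesis
  proof (rule V.form_density[OF h(1) F h(2)])
    fix y assume y: "h y \<noteq> 0"
    interpret M: Vector_Spaces.linear s1 s2 "M y" by (rule lin)
    show "M y (F y) = 0" using zero[OF y] y by (simp add: M.scale)
  qed
qed

text \<open>
  Finite dimension enters through a finite spanning set, from which the direct sum decompositions of
  the twisted sheaves and the polynomial equations for the \<open>B\<^sub>i\<close> are obtained.
\<close>

locale adhm = complex_vector_space scl
  for scl :: "complex \<Rightarrow> 'v \<Rightarrow> 'v::ab_group_add" +
  fixes B0 B1 B2 :: "'v \<Rightarrow> 'v" and I :: "complex \<Rightarrow> 'v"
  assumes stable: "(B0, B1, B2, I) \<in> stable_adhm_data scl"
    and finite_dimensional: "\<exists>b. finite b \<and> span b = UNIV"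
begin

lemma lin:
  "Vector_Spaces.linear scl scl B0" "Vector_Spaces.linear scl scl B1" "Vector_Spaces.linear scl scl B2"
  and comm: "B0 \<circ> B1 = B1 \<circ> B0" "B0 \<circ> B2 = B2 \<circ> B0" "B1 \<circ> B2 = B2 \<circ> B1"
  and linI: "Vector_Spaces.linear (*) scl I"
  using stable unfolding stable_adhm_data_def adhm_data_def by auto

lemma stability:
  assumes "subspace S" "\<And>v. v \<in> S \<Longrightarrow> B0 v \<in> S" "\<And>v. v \<in> S \<Longrightarrow> B1 v \<in> S" "\<And>v. v \<in> S \<Longrightarrow> B2 v \<in> S" "\<And>c. I c \<in> S"
  shows "S = UNIV"
proof (rule ccontr)
  assume "S \<noteq> UNIV"
  moreover have "B0 ` S \<subseteq> S" "B1 ` S \<subseteq> S" "B2 ` S \<subseteq> S" "range I \<subseteq> S"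
    using assms(2-5) by auto
  ultimately have "\<exists>S. subspace S \<and> S \<noteq> UNIV \<and> B0 ` S \<subseteq> S \<and> B1 ` S \<subseteq> S \<and> B2 ` S \<subseteq> S \<and> range I \<subseteq> S"
    using assms(1) by (intro exI[of _ S] conjI)
  moreover have "\<not> (\<exists>S. subspace S \<and> S \<noteq> UNIV \<and> B0 ` S \<subseteq> S \<and> B1 ` S \<subseteq> S \<and> B2 ` S \<subseteq> S \<and> range I \<subseteq> S)"
    using stable unfolding stable_adhm_data_def by simp
  ultimately show False by contradiction
qed

abbreviation A0 where "A0 \<equiv> A 0 B0"
abbreviation A1 where "A1 \<equiv> A 1 B1"
abbreviation A2 where "A2 \<equiv> A 2 B2"
abbreviation scl3 where "scl3 \<equiv> scale3 scl"
abbreviation scl3W where "scl3W \<equiv> scale3W scl"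
abbreviation al2 where "al2 \<equiv> alpha_m2 scl B0 B1 B2"
abbreviation al1 where "al1 \<equiv> alpha_m1 scl B0 B1 B2"
abbreviation al0 where "al0 \<equiv> alpha_0 scl B0 B1 B2 I"

sublocale A0: Vector_Spaces.linear scl scl "A0 x" for x by (rule linear_A[OF lin(1)])
sublocale A1: Vector_Spaces.linear scl scl "A1 x" for x by (rule linear_A[OF lin(2)])
sublocale A2: Vector_Spaces.linear scl scl "A2 x" for x by (rule linear_A[OF lin(3)])
sublocale I: Vector_Spaces.linear "(*)" scl I by (rule linI)

lemma A01: "A0 x (A1 x v) = A1 x (A0 x v)" by (rule A_commute[OF lin(1,2) comm(1)])
lemma A02: "A0 x (A2 x v) = A2 x (A0 x v)" by (rule A_commute[OF lin(1,3) comm(2)])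
lemma A12: "A1 x (A2 x v) = A2 x (A1 x v)" by (rule A_commute[OF lin(2,3) comm(3)])

lemma alpha_A:
  "al2 x v = (- A2 x v, A1 x v, - A0 x v)"
  "al1 x (u, v, w) = ((A1 x u + A2 x v, - A0 x u + A2 x w, - A0 x v - A1 x w), 0)"
  "al0 x ((u, v, w), c) = A0 x u + A1 x v + A2 x w + scl (x $ 3) (I c)"
  by (simp_all add: alpha_m2_def alpha_m1_def alpha_0_def A_def)

lemma vs: "complex_vector_space scl" by (rule complex_vector_space_axioms)
lemma vs2: "complex_vector_space (module_prod.scale scl scl)" by (rule complex_vector_space_prod[OF vs vs])
lemma vs3: "complex_vector_space scl3" unfolding scale3_def by (rule complex_vector_space_prod[OF vs vs2])
lemma vs3W: "complex_vector_space scl3W" unfolding scale3W_def by (rule complex_vector_space_prod[OF vs3 complex_vector_space_self])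

lemma scl3_apply [simp]: "scl3 c (u, v, w) = (scl c u, scl c v, scl c w)"
  unfolding scale3_def by (simp add: prod_scale_apply[OF vs vs2] prod_scale_apply[OF vs vs])

lemma scl3W_apply [simp]: "scl3W c (t, a) = (scl3 c t, c * a)"
  unfolding scale3W_def by (simp add: prod_scale_apply[OF vs3 complex_vector_space_self])

lemma form_scl3:
  "form scl3 S d f \<longleftrightarrow> form scl S d (\<lambda>x. fst (f x)) \<and> form scl S d (\<lambda>x. fst (snd (f x))) \<and> form scl S d (\<lambda>x. snd (snd (f x)))"
  unfolding scale3_def form_prod_iff[OF vs vs2] form_prod_iff[OF vs vs] ..

lemma form_scl3W: "form scl3W S d f \<longleftrightarrow> form scl3 S d (\<lambda>x. fst (f x)) \<and> form (*) S d (\<lambda>x. snd (f x))"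
  unfolding scale3W_def by (rule form_prod_iff[OF vs3 complex_vector_space_self])

lemma section_scl3:
  "openin P3 U \<Longrightarrow> is_section scl3 n U f \<longleftrightarrow> is_section scl n U (\<lambda>x. fst (f x)) \<and>
    is_section scl n U (\<lambda>x. fst (snd (f x))) \<and> is_section scl n U (\<lambda>x. snd (snd (f x)))"
  unfolding scale3_def by (simp only: section_prod_iff[OF vs vs2] section_prod_iff[OF vs vs])

lemma section_scl3W:
  "openin P3 U \<Longrightarrow> is_section scl3W n U f \<longleftrightarrow> is_section scl3 n U (\<lambda>x. fst (f x)) \<and> is_section (*) n U (\<lambda>x. snd (f x))"
  unfolding scale3W_def by (rule section_prod_iff[OF vs3 complex_vector_space_self])

lemma section_A:
  assumes T: "Vector_Spaces.linear scl scl T" and U: "openin P3 U" and s: "is_section scl n U s"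
  shows "is_section scl (n + 1) U (\<lambda>x. A i T x (s x))"
  unfolding A_def
  by (rule section_diff[OF U section_coord[OF U section_comp_linear[OF vs vs T U s]] section_coord[OF U s]])

lemma linear_al2: "Vector_Spaces.linear scl scl3 (al2 x)"
proof -
  interpret V3: complex_vector_space scl3 by (rule vs3)
  show ?thesis
    by unfold_locales (simp_all add: alpha_A A0.add A1.add A2.add A0.scale A1.scale A2.scale)
qed

lemma linear_al1: "Vector_Spaces.linear scl3 scl3W (al1 x)"
proof -
  interpret V3: complex_vector_space scl3 by (rule vs3)
  interpret V3W: complex_vector_space scl3W by (rule vs3W)
  have "al1 x (p + q) = al1 x p + al1 x q" for p q
    by (cases p; cases q) (simp add: alpha_A A0.add A1.add A2.add)
  moreover have "al1 x (scl3 c p) = scl3W c (al1 x p)" for c p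
    by (cases p) (simp add: alpha_A A0.scale A1.scale A2.scale scale_right_distrib scale_right_diff_distrib)
  ultimately show ?thesis by unfold_locales
qed

lemma linear_al0: "Vector_Spaces.linear scl3W scl (al0 x)"
proof -
  interpret V3W: complex_vector_space scl3W by (rule vs3W)
  have "al0 x (p + q) = al0 x p + al0 x q" for p q
    by (cases p; cases q; cases "fst p"; cases "fst q")
      (simp add: alpha_A A0.add A1.add A2.add I.add scale_right_distrib)
  moreover have "al0 x (scl3W c p) = scl c (al0 x p)" for c p
  proof -
    obtain u v w a where p: "p = ((u, v, w), a)" by (metis surj_pair)
    have "scl (x $ 3) (I (c * a)) = scl c (scl (x $ 3) (I a))"
      by (simp only: I.scale) (rule scale_left_commute)
    then show ?thesis
      by (simp add: p alpha_A A0.scale A1.scale A2.scale scale_right_distrib)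
  qed
  ultimately show ?thesis by unfold_locales
qed

lemma section_al2:
  assumes U: "openin P3 U" and s: "is_section scl n U s"
  shows "is_section scl3 (n + 1) U (\<lambda>x. al2 x (s x))"
  unfolding section_scl3[OF U] alpha_A fst_conv snd_conv
  by (intro conjI section_minus[OF U] section_A[OF _ U s] lin)

lemma section_al1:
  assumes U: "openin P3 U" and s: "is_section scl3 n U s"
  shows "is_section scl3W (n + 1) U (\<lambda>x. al1 x (s x))"
proof -
  have s': "is_section scl n U (\<lambda>x. fst (s x))" "is_section scl n U (\<lambda>x. fst (snd (s x)))" "is_section scl n U (\<lambda>x. snd (snd (s x)))"
    using s unfolding section_scl3[OF U] by auto
  have "al1 x (s x) = al1 x (fst (s x), fst (snd (s x)), snd (snd (s x)))" for x by simp
  then show ?thesis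
    unfolding section_scl3[OF U] section_scl3W[OF U]
    by (simp only: alpha_A fst_conv snd_conv)
      (intro conjI section_add[OF U] section_diff[OF U] section_minus[OF U] section_A[OF _ U] lin s' scalars.section_0[OF U])
qed

lemma section_al0:
  assumes U: "openin P3 U" and s: "is_section scl3W n U s"
  shows "is_section scl (n + 1) U (\<lambda>x. al0 x (s x))"
proof -
  have s': "is_section scl n U (\<lambda>x. fst (fst (s x)))" "is_section scl n U (\<lambda>x. fst (snd (fst (s x))))"
    "is_section scl n U (\<lambda>x. snd (snd (fst (s x))))" "is_section (*) n U (\<lambda>x. snd (s x))"
    using s unfolding section_scl3[OF U] section_scl3W[OF U] by auto
  have "al0 x (s x) = al0 x ((fst (fst (s x)), fst (snd (fst (s x))), snd (snd (fst (s x)))), snd (s x))" for x by simp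
  then show ?thesis
    by (simp only: alpha_A fst_conv snd_conv)
      (intro section_add[OF U] section_A[OF _ U] lin s' section_coord[OF U] section_comp_linear[OF complex_vector_space_self vs linI U])
qed

lemma sheaf_hom_al2: "sheaf_hom P3 O_P3 (twist scl (-2)) (twist scl3 (-1)) (matrix_hom al2)"
  by (rule sheaf_hom_matrix[OF _ linear_al2]) (use section_al2[of _ "-2"] in simp)

lemma sheaf_hom_al1: "sheaf_hom P3 O_P3 (twist scl3 (-1)) (twist scl3W 0) (matrix_hom al1)"
  by (rule sheaf_hom_matrix[OF _ linear_al1]) (use section_al1[of _ "-1"] in simp)

lemma sheaf_hom_al0: "sheaf_hom P3 O_P3 (twist scl3W 0) (twist scl 1) (matrix_hom al0)"
  by (rule sheaf_hom_matrix[OF _ linear_al0]) (use section_al0[of _ 0] in simp)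

lemma al1_al2: "al1 x (al2 x v) = 0"
  by (simp add: alpha_A A0.neg A1.neg A2.neg A01 A02 A12 zero_prod_def)

lemma al0_al1: "al0 x (al1 x t) = 0"
  by (cases t) (simp add: alpha_A A0.neg A1.neg A2.neg A0.add A1.add A2.add A0.diff A1.diff A2.diff A01 A02 A12)

lemma al_0 [simp]: "al2 x 0 = 0" "al1 x 0 = 0" "al0 x 0 = 0"
proof -
  interpret al2: Vector_Spaces.linear scl scl3 "al2 x" by (rule linear_al2)
  interpret al1: Vector_Spaces.linear scl3 scl3W "al1 x" by (rule linear_al1)
  interpret al0: Vector_Spaces.linear scl3W scl "al0 x" by (rule linear_al0)
  show "al2 x 0 = 0" "al1 x 0 = 0" "al0 x 0 = 0" by (rule al2.zero, rule al1.zero, rule al0.zero)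
qed

end

section \<open>Exactness of the monad\<close>

\<comment> \<open>From here on constant forms are recognized by \<open>form_constant\<close>; unfolding them into an existential
  statement would get in the way of the simplifier.\<close>
declare form.simps(1) [simp del]

context adhm
begin

lemma kernel_al2:
  assumes U: "openin P3 U"
  shows "ker_sheaf (twist scl (-2)) (twist scl3 (-1)) (matrix_hom al2) U = {\<lambda>x. 0}"
proof (intro equalityI subsetI)
  fix s assume "s \<in> ker_sheaf (twist scl (-2)) (twist scl3 (-1)) (matrix_hom al2) U"
  then have s: "is_section scl (-2) U s" and zero: "\<And>x. al2 x (s x) = 0"
    by (auto simp: ker_sheaf_def a_kernel_def kernel_def matrix_hom_def fun_eq_iff)
  have "s x = 0" for x
  proof (cases "x \<in> cone U")
    case True
    obtain h F d e where h: "form (*) UNIV e h" and F: "form scl UNIV d F" and "h x \<noteq> 0"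
      and eq: "\<And>y. h y \<noteq> 0 \<Longrightarrow> s y = fraction h F y"
      by (rule section_near[OF U s True], rule that)
    have "A0 y (F y) = 0" for y
    proof (rule fraction_relation[where M = A0, OF vs A0.linear_axioms h \<open>h x \<noteq> 0\<close>])
      show "form scl UNIV (Suc d) (\<lambda>y. A0 y (F y))" by (rule form_A[OF lin(1) _ _ F]) simp_all
      show "A0 y (scl (inverse (h y)) (F y)) = 0" if "h y \<noteq> 0" for y
        using zero[of y] eq[OF that] by (simp add: alpha_A fraction_def zero_prod_def)
    qed
    then have "F = (\<lambda>x. 0)" using koszul_exact_3[OF lin(1) F] by blast
    then show ?thesis using eq \<open>h x \<noteq> 0\<close> by (simp add: fraction_def)
  next
    case False
    then show ?thesis using section_supp[OF s] by blast
  qed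
  then show "s \<in> {\<lambda>x. 0}" by auto
next
  fix s :: "complex ^ 4 \<Rightarrow> 'v" assume "s \<in> {\<lambda>x. 0}"
  then show "s \<in> ker_sheaf (twist scl (-2)) (twist scl3 (-1)) (matrix_hom al2) U"
    using section_0[OF U] by (simp add: ker_sheaf_def a_kernel_def kernel_def matrix_hom_def)
qed

text \<open>
  By \<open>section_local\<close> the numerators can be assumed to have positive degree; \<open>koszul_exact_2\<close> lowers that degree
  by one, in accordance with the twist by \<open>-2\<close> of the preimage.
\<close>

lemma kernel_al1:
  assumes U: "openin P3 U"
  shows "ker_sheaf (twist scl3 (-1)) (twist scl3W 0) (matrix_hom al1) U =
    im_sheaf P3 (twist scl (-2)) (twist scl3 (-1)) (matrix_hom al2) U"
proof (intro equalityI subsetI)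
  fix s assume "s \<in> ker_sheaf (twist scl3 (-1)) (twist scl3W 0) (matrix_hom al1) U"
  then have s: "is_section scl3 (-1) U s" and zero: "\<And>x. al1 x (s x) = 0"
    by (auto simp: ker_sheaf_def a_kernel_def kernel_def matrix_hom_def fun_eq_iff)
  show "s \<in> im_sheaf P3 (twist scl (-2)) (twist scl3 (-1)) (matrix_hom al2) U"
  proof (rule im_sheaf_matrixI[where M = al2, OF U s vs al_0(1)])
    fix x assume x: "x \<in> cone U"
    interpret V3: complex_vector_space scl3 by (rule vs3)
    obtain h F d e where h: "form (*) UNIV e h" and F: "form scl3 UNIV d F" and deg: "int d = int e + - 1" "1 \<le> d"
      and h2: "0 < e" "h x \<noteq> 0" "nonvanishing h \<subseteq> U"
      and eq: "\<And>y. h y \<noteq> 0 \<Longrightarrow> s y = V3.fraction h F y"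
      by (rule V3.section_local[OF U s x, of 1], rule that)
    obtain d' where d: "d = Suc d'" using deg(2) by (cases d) auto
    define u v w where "u = (\<lambda>y. fst (F y))" and "v = (\<lambda>y. fst (snd (F y)))" and "w = (\<lambda>y. snd (snd (F y)))"
    have uvw: "form scl UNIV (Suc d') u" "form scl UNIV (Suc d') v" "form scl UNIV (Suc d') w"
      using F unfolding form_scl3 d u_def v_def w_def by auto
    have F_eq: "F y = (u y, v y, w y)" for y by (simp add: u_def v_def w_def)
    have rel: "A1 y (u y) + A2 y (v y) = 0 \<and> - A0 y (u y) + A2 y (w y) = 0 \<and> - A0 y (v y) - A1 y (w y) = 0" for y
    proof -
      have a: "al1 y (F y) = ((A1 y (u y) + A2 y (v y), - A0 y (u y) + A2 y (w y), - A0 y (v y) - A1 y (w y)), 0)" for y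
        unfolding F_eq alpha_A ..
      have "al1 y (F y) = 0"
      proof (rule fraction_relation[where M = al1, OF vs3W linear_al1 h h2(2)])
        show "form scl3W UNIV (Suc (Suc d')) (\<lambda>y. al1 y (F y))"
          unfolding a form_scl3W form_scl3 fst_conv snd_conv
          by (intro conjI form_add form_diff form_minus form_A lin uvw UNIV_I scalars.form_0)
        show "al1 y (scl3 (inverse (h y)) (F y)) = 0" if "h y \<noteq> 0" for y
          using zero[of y] eq[OF that] by (simp add: V3.fraction_def)
      qed
      then show ?thesis unfolding a by (simp add: zero_prod_def)
    qed
    obtain t where t: "form scl UNIV d' t"
      "\<And>x. u x = - A2 x (t x)" "\<And>x. v x = A1 x (t x)" "\<And>x. w x = - A0 x (t x)"
      by (rule koszul_exact_2[OF lin comm uvw]) (use rel in blast)+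
    have "s y = al2 y (scl (inverse (h y)) (t y))" if "h y \<noteq> 0" for y
      unfolding eq[OF that] V3.fraction_def F_eq
      by (simp add: t(2-4) alpha_A A0.scale A1.scale A2.scale)
    moreover have "int d' = int e + - 2" using deg d by simp
    ultimately show "\<exists>h F e d. form (*) UNIV e h \<and> 0 < e \<and> h x \<noteq> 0 \<and> nonvanishing h \<subseteq> U \<and>
      form scl UNIV d F \<and> int d = int e + - 2 \<and> (\<forall>y. h y \<noteq> 0 \<longrightarrow> s y = al2 y (scl (inverse (h y)) (F y)))"
      using h h2 t(1) by (intro exI[of _ h] exI[of _ t] exI[of _ e] exI[of _ d'] conjI allI impI)
  qed
next
  fix s assume s: "s \<in> im_sheaf P3 (twist scl (-2)) (twist scl3 (-1)) (matrix_hom al2) U"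
  then have sec: "is_section scl3 (-1) U s" by (simp add: im_sheaf_def)
  interpret V3: complex_vector_space scl3 by (rule vs3)
  have "al1 x (s x) = 0" for x
  proof (cases "x \<in> cone U")
    case True
    show ?thesis
      by (rule im_sheaf_matrixD[where M = al2, OF U s True]) (simp add: al1_al2)
  qed (simp add: V3.section_supp[OF sec])
  then show "s \<in> ker_sheaf (twist scl3 (-1)) (twist scl3W 0) (matrix_hom al1) U"
    using sec by (simp add: ker_sheaf_def a_kernel_def kernel_def matrix_hom_def)
qed

lemma kernel_al0_iff:
  "s \<in> ker_sheaf (twist scl3W 0) (twist scl 1) (matrix_hom al0) U \<longleftrightarrow>
    is_section scl3W 0 U s \<and> (\<forall>x. al0 x (s x) = 0)"
  by (auto simp: ker_sheaf_def a_kernel_def kernel_def matrix_hom_def fun_eq_iff)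

text \<open>
  An element of the kernel whose \<open>W\<close>-component vanishes satisfies \<open>A\<^sub>0 u + A\<^sub>1 v + A\<^sub>2 w = 0\<close>, so it comes from the
  previous term by \<open>koszul_exact_1\<close>. This identifies cohomology classes with their \<open>W\<close>-components.
\<close>

lemma image_al1_iff:
  assumes U: "openin P3 U"
  shows "s \<in> im_sheaf P3 (twist scl3 (-1)) (twist scl3W 0) (matrix_hom al1) U \<longleftrightarrow>
    s \<in> ker_sheaf (twist scl3W 0) (twist scl 1) (matrix_hom al0) U \<and> (\<forall>x. snd (s x) = 0)"
    (is "?l \<longleftrightarrow> ?r")
proof
  interpret V3W: complex_vector_space scl3W by (rule vs3W)
  assume s: ?l
  then have sec: "is_section scl3W 0 U s" by (simp add: im_sheaf_def)
  have "al0 x (s x) = 0 \<and> snd (s x) = 0" for x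
  proof (cases "x \<in> cone U")
    case True
    obtain t V where "x \<in> cone V" "\<And>y. y \<in> cone V \<Longrightarrow> s y = al1 y (t y)"
      by (rule im_sheaf_matrixD[where M = al1, OF U s True], rule that)
    then have "s x = al1 x (t x)" by blast
    then show ?thesis by (cases "t x") (simp add: al0_al1, simp add: alpha_A)
  qed (simp add: V3W.section_supp[OF sec])
  then show ?r using sec by (simp add: kernel_al0_iff)
next
  interpret V3: complex_vector_space scl3 by (rule vs3)
  interpret V3W: complex_vector_space scl3W by (rule vs3W)
  assume r: ?r
  then have s: "is_section scl3W 0 U s" and zero: "\<And>x. al0 x (s x) = 0" and c: "\<And>x. snd (s x) = 0"
    by (auto simp: kernel_al0_iff)
  show ?l
  proof (rule im_sheaf_matrixI[where M = al1, OF U s vs3 al_0(2)])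
    fix x assume x: "x \<in> cone U"
    obtain h F d e where h: "form (*) UNIV e h" and F: "form scl3W UNIV d F" and deg: "int d = int e + 0" "1 \<le> d"
      and h2: "0 < e" "h x \<noteq> 0" "nonvanishing h \<subseteq> U"
      and eq: "\<And>y. h y \<noteq> 0 \<Longrightarrow> s y = V3W.fraction h F y"
      by (rule V3W.section_local[OF U s x, of 1], rule that)
    obtain d' where d: "d = Suc d'" using deg(2) by (cases d) auto
    define u v w where "u = (\<lambda>y. fst (fst (F y)))" and "v = (\<lambda>y. fst (snd (fst (F y))))" and "w = (\<lambda>y. snd (snd (fst (F y))))"
    have uvw: "form scl UNIV (Suc d') u" "form scl UNIV (Suc d') v" "form scl UNIV (Suc d') w"
      using F unfolding form_scl3W form_scl3 d u_def v_def w_def by auto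
    have F_eq: "fst (F y) = (u y, v y, w y)" for y by (simp add: u_def v_def w_def)
    have snd0: "snd (F y) = 0" if "h y \<noteq> 0" for y
      using c[of y] eq[OF that] that by (cases "F y") (simp add: V3W.fraction_def)
    have al0_F: "A0 y (u y) + A1 y (v y) + A2 y (w y) = 0" for y
    proof (rule form_density[OF h _ h2(2)])
      show "form scl UNIV (Suc (Suc d')) (\<lambda>y. A0 y (u y) + A1 y (v y) + A2 y (w y))"
        by (intro form_add form_A lin uvw UNIV_I)
      fix y assume y: "h y \<noteq> 0"
      have "s y = scl3W (inverse (h y)) ((u y, v y, w y), 0)"
        unfolding eq[OF y] V3W.fraction_def using snd0[OF y] F_eq[of y] by (metis prod.collapse)
      then have "scl (inverse (h y)) (A0 y (u y) + A1 y (v y) + A2 y (w y)) = 0"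
        using zero[of y] by (simp add: alpha_A A0.scale A1.scale A2.scale scale_right_distrib I.zero)
      then show "A0 y (u y) + A1 y (v y) + A2 y (w y) = 0" using y by simp
    qed
    have al0_F': "A0 y (u y) + A1 y (v y) + A2 y (w y) + 0 = 0" for y using al0_F by simp
    obtain a b c where abc: "form scl UNIV d' a" "form scl UNIV d' b" "form scl UNIV d' c"
      "\<And>x. u x = A1 x (a x) + A2 x (b x)" "\<And>x. v x = - A0 x (a x) + A2 x (c x)"
      "\<And>x. w x = - A0 x (b x) - A1 x (c x)"
      by (rule koszul_exact_1[OF lin comm uvw form_0 al0_F']) (rule that)
    have t: "form scl3 UNIV d' (\<lambda>y. (a y, b y, c y))" using abc by (simp add: form_scl3)
    have eq': "s y = al1 y (scl3 (inverse (h y)) (a y, b y, c y))" if "h y \<noteq> 0" for y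
    proof -
      interpret al1: Vector_Spaces.linear scl3 scl3W "al1 y" by (rule linear_al1)
      have "F y = al1 y (a y, b y, c y)"
        using F_eq[of y] snd0[OF that] by (cases "F y") (simp add: alpha_A abc(4-6))
      then show ?thesis unfolding eq[OF that] V3W.fraction_def al1.scale by simp
    qed
    have deg': "int d' = int e + - 1" using deg d by simp
    show "\<exists>h F e d. form (*) UNIV e h \<and> 0 < e \<and> h x \<noteq> 0 \<and> nonvanishing h \<subseteq> U \<and>
      form scl3 UNIV d F \<and> int d = int e + - 1 \<and> (\<forall>y. h y \<noteq> 0 \<longrightarrow> s y = al1 y (scl3 (inverse (h y)) (F y)))"
      using h h2 t eq' deg'
      by (intro exI[of _ h] exI[of _ "\<lambda>y. (a y, b y, c y)"] exI[of _ e] exI[of _ d'] conjI allI impI)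
  qed
qed

subsection \<open>Local surjectivity of the last map\<close>

text \<open>
  \<open>liftable x d F\<close>: near \<open>x\<close> the form \<open>F\<close> of degree \<open>d\<close> is the image of a fraction \<open>G / g\<close>. The equation
  \<open>k + 1 = e + d\<close> says that \<open>G / g\<close> has degree \<open>d - 1\<close>, written without subtraction.
\<close>

definition liftable :: "complex ^ 4 \<Rightarrow> nat \<Rightarrow> (complex ^ 4 \<Rightarrow> 'v) \<Rightarrow> bool" where
  "liftable x d F \<longleftrightarrow> (\<exists>e g k G. form (*) UNIV e g \<and> g x \<noteq> 0 \<and> form scl3W UNIV k G \<and> Suc k = e + d \<and>
     (\<forall>y. al0 y (G y) = scl (g y) (F y)))"

lemma liftableI:
  assumes "form (*) UNIV e g" "g x \<noteq> 0" "form scl3W UNIV k G" "Suc k = e + d" "\<And>y. al0 y (G y) = scl (g y) (F y)"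
  shows "liftable x d F"
  unfolding liftable_def using assms by (intro exI[of _ e] exI[of _ g] exI[of _ k] exI[of _ G]) simp

lemma liftableE:
  assumes "liftable x d F"
  obtains e g k G where "form (*) UNIV e g" "g x \<noteq> 0" "form scl3W UNIV k G" "Suc k = e + d" "\<And>y. al0 y (G y) = scl (g y) (F y)"
  using assms unfolding liftable_def by (elim exE conjE) (rule that, auto)

lemma al0_add: "al0 x (p + q) = al0 x p + al0 x q" and al0_scale: "al0 x (scl3W c p) = scl c (al0 x p)"
proof -
  interpret al0: Vector_Spaces.linear scl3W scl "al0 x" by (rule linear_al0)
  show "al0 x (p + q) = al0 x p + al0 x q" "al0 x (scl3W c p) = scl c (al0 x p)" by (rule al0.add, rule al0.scale)
qed

lemma liftable_0:
  assumes "x \<noteq> 0" shows "liftable x d (\<lambda>y. 0)"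
proof -
  obtain g where g: "form (*) UNIV 1 g" "g x \<noteq> (0::complex)" using coordinate_power_nonzero[OF assms] .
  interpret V3W: complex_vector_space scl3W by (rule vs3W)
  show ?thesis by (rule liftableI[OF g V3W.form_0[of UNIV d]]) simp_all
qed

lemma liftable_add:
  assumes F: "liftable x d F" and F': "liftable x d F'"
  shows "liftable x d (\<lambda>y. F y + F' y)"
proof -
  interpret V3W: complex_vector_space scl3W by (rule vs3W)
  obtain e g k G where G: "form (*) UNIV e g" "g x \<noteq> 0" "form scl3W UNIV k G" "Suc k = e + d" "\<And>y. al0 y (G y) = scl (g y) (F y)"
    by (rule liftableE[OF F], rule that)
  obtain e' g' k' G' where G': "form (*) UNIV e' g'" "g' x \<noteq> 0" "form scl3W UNIV k' G'" "Suc k' = e' + d" "\<And>y. al0 y (G' y) = scl (g' y) (F' y)"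
    by (rule liftableE[OF F'], rule that)
  have deg: "e' + k = e + k'" using G(4) G'(4) by simp
  show ?thesis
  proof (rule liftableI[OF form_mult_scalar[OF G'(1) G(1)]])
    show "form scl3W UNIV (e' + k) (\<lambda>y. scl3W (g' y) (G y) + scl3W (g y) (G' y))"
      by (rule V3W.form_add[OF V3W.form_mult[OF G'(1) G(3)] V3W.form_mult[OF G(1) G'(3), folded deg]])
    show "al0 y (scl3W (g' y) (G y) + scl3W (g y) (G' y)) = scl (g' y * g y) (F y + F' y)" for y
      by (simp add: al0_add al0_scale G(5) G'(5) scale_right_distrib mult.commute)
  qed (use G(2,4) G'(2,4) in auto)
qed

lemma liftable_mult:
  assumes p: "form (*) UNIV m p" and F: "liftable x d F"
  shows "liftable x (m + d) (\<lambda>y. scl (p y) (F y))"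
proof -
  interpret V3W: complex_vector_space scl3W by (rule vs3W)
  obtain e g k G where G: "form (*) UNIV e g" "g x \<noteq> 0" "form scl3W UNIV k G" "Suc k = e + d" "\<And>y. al0 y (G y) = scl (g y) (F y)"
    by (rule liftableE[OF F], rule that)
  show ?thesis
  proof (rule liftableI[OF G(1,2) V3W.form_mult[OF p G(3)]])
    show "Suc (m + k) = e + (m + d)" using G(4) by simp
    show "al0 y (scl3W (p y) (G y)) = scl (g y) (scl (p y) (F y))" for y
      unfolding al0_scale G(5) by (rule scale_left_commute)
  qed
qed

lemma liftable_divide:
  assumes p: "form (*) UNIV m p" "p x \<noteq> 0" and F: "liftable x (m + d) (\<lambda>y. scl (p y) (F y))"
  shows "liftable x d F"
proof -
  obtain e g k G where G: "form (*) UNIV e g" "g x \<noteq> 0" "form scl3W UNIV k G" "Suc k = e + (m + d)"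
    "\<And>y. al0 y (G y) = scl (g y) (scl (p y) (F y))"
    by (rule liftableE[OF F], rule that)
  show ?thesis
    by (rule liftableI[OF form_mult_scalar[OF G(1) p(1)] _ G(3)]) (use G p in auto)
qed

lemma liftable_al0:
  assumes "x \<noteq> 0" "form scl3W UNIV k G"
  shows "liftable x (Suc k) (\<lambda>y. al0 y (G y))"
proof -
  have one: "form (*) UNIV 0 (\<lambda>y. 1 :: complex)" by simp
  show ?thesis by (rule liftableI[OF one _ assms(2)]) simp_all
qed

lemma liftable_A:
  assumes "x \<noteq> 0" "form scl UNIV k F"
  shows "liftable x (Suc k) (\<lambda>y. A0 y (F y))" "liftable x (Suc k) (\<lambda>y. A1 y (F y))" "liftable x (Suc k) (\<lambda>y. A2 y (F y))"
proof -
  have "form scl3W UNIV k (\<lambda>y. ((F y, 0, 0), 0))" "form scl3W UNIV k (\<lambda>y. ((0, F y, 0), 0))" "form scl3W UNIV k (\<lambda>y. ((0, 0, F y), 0))"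
    using assms(2) by (simp_all add: form_scl3W form_scl3)
  from this[THEN liftable_al0[OF assms(1)]]
  show "liftable x (Suc k) (\<lambda>y. A0 y (F y))" "liftable x (Suc k) (\<lambda>y. A1 y (F y))" "liftable x (Suc k) (\<lambda>y. A2 y (F y))"
    by (simp_all add: alpha_A I.zero A0.zero A1.zero A2.zero)
qed

lemma liftable_const_subspace:
  assumes x: "x \<noteq> 0"
  shows "subspace {v. liftable x 0 (\<lambda>y. v)}"
proof (rule subspaceI)
  show "0 \<in> {v. liftable x 0 (\<lambda>y. v)}" using liftable_0[OF x] by simp
  show "u + v \<in> {v. liftable x 0 (\<lambda>y. v)}" if "u \<in> {v. liftable x 0 (\<lambda>y. v)}" "v \<in> {v. liftable x 0 (\<lambda>y. v)}" for u v
    using that liftable_add[of x 0 "\<lambda>y. u" "\<lambda>y. v"] by simp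
  show "scl c v \<in> {v. liftable x 0 (\<lambda>y. v)}" if "v \<in> {v. liftable x 0 (\<lambda>y. v)}" for c v
    using that liftable_mult[of 0 "\<lambda>y. c" x 0 "\<lambda>y. v"] by simp
qed

text \<open>
  From \<open>z\<^sub>3 B\<^sub>i v = A\<^sub>i v + z\<^sub>i v\<close> and \<open>z\<^sub>3 \<noteq> 0\<close> at \<open>x\<close>, the liftable vectors are stable under \<open>B\<^sub>i\<close>; they contain the
  image of \<open>I\<close> because \<open>z\<^sub>3 I\<close> is an entry of the last map. Stability of the datum does the rest.
\<close>

lemma liftable_const_affine:
  assumes x: "x $ 3 \<noteq> 0"
  shows "liftable x 0 (\<lambda>y. v)"
proof -
  have x0: "x \<noteq> 0" using x by auto
  have step: "liftable x 0 (\<lambda>y. T v)"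
    if v: "liftable x 0 (\<lambda>y. v)" and A: "liftable x (Suc 0) (\<lambda>y. A i T y v)" for T v i
  proof -
    have "liftable x (Suc 0) (\<lambda>y. A i T y v + scl (y $ i) v)"
      using liftable_add[OF A liftable_mult[OF coordinate_form v, simplified]] .
    then have "liftable x (Suc 0 + 0) (\<lambda>y. scl (y $ 3) (T v))"
      by (simp add: A_def)
    then show ?thesis by (rule liftable_divide[OF coordinate_form x])
  qed
  have "{v. liftable x 0 (\<lambda>y. v)} = UNIV"
  proof (rule stability[OF liftable_const_subspace[OF x0]])
    show "B0 v \<in> {v. liftable x 0 (\<lambda>y. v)}" if "v \<in> {v. liftable x 0 (\<lambda>y. v)}" for v
      using step[OF _ liftable_A(1)[OF x0 form_constant]] that by blast
    show "B1 v \<in> {v. liftable x 0 (\<lambda>y. v)}" if "v \<in> {v. liftable x 0 (\<lambda>y. v)}" for v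
      using step[OF _ liftable_A(2)[OF x0 form_constant]] that by blast
    show "B2 v \<in> {v. liftable x 0 (\<lambda>y. v)}" if "v \<in> {v. liftable x 0 (\<lambda>y. v)}" for v
      using step[OF _ liftable_A(3)[OF x0 form_constant]] that by blast
    show "I c \<in> {v. liftable x 0 (\<lambda>y. v)}" for c
    proof -
      have "form scl3W UNIV 0 (\<lambda>y. (0, c))" by (simp add: form_scl3W form_scl3)
      then have "liftable x (Suc 0 + 0) (\<lambda>y. scl (y $ 3) (I c))"
        using liftable_al0[OF x0, of 0 "\<lambda>y. (0, c)"] by (simp add: zero_prod_def alpha_A A0.zero A1.zero A2.zero)
      then have "liftable x 0 (\<lambda>y. I c)" by (rule liftable_divide[OF coordinate_form x])
      then show ?thesis by simp
    qed
  qed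
  then show ?thesis by blast
qed

lemma span_family:
  assumes "finite K" "v \<in> span (f ` K)"
  shows "\<exists>a. v = (\<Sum>k\<in>K. scl (a k) (f k))"
  using assms(2)
proof (induction rule: span_induct_alt)
  case base
  show ?case by (intro exI[of _ "\<lambda>k. 0"]) simp
next
  case (step c x y)
  then obtain k a where k: "k \<in> K" "x = f k" and a: "y = (\<Sum>k\<in>K. scl (a k) (f k))" by blast
  have "(\<Sum>j\<in>K. scl ((if j = k then c else 0) + a j) (f j)) = scl c x + y"
    using assms(1) k
    by (simp add: scale_left_distrib sum.distrib a if_distrib[of "\<lambda>t. scl t _"] cong: if_cong)
  then show ?case by metis
qed

text \<open>
  In a finite-dimensional space the vectors \<open>v, T v, T\<^sup>2 v, \<dots>\<close> cannot all be independent of their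
  predecessors.
\<close>

lemma cyclic_relation: "\<exists>N a. (T ^^ N) v = (\<Sum>k<N. scl (a k) ((T ^^ k) v))"
proof (rule ccontr)
  assume no: "\<not> ?thesis"
  define f where "f k = (T ^^ k) v" for k
  have notin: "f n \<notin> span (f ` {..<n})" for n
  proof
    assume "f n \<in> span (f ` {..<n})"
    from span_family[OF finite_lessThan this] obtain a where "f n = (\<Sum>k<n. scl (a k) (f k))" ..
    then have "\<exists>N a. (T ^^ N) v = (\<Sum>k<N. scl (a k) ((T ^^ k) v))"
      unfolding f_def by (intro exI)
    with no show False by contradiction
  qed
  have ind: "independent (f ` {..<n}) \<and> card (f ` {..<n}) = n" for n
  proof (induction n)
    case (Suc n)
    have "f n \<notin> f ` {..<n}" using notin[of n] span_base[of "f n" "f ` {..<n}"] by blast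
    then show ?case
      using Suc notin[of n] by (simp add: lessThan_Suc independent_insert)
  qed (simp add: independent_empty)
  obtain b where b: "finite b" "span b = UNIV" using finite_dimensional by blast
  have "f ` {..<Suc (card b)} \<subseteq> span b" using b(2) by simp
  then have "card (f ` {..<Suc (card b)}) \<le> card b"
    using independent_span_bound[OF b(1) conjunct1[OF ind]] by blast
  then show False using conjunct2[OF ind, of "Suc (card b)"] by linarith
qed

text \<open>
  Modulo the image of \<open>A\<^sub>i\<close> the vector \<open>z\<^sub>i\<^sup>k v\<close> is congruent to \<open>z\<^sub>3\<^sup>k T\<^sup>k v\<close>. A relation
  \<open>T\<^sup>N v = \<Sum>\<^sub>k a\<^sub>k T\<^sup>k v\<close> therefore makes \<open>g v\<close> liftable for the homogenized polynomial
  \<open>g = z\<^sub>i (z\<^sub>i\<^sup>N - \<Sum>\<^sub>k a\<^sub>k z\<^sub>3\<^sup>N\<^sup>-\<^sup>k z\<^sub>i\<^sup>k)\<close>, and \<open>g\<close> does not vanish at a point with \<open>z\<^sub>3 = 0\<close> and \<open>z\<^sub>i \<noteq> 0\<close>.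
\<close>

lemma liftable_const_infinity:
  assumes T: "Vector_Spaces.linear scl scl T" and x: "x $ 3 = 0" "x $ i \<noteq> 0"
    and A: "\<And>k F. form scl UNIV k F \<Longrightarrow> liftable x (Suc k) (\<lambda>y. A i T y (F y))"
  shows "liftable x 0 (\<lambda>y. v)"
proof -
  interpret T: Vector_Spaces.linear scl scl T by (rule T)
  have x0: "x \<noteq> 0" using x by auto
  define p where "p k = (T ^^ k) v" for k
  obtain N a where N: "p N = (\<Sum>k<N. scl (a k) (p k))" using cyclic_relation[of T v] unfolding p_def by blast
  note pow = coordinate_power_form[OF UNIV_I]
  \<comment> \<open>The extra factor \<open>z\<^sub>i\<close> keeps the degrees positive: the preimage of the difference has one degree less.\<close>
  have reduce: "liftable x (Suc k) (\<lambda>y. scl (y $ i ^ Suc k) v - scl (y $ i * y $ 3 ^ k) (p k))" for k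
  proof (induction k)
    case 0
    show ?case using liftable_0[OF x0] by (simp add: p_def)
  next
    case (Suc k)
    have 1: "liftable x (Suc (Suc k)) (\<lambda>y. scl (y $ i) (scl (y $ i ^ Suc k) v - scl (y $ i * y $ 3 ^ k) (p k)))"
      using liftable_mult[OF coordinate_form Suc] unfolding add_Suc add_0 .
    have "form scl UNIV (Suc 0 + k + 0) (\<lambda>y. scl (y $ i * y $ 3 ^ k) (- p k))"
      by (rule form_mult[OF form_mult_scalar[OF coordinate_form pow] form_constant])
    then have 2: "liftable x (Suc (Suc k)) (\<lambda>y. A i T y (scl (y $ i * y $ 3 ^ k) (- p k)))"
      by (intro A) simp
    have eq: "scl (y $ i) (scl (y $ i ^ Suc k) v - scl (y $ i * y $ 3 ^ k) (p k)) + A i T y (scl (y $ i * y $ 3 ^ k) (- p k))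
      = scl (y $ i ^ Suc (Suc k)) v - scl (y $ i * y $ 3 ^ Suc k) (p (Suc k))" for y
    proof -
      have pS: "p (Suc k) = T (p k)" by (simp add: p_def)
      have A: "A i T y (scl c (- p k)) = scl (y $ i * c) (p k) - scl (y $ 3 * c) (p (Suc k))" for c
        unfolding A_def T.scale T.neg pS scale_scale scale_minus_right by simp
      have e: "y $ 3 * (y $ i * y $ 3 ^ k) = y $ i * y $ 3 ^ Suc k" by simp
      show ?thesis
        unfolding A scale_right_diff_distrib scale_scale e power_Suc[of "y $ i" "Suc k"]
        by (simp only: diff_add_cancel add_diff_eq)
    qed
    show ?case using liftable_add[OF 1 2] unfolding eq .
  qed
  define g where "g y = y $ i ^ Suc N - (\<Sum>k<N. a k * (y $ 3 ^ (N - k) * y $ i ^ Suc k))" for y :: "complex ^ 4"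
  have g: "form (*) UNIV (Suc N) g"
    unfolding g_def
  proof (intro scalars.form_diff pow scalars.form_sum scalars.form_scale)
    fix k assume "k \<in> {..<N}"
    then have "N - k + Suc k = Suc N" by simp
    then show "form (*) UNIV (Suc N) (\<lambda>y :: complex ^ 4. y $ 3 ^ (N - k) * y $ i ^ Suc k)"
      using form_mult_scalar[OF pow[where n = "N - k" and j = 3] pow[where n = "Suc k" and j = i]] by metis
  qed simp
  have gx: "g x \<noteq> 0"
  proof -
    have "(\<Sum>k<N. a k * (x $ 3 ^ (N - k) * x $ i ^ Suc k)) = 0"
      by (intro sum.neutral) (simp add: x(1) zero_power)
    then show ?thesis using x(2) by (simp add: g_def)
  qed
  define R where "R k y = scl (y $ i ^ Suc k) v - scl (y $ i * y $ 3 ^ k) (p k)" for k and y :: "complex ^ 4"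
  have R: "liftable x (Suc k) (R k)" for k using reduce[of k] unfolding R_def .
  have summand: "liftable x (Suc N) (\<lambda>y. scl (- a k * y $ 3 ^ (N - k)) (R k y))" if "k < N" for k
  proof -
    have "form (*) UNIV (0 + (N - k)) (\<lambda>y. - a k * y $ 3 ^ (N - k))"
      by (rule form_mult_scalar[OF _ pow]) simp
    from liftable_mult[OF this R[of k]] show ?thesis using that by simp
  qed
  have "liftable x (Suc N) (\<lambda>y. \<Sum>k\<in>K. scl (- a k * y $ 3 ^ (N - k)) (R k y))" if "finite K" "K \<subseteq> {..<N}" for K
    using that
  proof (induction K)
    case (insert k K)
    have "liftable x (Suc N) (\<lambda>y. scl (- a k * y $ 3 ^ (N - k)) (R k y) + (\<Sum>k\<in>K. scl (- a k * y $ 3 ^ (N - k)) (R k y)))"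
      by (rule liftable_add[OF summand]) (use insert in auto)
    then show ?case using insert(1,2) by simp
  qed (use liftable_0[OF x0] in simp)
  then have lift: "liftable x (Suc N) (\<lambda>y. R N y + (\<Sum>k<N. scl (- a k * y $ 3 ^ (N - k)) (R k y)))"
    by (intro liftable_add[OF R]) simp
  have eq: "R N y + (\<Sum>k<N. scl (- a k * y $ 3 ^ (N - k)) (R k y)) = scl (g y) v" for y
  proof -
    have "scl (- a k * y $ 3 ^ (N - k)) (R k y) =
      scl (y $ i * y $ 3 ^ N) (scl (a k) (p k)) - scl (a k * (y $ 3 ^ (N - k) * y $ i ^ Suc k)) v" if "k < N" for k
    proof -
      have "y $ 3 ^ N = y $ 3 ^ (N - k) * y $ 3 ^ k" using that by (simp flip: power_add)
      then have c: "- a k * y $ 3 ^ (N - k) * (y $ i * y $ 3 ^ k) = - (y $ i * y $ 3 ^ N * a k)"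
        "- a k * y $ 3 ^ (N - k) * y $ i ^ Suc k = - (a k * (y $ 3 ^ (N - k) * y $ i ^ Suc k))"
        by (simp_all only: mult_ac mult_minus_left mult_minus_right)
      show ?thesis
        unfolding R_def scale_right_diff_distrib scale_scale c scale_minus_left by simp
    qed
    then have "(\<Sum>k<N. scl (- a k * y $ 3 ^ (N - k)) (R k y)) =
      (\<Sum>k<N. scl (y $ i * y $ 3 ^ N) (scl (a k) (p k)) - scl (a k * (y $ 3 ^ (N - k) * y $ i ^ Suc k)) v)"
      by (intro sum.cong) auto
    also have "\<dots> = scl (y $ i * y $ 3 ^ N) (p N) - scl (\<Sum>k<N. a k * (y $ 3 ^ (N - k) * y $ i ^ Suc k)) v"
      unfolding N sum_subtractf scale_sum_left scale_sum_right ..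
    finally have s: "(\<Sum>k<N. scl (- a k * y $ 3 ^ (N - k)) (R k y)) =
      scl (y $ i * y $ 3 ^ N) (p N) - scl (\<Sum>k<N. a k * (y $ 3 ^ (N - k) * y $ i ^ Suc k)) v" .
    show ?thesis unfolding s unfolding R_def g_def scale_left_diff_distrib by (simp only: diff_add_cancel add_diff_eq)
  qed
  have "(\<lambda>y. R N y + (\<Sum>k<N. scl (- a k * y $ 3 ^ (N - k)) (R k y))) = (\<lambda>y. scl (g y) v)"
    by (rule ext) (rule eq)
  from subst[where P = "liftable x (Suc N)", OF this lift]
  have "liftable x (Suc N + 0) (\<lambda>y. scl (g y) v)" unfolding add_0_right .
  then show ?thesis by (rule liftable_divide[where F = "\<lambda>y. v", OF g gx])
qed

lemma liftable_const:
  assumes "x \<noteq> 0" shows "liftable x 0 (\<lambda>y. v)"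
proof (cases "x $ 3 = 0")
  case True
  have "\<exists>i. x $ i \<noteq> 0" using assms by (auto simp: vec_eq_iff)
  then obtain i where i: "x $ i \<noteq> 0" by blast
  then have "i \<noteq> 3" using True by auto
  then consider "i = 0" | "i = 1" | "i = 2" using UNIV_4' by blast
  then show ?thesis
  proof cases
    case 1
    show ?thesis by (rule liftable_const_infinity[OF lin(1) True i]) (unfold 1, rule liftable_A(1)[OF assms])
  next
    case 2
    show ?thesis by (rule liftable_const_infinity[OF lin(2) True i]) (unfold 2, rule liftable_A(2)[OF assms])
  next
    case 3
    show ?thesis by (rule liftable_const_infinity[OF lin(3) True i]) (unfold 3, rule liftable_A(3)[OF assms])
  qed
qed (rule liftable_const_affine)

lemma liftable_form: "x \<noteq> 0 \<Longrightarrow> form scl UNIV d F \<Longrightarrow> liftable x d F"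
proof (induction d arbitrary: F)
  case 0
  then obtain v where "F = (\<lambda>y. v)" by (auto simp: form.simps(1))
  then show ?case using liftable_const[OF 0(1)] by simp
next
  case (Suc d)
  obtain F' where F': "\<forall>i\<in>UNIV. form scl UNIV d (F' i)" "F = (\<lambda>x. \<Sum>i\<in>UNIV. scl (x $ i) (F' i x))"
    using Suc.prems(2) unfolding form_Suc by (elim exE conjE)
  have "liftable x (Suc d) (\<lambda>x. \<Sum>i\<in>K. scl (x $ i) (F' i x))" if "finite K" for K
    using that
  proof (induction K)
    case (insert i K)
    have "liftable x (Suc 0 + d) (\<lambda>x. scl (x $ i) (F' i x))"
      by (rule liftable_mult[OF coordinate_form Suc.IH]) (use Suc.prems F' in auto)
    then have "liftable x (Suc d) (\<lambda>x. scl (x $ i) (F' i x) + (\<Sum>i\<in>K. scl (x $ i) (F' i x)))"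
      using liftable_add[OF _ insert(3)] by simp
    then show ?case using insert(1,2) by simp
  qed (use liftable_0[OF Suc.prems(1)] in simp)
  then show ?case unfolding F'(2) by simp
qed

lemma image_al0:
  assumes U: "openin P3 U"
  shows "im_sheaf P3 (twist scl3W 0) (twist scl 1) (matrix_hom al0) U = carrier (sec (twist scl 1) U)"
proof (intro equalityI subsetI)
  show "s \<in> carrier (sec (twist scl 1) U)" if "s \<in> im_sheaf P3 (twist scl3W 0) (twist scl 1) (matrix_hom al0) U" for s
    using that by (simp add: im_sheaf_def)
  fix s assume "s \<in> carrier (sec (twist scl 1) U)"
  then have s: "is_section scl 1 U s" by simp
  show "s \<in> im_sheaf P3 (twist scl3W 0) (twist scl 1) (matrix_hom al0) U"
  proof (rule im_sheaf_matrixI[where M = al0, OF U s vs3W al_0(3)])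
    fix x assume x: "x \<in> cone U"
    then have x0: "x \<noteq> 0" by auto
    obtain h F d e where h: "form (*) UNIV e h" and F: "form scl UNIV d F" and deg: "int d = int e + 1" "0 \<le> d"
      and h2: "0 < e" "h x \<noteq> 0" "nonvanishing h \<subseteq> U"
      and eq: "\<And>y. h y \<noteq> 0 \<Longrightarrow> s y = fraction h F y"
      by (rule section_local[OF U s x, of 0], rule that)
    obtain e' g k G where G: "form (*) UNIV e' g" "g x \<noteq> 0" "form scl3W UNIV k G" "Suc k = e' + d" "\<And>y. al0 y (G y) = scl (g y) (F y)"
      by (rule liftableE[OF liftable_form[OF x0 F]], rule that)
    have hg: "form (*) UNIV (e' + e) (\<lambda>y. g y * h y)" by (rule form_mult_scalar[OF G(1) h])
    have sub: "nonvanishing (\<lambda>y. g y * h y) \<subseteq> U" using h2(3) by (auto simp: nonvanishing_def)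
    have eq': "s y = al0 y (scl3W (inverse (g y * h y)) (G y))" if "g y * h y \<noteq> 0" for y
      using that eq[of y] by (simp add: al0_scale G(5) fraction_def field_simps)
    have "int k = int (e' + e) + 0" using G(4) deg by simp
    then show "\<exists>h F e d. form (*) UNIV e h \<and> 0 < e \<and> h x \<noteq> 0 \<and> nonvanishing h \<subseteq> U \<and>
      form scl3W UNIV d F \<and> int d = int e + 0 \<and> (\<forall>y. h y \<noteq> 0 \<longrightarrow> s y = al0 y (scl3W (inverse (h y)) (F y)))"
      using hg sub eq' G(2,3) h2(1,2)
      by (intro exI[of _ "\<lambda>y. g y * h y"] exI[of _ G] exI[of _ "e' + e"] exI[of _ k] conjI allI impI) auto
  qed
qed

end

section \<open>Sheafification of presheaves of functions\<close>

lemma restrict_to_simps: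
  "x \<in> cone V \<Longrightarrow> restrict_to V s x = s x" "x \<notin> cone V \<Longrightarrow> restrict_to V s x = 0"
  by (simp_all add: restrict_to_def)

lemma restrict_to_eq_iff: "restrict_to N s = restrict_to N t \<longleftrightarrow> (\<forall>y\<in>cone N. s y = t y)"
  by (auto simp: restrict_to_def fun_eq_iff)

text \<open>
  A presheaf of modules whose sections are determined by functions, compatibly with all operations,
  has a sheafification that consists of the functions that are locally given by sections. No
  quotients or germs are left in that description.
\<close>

locale function_presheaf =
  fixes Q :: "(point, complex ^ 4 \<Rightarrow> complex, 'q) mod_presheaf"
    and e :: "point set \<Rightarrow> 'q \<Rightarrow> complex ^ 4 \<Rightarrow> complex"
  assumes section_e: "\<And>U s. openin P3 U \<Longrightarrow> s \<in> carrier (sec Q U) \<Longrightarrow> is_section (*) 0 U (e U s)"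
    and inj_e: "\<And>U s t. openin P3 U \<Longrightarrow> s \<in> carrier (sec Q U) \<Longrightarrow> t \<in> carrier (sec Q U) \<Longrightarrow> e U s = e U t \<Longrightarrow> s = t"
    and res_e: "\<And>U V s. openin P3 U \<Longrightarrow> openin P3 V \<Longrightarrow> V \<subseteq> U \<Longrightarrow> s \<in> carrier (sec Q U) \<Longrightarrow>
      res Q U V s \<in> carrier (sec Q V) \<and> e V (res Q U V s) = restrict_to V (e U s)"
    and zero_e: "\<And>U. openin P3 U \<Longrightarrow> \<exists>s\<in>carrier (sec Q U). e U s = (\<lambda>x. 0)"
    and add_e: "\<And>U s t. openin P3 U \<Longrightarrow> s \<in> carrier (sec Q U) \<Longrightarrow> t \<in> carrier (sec Q U) \<Longrightarrow>
      s \<oplus>\<^bsub>sec Q U\<^esub> t \<in> carrier (sec Q U) \<and> e U (s \<oplus>\<^bsub>sec Q U\<^esub> t) = (\<lambda>x. e U s x + e U t x)"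
    and smult_e: "\<And>U f s. openin P3 U \<Longrightarrow> is_section (*) 0 U f \<Longrightarrow> s \<in> carrier (sec Q U) \<Longrightarrow>
      f \<odot>\<^bsub>sec Q U\<^esub> s \<in> carrier (sec Q U) \<and> e U (f \<odot>\<^bsub>sec Q U\<^esub> s) = (\<lambda>x. f x * e U s x)"
begin

definition agree :: "point set \<Rightarrow> (complex ^ 4 \<Rightarrow> complex) \<Rightarrow> (complex ^ 4 \<Rightarrow> complex) \<Rightarrow> bool" where
  "agree N c c' \<longleftrightarrow> (\<forall>y\<in>cone N. c y = c' y)"

lemma agree_mono: "N \<subseteq> N' \<Longrightarrow> agree N' c c' \<Longrightarrow> agree N c c'"
  using cone_mono[of N N'] by (auto simp: agree_def)

lemma agree_sym: "agree N c c' \<Longrightarrow> agree N c' c" by (simp add: agree_def)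

lemma agree_trans: "agree N c c' \<Longrightarrow> agree N c' c'' \<Longrightarrow> agree N c c''" by (simp add: agree_def)

lemma agree_restrict: "N \<subseteq> V \<Longrightarrow> agree N (restrict_to V c) c"
  using cone_mono[of N V] by (auto simp: agree_def restrict_to_def)

definition J :: "point set \<Rightarrow> (complex ^ 4 \<Rightarrow> complex) set" where
  "J U = {c. (\<forall>x. x \<notin> cone U \<longrightarrow> c x = 0) \<and>
     (\<forall>p\<in>U. \<exists>V. openin P3 V \<and> p \<in> V \<and> V \<subseteq> U \<and> (\<exists>t\<in>carrier (sec Q V). agree V c (e V t)))}"

definition germ_of :: "(complex ^ 4 \<Rightarrow> complex) \<Rightarrow> point \<Rightarrow> (point set \<times> 'q) set" where
  "germ_of c p = {(W, t). openin P3 W \<and> p \<in> W \<and> t \<in> carrier (sec Q W) \<and>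
     (\<exists>N. openin P3 N \<and> p \<in> N \<and> N \<subseteq> W \<and> agree N c (e W t))}"

text \<open>
  Sections with the same function are equal, so a germ only depends on the function near the point.
\<close>

lemma germ_eq:
  assumes V: "openin P3 V" "p \<in> V" and s: "s \<in> carrier (sec Q V)"
  shows "germ P3 Q p V s = germ_of (e V s) p"
proof -
  have *: "res Q V N s = res Q W N t \<longleftrightarrow> agree N (e V s) (e W t)"
    if "openin P3 W" "t \<in> carrier (sec Q W)" "openin P3 N" "N \<subseteq> V" "N \<subseteq> W" for W t N
  proof -
    note rs = res_e[OF V(1) that(3,4) s] and rt = res_e[OF that(1,3,5,2)]
    have "res Q V N s = res Q W N t \<longleftrightarrow> e N (res Q V N s) = e N (res Q W N t)"
      using inj_e[OF that(3) conjunct1[OF rs] conjunct1[OF rt]] by auto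
    then show ?thesis using rs rt by (simp add: restrict_to_eq_iff agree_def)
  qed
  show ?thesis
  proof (intro equalityI subsetI)
    fix z assume "z \<in> germ P3 Q p V s"
    then obtain W t N where z: "z = (W, t)" "openin P3 W" "p \<in> W" "t \<in> carrier (sec Q W)"
      and N: "openin P3 N" "p \<in> N" "N \<subseteq> V" "N \<subseteq> W" and eq: "res Q V N s = res Q W N t"
      unfolding germ_def by blast
    have "agree N (e V s) (e W t)" using *[OF z(2,4) N(1,3,4)] eq by simp
    then show "z \<in> germ_of (e V s) p"
      unfolding germ_of_def z(1) using z(2-4) N by blast
  next
    fix z assume "z \<in> germ_of (e V s) p"
    then obtain W t N where z: "z = (W, t)" "openin P3 W" "p \<in> W" "t \<in> carrier (sec Q W)"
      and N: "openin P3 N" "p \<in> N" "N \<subseteq> W" "agree N (e V s) (e W t)"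
      unfolding germ_of_def by blast
    have "openin P3 (N \<inter> V)" "p \<in> N \<inter> V" "N \<inter> V \<subseteq> V \<inter> W" using N V by auto
    moreover have "agree (N \<inter> V) (e V s) (e W t)" using N(4) by (rule agree_mono[rotated]) simp
    moreover have "res Q V (N \<inter> V) s = res Q W (N \<inter> V) t"
      using *[OF z(2,4) calculation(1)] calculation(3,4) by simp
    ultimately show "z \<in> germ P3 Q p V s"
      unfolding germ_def z(1) using z(2-4) by blast
  qed
qed

lemma germ_of_cong:
  assumes "openin P3 N" "p \<in> N" "agree N c c'"
  shows "germ_of c p = germ_of c' p"
proof -
  have "germ_of c p \<subseteq> germ_of c' p" if "agree N c c'" for c c'
  proof
    fix z assume "z \<in> germ_of c p"
    then obtain W t M where z: "z = (W, t)" "openin P3 W" "p \<in> W" "t \<in> carrier (sec Q W)"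
      and M: "openin P3 M" "p \<in> M" "M \<subseteq> W" "agree M c (e W t)"
      unfolding germ_of_def by blast
    have "agree (N \<inter> M) c' (e W t)"
      using agree_mono[of "N \<inter> M", OF _ agree_sym[OF that]] agree_mono[of "N \<inter> M", OF _ M(4)] agree_trans by blast
    moreover have "openin P3 (N \<inter> M)" "p \<in> N \<inter> M" "N \<inter> M \<subseteq> W" using assms M by auto
    ultimately show "z \<in> germ_of c' p" unfolding germ_of_def using z by blast
  qed
  then show ?thesis using assms(3) agree_sym by blast
qed

lemma germ_of_value:
  assumes "(W, t) \<in> germ_of c (vec.span {x})" "x \<noteq> 0"
  shows "e W t x = c x"
proof -
  obtain N where "vec.span {x} \<in> N" "agree N c (e W t)" using assms(1) unfolding germ_of_def by blast
  then show ?thesis using assms(2) by (simp add: agree_def cone_def)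
qed

lemma J_local:
  assumes "c \<in> J U" "p \<in> U"
  obtains V t where "openin P3 V" "p \<in> V" "V \<subseteq> U" "t \<in> carrier (sec Q V)" "agree V c (e V t)" "(V, t) \<in> germ_of c p"
proof -
  obtain V t where V: "openin P3 V" "p \<in> V" "V \<subseteq> U" "t \<in> carrier (sec Q V)" "agree V c (e V t)"
    using assms unfolding J_def by blast
  moreover have "(V, t) \<in> germ_of c p" unfolding germ_of_def using V by blast
  ultimately show thesis by (rule that)
qed

lemma J_supp: "c \<in> J U \<Longrightarrow> x \<notin> cone U \<Longrightarrow> c x = 0"
  by (simp add: J_def)

lemma J_intro:
  assumes "\<And>x. x \<notin> cone U \<Longrightarrow> c x = 0"
    and "\<And>p. p \<in> U \<Longrightarrow> \<exists>V t. openin P3 V \<and> p \<in> V \<and> V \<subseteq> U \<and> t \<in> carrier (sec Q V) \<and> agree V c (e V t)"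
  shows "c \<in> J U"
  unfolding J_def
proof (intro CollectI conjI allI impI ballI)
  show "c x = 0" if "x \<notin> cone U" for x using that by (rule assms(1))
  show "\<exists>V. openin P3 V \<and> p \<in> V \<and> V \<subseteq> U \<and> (\<exists>t\<in>carrier (sec Q V). agree V c (e V t))" if "p \<in> U" for p
    using assms(2)[OF that] by auto
qed

lemma J_add:
  assumes c: "c \<in> J U" and c': "c' \<in> J U"
  shows "(\<lambda>x. c x + c' x) \<in> J U"
proof (rule J_intro)
  show "c x + c' x = 0" if "x \<notin> cone U" for x using that J_supp[OF c] J_supp[OF c'] by simp
  fix p assume p: "p \<in> U"
  obtain V t where V: "openin P3 V" "p \<in> V" "V \<subseteq> U" "t \<in> carrier (sec Q V)" "agree V c (e V t)"
    by (rule J_local[OF c p], rule that)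
  obtain V' t' where V': "openin P3 V'" "p \<in> V'" "V' \<subseteq> U" "t' \<in> carrier (sec Q V')" "agree V' c' (e V' t')"
    by (rule J_local[OF c' p], rule that)
  define N where "N = V \<inter> V'"
  have N: "openin P3 N" "p \<in> N" "N \<subseteq> U" "N \<subseteq> V" "N \<subseteq> V'" using V V' by (auto simp: N_def)
  note r = res_e[OF V(1) N(1,4) V(4)] and r' = res_e[OF V'(1) N(1,5) V'(4)]
  note a = add_e[OF N(1) conjunct1[OF r] conjunct1[OF r']]
  have "agree N (\<lambda>x. c x + c' x) (e N (res Q V N t \<oplus>\<^bsub>sec Q N\<^esub> res Q V' N t'))"
    unfolding agree_def
  proof
    fix y assume y: "y \<in> cone N"
    then have "c y = e V t y" "c' y = e V' t' y"
      using V(5) V'(5) cone_mono[OF N(4)] cone_mono[OF N(5)] unfolding agree_def by blast+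
    then show "c y + c' y = e N (res Q V N t \<oplus>\<^bsub>sec Q N\<^esub> res Q V' N t') y"
      using y r r' conjunct2[OF a] by (simp add: restrict_to_simps)
  qed
  then show "\<exists>V t. openin P3 V \<and> p \<in> V \<and> V \<subseteq> U \<and> t \<in> carrier (sec Q V) \<and> agree V (\<lambda>x. c x + c' x) (e V t)"
    using N(1-3) conjunct1[OF a] by blast
qed

lemma J_smult:
  assumes U: "openin P3 U" and f: "is_section (*) 0 U f" and c: "c \<in> J U"
  shows "(\<lambda>x. f x * c x) \<in> J U"
proof (rule J_intro)
  show "f x * c x = 0" if "x \<notin> cone U" for x using that J_supp[OF c] by simp
  fix p assume p: "p \<in> U"
  obtain V t where V: "openin P3 V" "p \<in> V" "V \<subseteq> U" "t \<in> carrier (sec Q V)" "agree V c (e V t)"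
    by (rule J_local[OF c p], rule that)
  note s = smult_e[OF V(1) scalars.section_restrict[OF U V(1,3) f] V(4)]
  have "agree V (\<lambda>x. f x * c x) (e V (restrict_to V f \<odot>\<^bsub>sec Q V\<^esub> t))"
    using V(5) s by (auto simp: agree_def restrict_to_simps)
  then show "\<exists>V t. openin P3 V \<and> p \<in> V \<and> V \<subseteq> U \<and> t \<in> carrier (sec Q V) \<and> agree V (\<lambda>x. f x * c x) (e V t)"
    using V(1-3) conjunct1[OF s] by blast
qed

lemma J_restrict:
  assumes V: "openin P3 V" "V \<subseteq> U" and c: "c \<in> J U"
  shows "restrict_to V c \<in> J V"
proof (rule J_intro)
  show "restrict_to V c x = 0" if "x \<notin> cone V" for x using that by (rule restrict_to_simps)
  fix p assume p: "p \<in> V"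
  then have "p \<in> U" using V by blast
  obtain W t where W: "openin P3 W" "p \<in> W" "W \<subseteq> U" "t \<in> carrier (sec Q W)" "agree W c (e W t)"
    by (rule J_local[OF c \<open>p \<in> U\<close>], rule that)
  define N where "N = V \<inter> W"
  have N: "openin P3 N" "p \<in> N" "N \<subseteq> V" "N \<subseteq> W" using V W p by (auto simp: N_def)
  note r = res_e[OF W(1) N(1,4) W(4)]
  have "agree N (restrict_to V c) (e N (res Q W N t))"
    using W(5) r cone_mono[OF N(3)] cone_mono[OF N(4)] by (auto simp: agree_def restrict_to_def)
  then show "\<exists>N t. openin P3 N \<and> p \<in> N \<and> N \<subseteq> V \<and> t \<in> carrier (sec Q N) \<and> agree N (restrict_to V c) (e N t)"
    using N(1-3) conjunct1[OF r] by blast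
qed

lemma J_glue:
  assumes "\<And>x. x \<notin> cone U \<Longrightarrow> c x = 0"
    and "\<And>p. p \<in> U \<Longrightarrow> \<exists>V. openin P3 V \<and> p \<in> V \<and> V \<subseteq> U \<and> restrict_to V c \<in> J V"
  shows "c \<in> J U"
proof (rule J_intro[OF assms(1)])
  fix p assume "p \<in> U"
  then obtain V where V: "openin P3 V" "p \<in> V" "V \<subseteq> U" "restrict_to V c \<in> J V" using assms(2) by blast
  obtain W t where W: "openin P3 W" "p \<in> W" "W \<subseteq> V" "t \<in> carrier (sec Q W)" "agree W (restrict_to V c) (e W t)"
    by (rule J_local[OF V(4,2)], rule that)
  have "agree W c (e W t)" using agree_trans[OF agree_sym[OF agree_restrict[OF W(3)]] W(5)] .
  then show "\<exists>V t. openin P3 V \<and> p \<in> V \<and> V \<subseteq> U \<and> t \<in> carrier (sec Q V) \<and> agree V c (e V t)"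
    using W V(3) by blast
qed

lemma J_section:
  assumes U: "openin P3 U" and c: "c \<in> J U"
  shows "is_section (*) 0 U c"
proof (rule scalars.section_glue[OF U J_supp[OF c]])
  fix x assume x: "x \<in> cone U"
  obtain V t where V: "openin P3 V" "vec.span {x} \<in> V" "V \<subseteq> U" "t \<in> carrier (sec Q V)" "agree V c (e V t)"
    by (rule J_local[OF c span_in_cone[OF x]], rule that)
  have "x \<in> cone V" using V(2) x by (auto simp: cone_def)
  then show "\<exists>V t. openin P3 V \<and> x \<in> cone V \<and> is_section (*) 0 V t \<and> (\<forall>y\<in>cone V. c y = t y)"
    using V(1,5) section_e[OF V(1,4)] unfolding agree_def by blast
qed

lemma J_zero:
  assumes U: "openin P3 U"
  shows "(\<lambda>x. 0) \<in> J U"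
proof (rule J_intro)
  fix p assume "p \<in> U"
  moreover obtain t where "t \<in> carrier (sec Q U)" "e U t = (\<lambda>x. 0)" using zero_e[OF U] by blast
  ultimately show "\<exists>V t. openin P3 V \<and> p \<in> V \<and> V \<subseteq> U \<and> t \<in> carrier (sec Q V) \<and> agree V (\<lambda>x. 0) (e V t)"
    using U by (intro exI[of _ U] exI[of _ t]) (simp add: agree_def)
qed simp

definition germs :: "point set \<Rightarrow> (complex ^ 4 \<Rightarrow> complex) \<Rightarrow> point \<Rightarrow> (point set \<times> 'q) set" where
  "germs U c = (\<lambda>p. if p \<in> U then germ_of c p else {})"

definition value_of :: "point set \<Rightarrow> (point \<Rightarrow> (point set \<times> 'q) set) \<Rightarrow> complex ^ 4 \<Rightarrow> complex" where
  "value_of U \<sigma> x = (if x \<in> cone U then case (SOME z. z \<in> \<sigma> (vec.span {x})) of (W, t) \<Rightarrow> e W t x else 0)"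

lemma value_of_germs:
  assumes c: "c \<in> J U"
  shows "value_of U (germs U c) = c"
proof
  fix x
  show "value_of U (germs U c) x = c x"
  proof (cases "x \<in> cone U")
    case True
    have eq: "germs U c (vec.span {x}) = germ_of c (vec.span {x})" using span_in_cone[OF True] by (simp add: germs_def)
    obtain V t where "(V, t) \<in> germ_of c (vec.span {x})"
      by (rule J_local[OF c span_in_cone[OF True]], rule that)
    then have "(SOME z. z \<in> germ_of c (vec.span {x})) \<in> germ_of c (vec.span {x})" by (rule someI)
    moreover have "x \<noteq> 0" using True by auto
    ultimately show ?thesis
      using True germ_of_value[of "fst (SOME z. z \<in> germ_of c (vec.span {x}))" "snd (SOME z. z \<in> germ_of c (vec.span {x}))" c x]
      by (simp add: value_of_def eq split_beta)
  next
    case False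
    then show ?thesis using J_supp[OF c] by (simp add: value_of_def)
  qed
qed

text \<open>
  A family of germs that is locally induced by sections is the same as a function in \<open>J U\<close>: the function
  takes at \<open>x\<close> the common value of all representatives of the germ at the line through \<open>x\<close>.
\<close>

lemma carrier_sheafify:
  assumes U: "openin P3 U"
  shows "carrier (sec (sheafify P3 O_P3 Q) U) = germs U ` J U"
proof (intro equalityI subsetI)
  fix \<sigma> assume "\<sigma> \<in> carrier (sec (sheafify P3 O_P3 Q) U)"
  then have out: "\<And>p. p \<notin> U \<Longrightarrow> \<sigma> p = {}"
    and loc: "\<And>p. p \<in> U \<Longrightarrow> \<exists>V. openin P3 V \<and> p \<in> V \<and> V \<subseteq> U \<and>
        (\<exists>t\<in>carrier (sec Q V). \<forall>q\<in>V. \<sigma> q = germ P3 Q q V t)"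
    by (simp_all add: sheafify_def)
  define c where "c = value_of U \<sigma>"
  have c: "\<exists>V t. openin P3 V \<and> p \<in> V \<and> V \<subseteq> U \<and> t \<in> carrier (sec Q V) \<and> agree V c (e V t) \<and> \<sigma> p = germ_of c p"
    if p: "p \<in> U" for p
  proof -
    obtain V t where V: "openin P3 V" "p \<in> V" "V \<subseteq> U" "t \<in> carrier (sec Q V)" and eq: "\<And>q. q \<in> V \<Longrightarrow> \<sigma> q = germ P3 Q q V t"
      using loc[OF p] by blast
    have germ: "\<sigma> q = germ_of (e V t) q" if "q \<in> V" for q
      using eq[OF that] germ_eq[OF V(1) that V(4)] by simp
    have "c x = e V t x" if x: "x \<in> cone V" for x
    proof -
      have xU: "x \<in> cone U" using x cone_mono[OF V(3)] by blast
      have s: "\<sigma> (vec.span {x}) = germ_of (e V t) (vec.span {x})" by (rule germ[OF span_in_cone[OF x]])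
      have "(V, t) \<in> germ_of (e V t) (vec.span {x})"
        unfolding germ_of_def using V span_in_cone[OF x] by (auto simp: agree_def)
      then have "(SOME z. z \<in> germ_of (e V t) (vec.span {x})) \<in> germ_of (e V t) (vec.span {x})" by (rule someI)
      moreover have "x \<noteq> 0" using x by auto
      ultimately show ?thesis
        using xU germ_of_value[of "fst (SOME z. z \<in> germ_of (e V t) (vec.span {x}))" "snd (SOME z. z \<in> germ_of (e V t) (vec.span {x}))" "e V t" x]
        by (simp add: c_def value_of_def s split_beta)
    qed
    then have a: "agree V c (e V t)" by (simp add: agree_def)
    then have "\<sigma> p = germ_of c p" using germ[OF V(2)] germ_of_cong[OF V(1,2) a] by simp
    then show ?thesis using V a by blast
  qed
  have "c \<in> J U"
  proof (rule J_intro)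
    show "c x = 0" if "x \<notin> cone U" for x using that by (simp add: c_def value_of_def)
  qed (use c in blast)
  moreover have "\<sigma> = germs U c"
  proof
    fix p show "\<sigma> p = germs U c p" using c[of p] out[of p] by (cases "p \<in> U") (auto simp: germs_def)
  qed
  ultimately show "\<sigma> \<in> germs U ` J U" by blast
next
  fix \<sigma> assume "\<sigma> \<in> germs U ` J U"
  then obtain c where c: "c \<in> J U" "\<sigma> = germs U c" by blast
  have "\<exists>V. openin P3 V \<and> p \<in> V \<and> V \<subseteq> U \<and> (\<exists>t\<in>carrier (sec Q V). \<forall>q\<in>V. \<sigma> q = germ P3 Q q V t)" if p: "p \<in> U" for p
  proof -
    obtain V t where V: "openin P3 V" "p \<in> V" "V \<subseteq> U" "t \<in> carrier (sec Q V)" "agree V c (e V t)"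
      by (rule J_local[OF c(1) p], rule that)
    have "\<sigma> q = germ P3 Q q V t" if "q \<in> V" for q
      using that V(3) germ_eq[OF V(1) that V(4)] germ_of_cong[OF V(1) that V(5)] by (auto simp: c(2) germs_def)
    then show ?thesis using V by blast
  qed
  then show "\<sigma> \<in> carrier (sec (sheafify P3 O_P3 Q) U)"
    by (simp add: sheafify_def c(2) germs_def)
qed

text \<open>
  The stalkwise sum is a union over all pairs of representatives; each pair contributes the same germ.
\<close>

lemma stalk_add_germ_of:
  assumes c: "c \<in> J U" and c': "c' \<in> J U" and p: "p \<in> U"
  shows "stalk_add P3 Q p (germ_of c p) (germ_of c' p) = germ_of (\<lambda>x. c x + c' x) p"
proof -
  have each: "germ P3 Q p (V \<inter> W) (res Q V (V \<inter> W) s \<oplus>\<^bsub>sec Q (V \<inter> W)\<^esub> res Q W (V \<inter> W) t) = germ_of (\<lambda>x. c x + c' x) p"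
    if st: "(V, s) \<in> germ_of c p" "(W, t) \<in> germ_of c' p" for V s W t
  proof -
    obtain N where V: "openin P3 V" "p \<in> V" "s \<in> carrier (sec Q V)" and N: "openin P3 N" "p \<in> N" "N \<subseteq> V" "agree N c (e V s)"
      using st(1) unfolding germ_of_def by blast
    obtain M where W: "openin P3 W" "p \<in> W" "t \<in> carrier (sec Q W)" and M: "openin P3 M" "p \<in> M" "M \<subseteq> W" "agree M c' (e W t)"
      using st(2) unfolding germ_of_def by blast
    have VW: "openin P3 (V \<inter> W)" "p \<in> V \<inter> W" using V W by auto
    have r: "res Q V (V \<inter> W) s \<in> carrier (sec Q (V \<inter> W))" "e (V \<inter> W) (res Q V (V \<inter> W) s) = restrict_to (V \<inter> W) (e V s)"
      using res_e[OF V(1) VW(1) _ V(3)] by auto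
    have r': "res Q W (V \<inter> W) t \<in> carrier (sec Q (V \<inter> W))" "e (V \<inter> W) (res Q W (V \<inter> W) t) = restrict_to (V \<inter> W) (e W t)"
      using res_e[OF W(1) VW(1) _ W(3)] by auto
    note a = add_e[OF VW(1) r(1) r'(1)]
    have NM: "openin P3 (N \<inter> M)" "p \<in> N \<inter> M" "N \<inter> M \<subseteq> V \<inter> W" using N M by auto
    have "agree (N \<inter> M) (e (V \<inter> W) (res Q V (V \<inter> W) s \<oplus>\<^bsub>sec Q (V \<inter> W)\<^esub> res Q W (V \<inter> W) t)) (\<lambda>x. c x + c' x)"
      unfolding conjunct2[OF a] r(2) r'(2) agree_def
    proof
      fix y assume y: "y \<in> cone (N \<inter> M)"
      then have "y \<in> cone (V \<inter> W)" using cone_mono[OF NM(3)] by blast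
      then show "restrict_to (V \<inter> W) (e V s) y + restrict_to (V \<inter> W) (e W t) y = c y + c' y"
        using y N(4) M(4) by (simp add: restrict_to_simps agree_def cone_Int)
    qed
    from germ_of_cong[OF NM(1,2) this] show ?thesis
      using germ_eq[OF VW conjunct1[OF a]] by simp
  qed
  obtain V t where V: "(V, t) \<in> germ_of c p" by (rule J_local[OF c p], rule that)
  obtain V' t' where V': "(V', t') \<in> germ_of c' p" by (rule J_local[OF c' p], rule that)
  show ?thesis
  proof (intro equalityI subsetI)
    fix z assume "z \<in> stalk_add P3 Q p (germ_of c p) (germ_of c' p)"
    then show "z \<in> germ_of (\<lambda>x. c x + c' x) p" unfolding stalk_add_def using each by auto
  next
    fix z assume "z \<in> germ_of (\<lambda>x. c x + c' x) p"
    then have "z \<in> germ P3 Q p (V \<inter> V') (res Q V (V \<inter> V') t \<oplus>\<^bsub>sec Q (V \<inter> V')\<^esub> res Q V' (V \<inter> V') t')"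
      using each[OF V V'] by simp
    then show "z \<in> stalk_add P3 Q p (germ_of c p) (germ_of c' p)"
      unfolding stalk_add_def using V V' by blast
  qed
qed

lemma stalk_smult_germ_of:
  assumes U: "openin P3 U" and f: "is_section (*) 0 U f" and c: "c \<in> J U" and p: "p \<in> U"
  shows "stalk_smult P3 O_P3 Q p U f (germ_of c p) = germ_of (\<lambda>x. f x * c x) p"
proof -
  have each: "germ P3 Q p (U \<inter> V) (restrict_to (U \<inter> V) f \<odot>\<^bsub>sec Q (U \<inter> V)\<^esub> res Q V (U \<inter> V) s) = germ_of (\<lambda>x. f x * c x) p"
    if st: "(V, s) \<in> germ_of c p" for V s
  proof -
    obtain N where V: "openin P3 V" "p \<in> V" "s \<in> carrier (sec Q V)" and N: "openin P3 N" "p \<in> N" "N \<subseteq> V" "agree N c (e V s)"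
      using st(1) unfolding germ_of_def by blast
    have VW: "openin P3 (U \<inter> V)" "p \<in> U \<inter> V" using V U p by auto
    have r: "res Q V (U \<inter> V) s \<in> carrier (sec Q (U \<inter> V))" "e (U \<inter> V) (res Q V (U \<inter> V) s) = restrict_to (U \<inter> V) (e V s)"
      using res_e[OF V(1) VW(1) _ V(3)] by auto
    have fr: "is_section (*) 0 (U \<inter> V) (restrict_to (U \<inter> V) f)"
      by (rule scalars.section_restrict[OF U VW(1) _ f]) simp
    note a = smult_e[OF VW(1) fr r(1)]
    have NM: "openin P3 (U \<inter> N)" "p \<in> U \<inter> N" "U \<inter> N \<subseteq> U \<inter> V" using N U p by auto
    have "agree (U \<inter> N) (e (U \<inter> V) (restrict_to (U \<inter> V) f \<odot>\<^bsub>sec Q (U \<inter> V)\<^esub> res Q V (U \<inter> V) s)) (\<lambda>x. f x * c x)"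
      unfolding conjunct2[OF a] r(2) agree_def
    proof
      fix y assume y: "y \<in> cone (U \<inter> N)"
      then have "y \<in> cone (U \<inter> V)" using cone_mono[OF NM(3)] by blast
      then show "restrict_to (U \<inter> V) f y * restrict_to (U \<inter> V) (e V s) y = f y * c y"
        using y N(4) by (simp add: restrict_to_simps agree_def cone_Int)
    qed
    from germ_of_cong[OF NM(1,2) this] show ?thesis
      using germ_eq[OF VW conjunct1[OF a]] by simp
  qed
  obtain V t where V: "(V, t) \<in> germ_of c p" by (rule J_local[OF c p], rule that)
  show ?thesis
  proof (intro equalityI subsetI)
    fix z assume "z \<in> stalk_smult P3 O_P3 Q p U f (germ_of c p)"
    then show "z \<in> germ_of (\<lambda>x. f x * c x) p" unfolding stalk_smult_def using each by auto
  next
    fix z assume "z \<in> germ_of (\<lambda>x. f x * c x) p"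
    then have "z \<in> germ P3 Q p (U \<inter> V) (rres O_P3 U (U \<inter> V) f \<odot>\<^bsub>sec Q (U \<inter> V)\<^esub> res Q V (U \<inter> V) t)"
      using each[OF V] by simp
    then show "z \<in> stalk_smult P3 O_P3 Q p U f (germ_of c p)"
      unfolding stalk_smult_def using V by blast
  qed
qed

theorem sheafify_iso: "sheaf_iso P3 O_P3 (sheafify P3 O_P3 Q) (ideal_module O_P3 J)"
proof -
  have carrier_J: "carrier (sec (ideal_module O_P3 J) U) = J U" for U by (simp add: ideal_module_def)
  have add: "germs U c \<oplus>\<^bsub>sec (sheafify P3 O_P3 Q) U\<^esub> germs U c' = germs U (\<lambda>x. c x + c' x)"
    if "c \<in> J U" "c' \<in> J U" for U c c'
  proof -
    have "germs U c \<oplus>\<^bsub>sec (sheafify P3 O_P3 Q) U\<^esub> germs U c' = (\<lambda>p. stalk_add P3 Q p (germs U c p) (germs U c' p))"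
      by (simp add: sheafify_def)
    also have "\<dots> = germs U (\<lambda>x. c x + c' x)"
      using stalk_add_germ_of[OF that] by (auto simp: germs_def fun_eq_iff stalk_add_def)
    finally show ?thesis .
  qed
  have smult: "f \<odot>\<^bsub>sec (sheafify P3 O_P3 Q) U\<^esub> germs U c = germs U (\<lambda>x. f x * c x)"
    if "openin P3 U" "is_section (*) 0 U f" "c \<in> J U" for U f c
  proof -
    have "f \<odot>\<^bsub>sec (sheafify P3 O_P3 Q) U\<^esub> germs U c = (\<lambda>p. stalk_smult P3 O_P3 Q p U f (germs U c p))"
      by (simp add: sheafify_def)
    also have "\<dots> = germs U (\<lambda>x. f x * c x)"
      using stalk_smult_germ_of[OF that] by (auto simp: germs_def fun_eq_iff stalk_smult_def)
    finally show ?thesis .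
  qed
  have restr: "res (sheafify P3 O_P3 Q) U V (germs U c) = germs V (restrict_to V c)"
    if V: "openin P3 V" "V \<subseteq> U" for U V c
  proof
    fix p
    show "res (sheafify P3 O_P3 Q) U V (germs U c) p = germs V (restrict_to V c) p"
      using that germ_of_cong[OF V(1) _ agree_restrict[OF subset_refl], of p c]
      by (auto simp: sheafify_def germs_def)
  qed
  have hom: "sheaf_hom P3 O_P3 (sheafify P3 O_P3 Q) (ideal_module O_P3 J) value_of"
    unfolding sheaf_hom_def
  proof (intro allI impI conjI ballI)
    fix U assume U: "openin P3 U"
    fix \<sigma> assume "\<sigma> \<in> carrier (sec (sheafify P3 O_P3 Q) U)"
    then obtain c where c: "c \<in> J U" "\<sigma> = germs U c" unfolding carrier_sheafify[OF U] by blast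
    show "value_of U \<sigma> \<in> carrier (sec (ideal_module O_P3 J) U)"
      unfolding carrier_J c(2) value_of_germs[OF c(1)] by (rule c(1))
    show "value_of U (\<sigma> \<oplus>\<^bsub>sec (sheafify P3 O_P3 Q) U\<^esub> \<tau>) = value_of U \<sigma> \<oplus>\<^bsub>sec (ideal_module O_P3 J) U\<^esub> value_of U \<tau>"
      if \<tau>: "\<tau> \<in> carrier (sec (sheafify P3 O_P3 Q) U)" for \<tau>
    proof -
      obtain c' where c': "c' \<in> J U" "\<tau> = germs U c'" using \<tau> unfolding carrier_sheafify[OF U] by blast
      show ?thesis
        unfolding c(2) c'(2) add[OF c(1) c'(1)] value_of_germs[OF c(1)] value_of_germs[OF c'(1)] value_of_germs[OF J_add[OF c(1) c'(1)]]
        by (simp add: ideal_module_def)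
    qed
    show "value_of U (f \<odot>\<^bsub>sec (sheafify P3 O_P3 Q) U\<^esub> \<sigma>) = f \<odot>\<^bsub>sec (ideal_module O_P3 J) U\<^esub> value_of U \<sigma>"
      if "f \<in> carrier (rsec O_P3 U)" for f
    proof -
      have f: "is_section (*) 0 U f" using that by simp
      show ?thesis
        unfolding c(2) smult[OF U f c(1)] value_of_germs[OF c(1)] value_of_germs[OF J_smult[OF U f c(1)]]
        by (simp add: ideal_module_def)
    qed
    show "value_of V (res (sheafify P3 O_P3 Q) U V \<sigma>) = res (ideal_module O_P3 J) U V (value_of U \<sigma>)"
      if "openin P3 V \<and> V \<subseteq> U" for V
      unfolding c(2) restr[OF conjunct1[OF that] conjunct2[OF that]] value_of_germs[OF c(1)]
        value_of_germs[OF J_restrict[OF conjunct1[OF that] conjunct2[OF that] c(1)]]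
      by (simp add: ideal_module_def)
  qed
  have bij: "bij_betw (value_of U) (carrier (sec (sheafify P3 O_P3 Q) U)) (carrier (sec (ideal_module O_P3 J) U))"
    if U: "openin P3 U" for U
    unfolding carrier_sheafify[OF U] carrier_J
    by (rule bij_betw_byWitness[of _ "germs U"]) (auto simp: value_of_germs)
  show ?thesis unfolding sheaf_iso_def using hom bij by blast
qed

end

section \<open>The structure sheaf and ideal sheaves\<close>

lemma section_one: "openin P3 U \<Longrightarrow> is_section (*) 0 U (\<lambda>x. if x \<in> cone U then 1 else 0 :: complex)"
proof (rule scalars.section_intro)
  fix x assume x: "x \<in> cone U"
  have one: "form (*) UNIV 0 (\<lambda>x. 1 :: complex)" by simp
  show "scalars.fraction_near 0 U (\<lambda>x. if x \<in> cone U then 1 else 0) x"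
    by (rule scalars.fraction_nearI[OF one one]) (simp_all add: scalars.fraction_def)
qed auto

lemma section_mult:
  "openin P3 U \<Longrightarrow> is_section (*) 0 U f \<Longrightarrow> is_section (*) 0 U g \<Longrightarrow> is_section (*) 0 U (\<lambda>x. f x * g x)"
  for f g :: "complex ^ 4 \<Rightarrow> complex"
  using scalars.section_smult[of U 0 f 0 g] by simp

lemma ring_O_P3:
  assumes U: "openin P3 U"
  shows "ring (rsec O_P3 U)"
proof (rule ringI)
  show "abelian_group (rsec O_P3 U)"
  proof (rule abelian_groupI)
    fix f assume f: "f \<in> carrier (rsec O_P3 U)"
    then show "\<exists>g\<in>carrier (rsec O_P3 U). g \<oplus>\<^bsub>rsec O_P3 U\<^esub> f = \<zero>\<^bsub>rsec O_P3 U\<^esub>"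
      using scalars.section_minus[OF U] by (intro bexI[of _ "\<lambda>x. - f x"]) auto
  qed (use scalars.section_0[OF U] scalars.section_add[OF U] in \<open>auto simp: add_ac\<close>)
  show "Group.monoid (rsec O_P3 U)"
  proof
    fix f assume f: "f \<in> carrier (rsec O_P3 U)"
    show "\<one>\<^bsub>rsec O_P3 U\<^esub> \<otimes>\<^bsub>rsec O_P3 U\<^esub> f = f" "f \<otimes>\<^bsub>rsec O_P3 U\<^esub> \<one>\<^bsub>rsec O_P3 U\<^esub> = f"
      using scalars.section_supp[of 0 U f] f by (auto simp: fun_eq_iff)
  qed (use section_one[OF U] section_mult[OF U] in \<open>auto simp: mult_ac\<close>)
qed (auto simp: algebra_simps)

context function_presheaf
begin

lemma J_minus:
  assumes U: "openin P3 U" and c: "c \<in> J U"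
  shows "(\<lambda>x. - c x) \<in> J U"
proof -
  have "(\<lambda>x. (- (if x \<in> cone U then 1 else 0)) * c x) \<in> J U"
    by (rule J_smult[OF U scalars.section_minus[OF U section_one[OF U]] c])
  moreover have "(\<lambda>x. (- (if x \<in> cone U then 1 else 0)) * c x) = (\<lambda>x. - c x)"
    using J_supp[OF c] by (auto simp: fun_eq_iff)
  ultimately show ?thesis by simp
qed

lemma ideal_J:
  assumes U: "openin P3 U"
  shows "ideal (J U) (rsec O_P3 U)"
proof (rule idealI[OF ring_O_P3[OF U]])
  interpret R: ring "rsec O_P3 U" by (rule ring_O_P3[OF U])
  show "subgroup (J U) (add_monoid (rsec O_P3 U))"
  proof (rule R.add.subgroupI)
    show "J U \<subseteq> carrier (rsec O_P3 U)" using J_section[OF U] by auto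
    show "J U \<noteq> {}" using J_zero[OF U] by blast
    fix c assume c: "c \<in> J U"
    have "\<ominus>\<^bsub>rsec O_P3 U\<^esub> c = (\<lambda>x. - c x)"
    proof (rule R.minus_equality)
      show "c \<in> carrier (rsec O_P3 U)" "(\<lambda>x. - c x) \<in> carrier (rsec O_P3 U)"
        using J_section[OF U c] scalars.section_minus[OF U] by auto
      show "(\<lambda>x. - c x) \<oplus>\<^bsub>rsec O_P3 U\<^esub> c = \<zero>\<^bsub>rsec O_P3 U\<^esub>" by simp
    qed
    then show "\<ominus>\<^bsub>rsec O_P3 U\<^esub> c \<in> J U" using J_minus[OF U c] by simp
    show "c \<oplus>\<^bsub>rsec O_P3 U\<^esub> c' \<in> J U" if "c' \<in> J U" for c'
      using J_add[OF c that] by simp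
  qed
next
  fix c f assume "c \<in> J U" "f \<in> carrier (rsec O_P3 U)"
  then show "f \<otimes>\<^bsub>rsec O_P3 U\<^esub> c \<in> J U" "c \<otimes>\<^bsub>rsec O_P3 U\<^esub> f \<in> J U"
    using J_smult[OF U, of f c] by (simp_all add: mult.commute)
qed

lemma ideal_sheaf_J: "ideal_sheaf P3 O_P3 J"
  unfolding ideal_sheaf_def
proof (intro allI impI conjI ballI)
  fix U assume U: "openin P3 U"
  show "ideal (J U) (rsec O_P3 U)" by (rule ideal_J[OF U])
  show "rres O_P3 U V ` J U \<subseteq> J V" if "openin P3 V \<and> V \<subseteq> U" for V
    using J_restrict[OF conjunct1[OF that] conjunct2[OF that]] by auto
  show "f \<in> J U" if f: "f \<in> carrier (rsec O_P3 U)"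
    and loc: "\<forall>p\<in>U. \<exists>V. openin P3 V \<and> p \<in> V \<and> V \<subseteq> U \<and> rres O_P3 U V f \<in> J V" for f
  proof (rule J_glue)
    show "f x = 0" if "x \<notin> cone U" for x using scalars.section_supp[of 0 U f x] f that by simp
    show "\<exists>V. openin P3 V \<and> p \<in> V \<and> V \<subseteq> U \<and> restrict_to V f \<in> J V" if "p \<in> U" for p
      using loc that by simp
  qed
qed

end

section \<open>The cohomology sheaf\<close>

context adhm
begin

definition K :: "point set \<Rightarrow> (complex ^ 4 \<Rightarrow> ('v \<times> 'v \<times> 'v) \<times> complex) set" where
  "K U = ker_sheaf (twist scl3W 0) (twist scl 1) (matrix_hom al0) U"

definition N :: "point set \<Rightarrow> (complex ^ 4 \<Rightarrow> ('v \<times> 'v \<times> 'v) \<times> complex) set" where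
  "N U = im_sheaf P3 (twist scl3 (-1)) (twist scl3W 0) (matrix_hom al1) U"

lemma K_iff: "k \<in> K U \<longleftrightarrow> is_section scl3W 0 U k \<and> (\<forall>x. al0 x (k x) = 0)"
  unfolding K_def by (rule kernel_al0_iff)

lemma N_iff: "openin P3 U \<Longrightarrow> k \<in> N U \<longleftrightarrow> k \<in> K U \<and> (\<forall>x. snd (k x) = 0)"
  unfolding N_def K_def by (rule image_al1_iff)

definition fiber :: "point set \<Rightarrow> (complex ^ 4 \<Rightarrow> complex) \<Rightarrow> (complex ^ 4 \<Rightarrow> ('v \<times> 'v \<times> 'v) \<times> complex) set" where
  "fiber U c = {k \<in> K U. \<forall>x. snd (k x) = c x}"

lemma K_add: "openin P3 U \<Longrightarrow> k \<in> K U \<Longrightarrow> l \<in> K U \<Longrightarrow> (\<lambda>x. k x + l x) \<in> K U"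
proof -
  interpret V3W: complex_vector_space scl3W by (rule vs3W)
  show "openin P3 U \<Longrightarrow> k \<in> K U \<Longrightarrow> l \<in> K U \<Longrightarrow> (\<lambda>x. k x + l x) \<in> K U"
    unfolding K_iff al0_add using V3W.section_add[of U 0 k l] by simp
qed

lemma K_smult: "openin P3 U \<Longrightarrow> is_section (*) 0 U f \<Longrightarrow> k \<in> K U \<Longrightarrow> (\<lambda>x. scl3W (f x) (k x)) \<in> K U"
proof -
  interpret V3W: complex_vector_space scl3W by (rule vs3W)
  show "openin P3 U \<Longrightarrow> is_section (*) 0 U f \<Longrightarrow> k \<in> K U \<Longrightarrow> (\<lambda>x. scl3W (f x) (k x)) \<in> K U"
    unfolding K_iff al0_scale using V3W.section_smult[of U 0 f 0 k] by simp
qed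

lemma K_diff: "openin P3 U \<Longrightarrow> k \<in> K U \<Longrightarrow> l \<in> K U \<Longrightarrow> (\<lambda>x. k x - l x) \<in> K U"
proof -
  interpret V3W: complex_vector_space scl3W by (rule vs3W)
  have "al0 x (p - q) = al0 x p - al0 x q" for x p q
    using al0_add[of x "p - q" q] by simp
  then show "openin P3 U \<Longrightarrow> k \<in> K U \<Longrightarrow> l \<in> K U \<Longrightarrow> (\<lambda>x. k x - l x) \<in> K U"
    unfolding K_iff using V3W.section_diff[of U 0 k l] by simp
qed

lemma K_restrict: "openin P3 U \<Longrightarrow> openin P3 V \<Longrightarrow> V \<subseteq> U \<Longrightarrow> k \<in> K U \<Longrightarrow> restrict_to V k \<in> K V"
proof -
  interpret V3W: complex_vector_space scl3W by (rule vs3W)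
  show "openin P3 U \<Longrightarrow> openin P3 V \<Longrightarrow> V \<subseteq> U \<Longrightarrow> k \<in> K U \<Longrightarrow> restrict_to V k \<in> K V"
    unfolding K_iff using V3W.section_restrict[of U V 0 k] by (auto simp: restrict_to_def)
qed

lemma K_zero: "openin P3 U \<Longrightarrow> (\<lambda>x. 0) \<in> K U"
proof -
  interpret V3W: complex_vector_space scl3W by (rule vs3W)
  show "openin P3 U \<Longrightarrow> (\<lambda>x. 0) \<in> K U" unfolding K_iff by simp
qed

lemma K_snd_section: "openin P3 U \<Longrightarrow> k \<in> K U \<Longrightarrow> is_section (*) 0 U (\<lambda>x. snd (k x))"
  by (simp add: K_iff section_scl3W)

text \<open>
  Two elements of the kernel differ by an element of the image if and only if their \<open>W\<close>-components
  agree, so a coset is the set of all kernel elements with a given \<open>W\<close>-component.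
\<close>

lemma coset_eq_fiber:
  assumes U: "openin P3 U" and k: "k \<in> K U" and add: "add M = (\<lambda>s t x. s x + t x)"
  shows "N U +>\<^bsub>M\<^esub> k = fiber U (\<lambda>x. snd (k x))"
proof -
  have coset: "N U +>\<^bsub>M\<^esub> k = (\<Union>n\<in>N U. {\<lambda>x. n x + k x})"
    by (simp add: a_r_coset_def r_coset_def add)
  show ?thesis
    unfolding coset
  proof (intro equalityI subsetI)
    fix l assume "l \<in> (\<Union>n\<in>N U. {\<lambda>x. n x + k x})"
    then obtain n where n: "n \<in> N U" "l = (\<lambda>x. n x + k x)" by blast
    then show "l \<in> fiber U (\<lambda>x. snd (k x))"
      using K_add[OF U _ k] N_iff[OF U] by (simp add: fiber_def)
  next
    fix l assume l: "l \<in> fiber U (\<lambda>x. snd (k x))"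
    have "(\<lambda>x. l x - k x) \<in> N U" using l K_diff[OF U _ k] N_iff[OF U] by (simp add: fiber_def)
    moreover have "l = (\<lambda>x. (l x - k x) + k x)" by simp
    ultimately show "l \<in> (\<Union>n\<in>N U. {\<lambda>x. n x + k x})" by (intro UN_I) auto
  qed
qed

lemma UN_const_fiber: "k \<in> C \<Longrightarrow> (\<And>l. l \<in> C \<Longrightarrow> f l = D) \<Longrightarrow> (\<Union>l\<in>C. f l) = D"
  by auto

abbreviation Q where "Q \<equiv> quot_presheaf (twist scl3W 0) K N"

definition second :: "point set \<Rightarrow> (complex ^ 4 \<Rightarrow> ('v \<times> 'v \<times> 'v) \<times> complex) set \<Rightarrow> complex ^ 4 \<Rightarrow> complex" where
  "second U C = (\<lambda>x. snd ((SOME k. k \<in> C) x))"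

lemma fiber_self: "k \<in> K U \<Longrightarrow> k \<in> fiber U (\<lambda>x. snd (k x))"
  by (simp add: fiber_def)

lemma second_fiber: "k \<in> fiber U c \<Longrightarrow> second U (fiber U c) = c"
proof -
  assume "k \<in> fiber U c"
  then have "(SOME k. k \<in> fiber U c) \<in> fiber U c" by (rule someI[of "\<lambda>k. k \<in> fiber U c"])
  then show ?thesis by (auto simp: fiber_def second_def)
qed

lemma carrier_Q:
  assumes U: "openin P3 U"
  shows "carrier (sec Q U) = {fiber U (\<lambda>x. snd (k x)) | k. k \<in> K U}"
proof -
  have "carrier (sec Q U) = (\<Union>k\<in>K U. {N U +>\<^bsub>(sec (twist scl3W 0) U)\<lparr>carrier := K U\<rparr>\<^esub> k})"
    by (simp add: quot_presheaf_def A_RCOSETS_def RCOSETS_def a_r_coset_def Let_def)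
  moreover have "N U +>\<^bsub>(sec (twist scl3W 0) U)\<lparr>carrier := K U\<rparr>\<^esub> k = fiber U (\<lambda>x. snd (k x))" if "k \<in> K U" for k
    by (rule coset_eq_fiber[OF U that]) simp
  ultimately show ?thesis by auto
qed

lemma Q_elim:
  assumes U: "openin P3 U" and C: "C \<in> carrier (sec Q U)"
  obtains k where "k \<in> K U" "C = fiber U (\<lambda>x. snd (k x))" "second U C = (\<lambda>x. snd (k x))"
  using C second_fiber[OF fiber_self] unfolding carrier_Q[OF U] by auto

lemma Q_add:
  assumes U: "openin P3 U" and k: "k \<in> K U" and l: "l \<in> K U"
  shows "fiber U (\<lambda>x. snd (k x)) \<oplus>\<^bsub>sec Q U\<^esub> fiber U (\<lambda>x. snd (l x)) = fiber U (\<lambda>x. snd (k x + l x))"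
proof -
  have "fiber U (\<lambda>x. snd (k x)) \<oplus>\<^bsub>sec Q U\<^esub> fiber U (\<lambda>x. snd (l x)) =
    {\<lambda>x. a x + b x | a b. a \<in> fiber U (\<lambda>x. snd (k x)) \<and> b \<in> fiber U (\<lambda>x. snd (l x))}"
    by (auto simp: quot_presheaf_def Let_def set_add_def set_mult_def)
  also have "\<dots> = fiber U (\<lambda>x. snd (k x + l x))"
  proof (intro equalityI subsetI)
    fix z assume "z \<in> {\<lambda>x. a x + b x | a b. a \<in> fiber U (\<lambda>x. snd (k x)) \<and> b \<in> fiber U (\<lambda>x. snd (l x))}"
    then show "z \<in> fiber U (\<lambda>x. snd (k x + l x))"
      using K_add[OF U] by (auto simp: fiber_def)
  next
    fix z assume z: "z \<in> fiber U (\<lambda>x. snd (k x + l x))"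
    have "(\<lambda>x. z x - l x) \<in> fiber U (\<lambda>x. snd (k x))"
      using z K_diff[OF U _ l] by (simp add: fiber_def)
    moreover have "z = (\<lambda>x. (z x - l x) + l x)" by simp
    ultimately show "z \<in> {\<lambda>x. a x + b x | a b. a \<in> fiber U (\<lambda>x. snd (k x)) \<and> b \<in> fiber U (\<lambda>x. snd (l x))}"
      using fiber_self[OF l] by (intro CollectI exI[of _ "\<lambda>x. z x - l x"] exI[of _ l] conjI)
  qed
  finally show ?thesis .
qed

lemma snd_scl3W: "snd (scl3W c p) = c * snd p"
  by (cases p) simp

lemma Q_smult:
  assumes U: "openin P3 U" and f: "is_section (*) 0 U f" and k: "k \<in> K U"
  shows "f \<odot>\<^bsub>sec Q U\<^esub> fiber U (\<lambda>x. snd (k x)) = fiber U (\<lambda>x. snd (scl3W (f x) (k x)))"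
proof -
  let ?M = "(sec (twist scl3W 0) U)\<lparr>carrier := K U\<rparr>"
  have "f \<odot>\<^bsub>sec Q U\<^esub> fiber U (\<lambda>x. snd (k x)) = (\<Union>l\<in>fiber U (\<lambda>x. snd (k x)). N U +>\<^bsub>?M\<^esub> (\<lambda>x. scl3W (f x) (l x)))"
    by (simp add: quot_presheaf_def Let_def)
  also have "\<dots> = fiber U (\<lambda>x. snd (scl3W (f x) (k x)))"
  proof (rule UN_const_fiber[OF fiber_self[OF k]])
    fix l assume l: "l \<in> fiber U (\<lambda>x. snd (k x))"
    then have "N U +>\<^bsub>?M\<^esub> (\<lambda>x. scl3W (f x) (l x)) = fiber U (\<lambda>x. snd (scl3W (f x) (l x)))"
      by (intro coset_eq_fiber[OF U K_smult[OF U f]]) (simp_all add: fiber_def)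
    also have "(\<lambda>x. snd (scl3W (f x) (l x))) = (\<lambda>x. snd (scl3W (f x) (k x)))"
      using l by (simp add: fiber_def snd_scl3W)
    finally show "N U +>\<^bsub>?M\<^esub> (\<lambda>x. scl3W (f x) (l x)) = fiber U (\<lambda>x. snd (scl3W (f x) (k x)))" .
  qed
  finally show ?thesis .
qed

lemma Q_res:
  assumes U: "openin P3 U" and V: "openin P3 V" "V \<subseteq> U" and k: "k \<in> K U"
  shows "res Q U V (fiber U (\<lambda>x. snd (k x))) = fiber V (\<lambda>x. snd (restrict_to V k x))"
proof -
  let ?M = "sec (twist scl3W 0) V"
  have "res Q U V (fiber U (\<lambda>x. snd (k x))) = (\<Union>l\<in>fiber U (\<lambda>x. snd (k x)). N V +>\<^bsub>?M\<^esub> restrict_to V l)"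
    by (simp add: quot_presheaf_def)
  also have "\<dots> = fiber V (\<lambda>x. snd (restrict_to V k x))"
  proof (rule UN_const_fiber[OF fiber_self[OF k]])
    fix l assume l: "l \<in> fiber U (\<lambda>x. snd (k x))"
    then have "N V +>\<^bsub>?M\<^esub> restrict_to V l = fiber V (\<lambda>x. snd (restrict_to V l x))"
      by (intro coset_eq_fiber[OF V(1) K_restrict[OF U V]]) (simp_all add: fiber_def)
    also have "(\<lambda>x. snd (restrict_to V l x)) = (\<lambda>x. snd (restrict_to V k x))"
      using l by (auto simp add: fiber_def restrict_to_def)
    finally show "N V +>\<^bsub>?M\<^esub> restrict_to V l = fiber V (\<lambda>x. snd (restrict_to V k x))" .
  qed
  finally show ?thesis .
qed

lemma fiber_in_Q: "openin P3 U \<Longrightarrow> k \<in> K U \<Longrightarrow> fiber U (\<lambda>x. snd (k x)) \<in> carrier (sec Q U) \<and>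
    second U (fiber U (\<lambda>x. snd (k x))) = (\<lambda>x. snd (k x))"
  using carrier_Q second_fiber[OF fiber_self] by blast

sublocale coh: function_presheaf Q second
proof
  fix U s assume U: "openin P3 U" and s: "s \<in> carrier (sec Q U)"
  obtain k where k: "k \<in> K U" "s = fiber U (\<lambda>x. snd (k x))" "second U s = (\<lambda>x. snd (k x))"
    by (rule Q_elim[OF U s])
  show "is_section (*) 0 U (second U s)" unfolding k(3) by (rule K_snd_section[OF U k(1)])
  show "res Q U V s \<in> carrier (sec Q V) \<and> second V (res Q U V s) = restrict_to V (second U s)"
    if V: "openin P3 V" "V \<subseteq> U" for V
    unfolding k(3) unfolding k(2) Q_res[OF U V k(1)]
    using fiber_in_Q[OF V(1) K_restrict[OF U V k(1)]] by (simp add: restrict_to_def if_distrib cong: if_cong)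
  show "f \<odot>\<^bsub>sec Q U\<^esub> s \<in> carrier (sec Q U) \<and> second U (f \<odot>\<^bsub>sec Q U\<^esub> s) = (\<lambda>x. f x * second U s x)"
    if f: "is_section (*) 0 U f" for f
    unfolding k(3) unfolding k(2) Q_smult[OF U f k(1)]
    using fiber_in_Q[OF U K_smult[OF U f k(1)]] by (simp add: snd_scl3W)
  fix t assume t: "t \<in> carrier (sec Q U)"
  obtain l where l: "l \<in> K U" "t = fiber U (\<lambda>x. snd (l x))" "second U t = (\<lambda>x. snd (l x))"
    by (rule Q_elim[OF U t])
  show "s = t" if "second U s = second U t" using that unfolding k(3) l(3) unfolding k(2) l(2) by simp
  show "s \<oplus>\<^bsub>sec Q U\<^esub> t \<in> carrier (sec Q U) \<and> second U (s \<oplus>\<^bsub>sec Q U\<^esub> t) = (\<lambda>x. second U s x + second U t x)"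
    unfolding k(3) l(3) unfolding k(2) l(2) Q_add[OF U k(1) l(1)]
    using fiber_in_Q[OF U K_add[OF U k(1) l(1)]] by simp
next
  fix U assume U: "openin P3 U"
  show "\<exists>s\<in>carrier (sec Q U). second U s = (\<lambda>x. 0)"
    using fiber_in_Q[OF U K_zero[OF U]] by auto
qed

lemma cohomology_iso:
  "sheaf_iso P3 O_P3 (cohomology_sheaf P3 O_P3 (twist scl3 (-1)) (matrix_hom al1) (twist scl3W 0) (matrix_hom al0) (twist scl 1))
    (ideal_module O_P3 coh.J)"
proof -
  have "K = ker_sheaf (twist scl3W 0) (twist scl 1) (matrix_hom al0)"
    "N = im_sheaf P3 (twist scl3 (-1)) (twist scl3W 0) (matrix_hom al1)"
    by (auto simp: fun_eq_iff K_def N_def)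
  then show ?thesis unfolding cohomology_sheaf_def using coh.sheafify_iso by simp
qed

text \<open>
  Eliminates the cosets from the description of the ideal sheaf of the theorem.
\<close>

lemma coh_J_iff:
  "c \<in> coh.J U \<longleftrightarrow> (\<forall>x. x \<notin> cone U \<longrightarrow> c x = 0) \<and>
     (\<forall>p\<in>U. \<exists>V. openin P3 V \<and> p \<in> V \<and> V \<subseteq> U \<and> (\<exists>k\<in>K V. \<forall>y\<in>cone V. c y = snd (k y)))"
proof -
  have "(\<exists>t\<in>carrier (sec Q V). coh.agree V c (second V t)) \<longleftrightarrow> (\<exists>k\<in>K V. \<forall>y\<in>cone V. c y = snd (k y))"
    if V: "openin P3 V" for V
  proof
    assume "\<exists>t\<in>carrier (sec Q V). coh.agree V c (second V t)"
    then obtain t where t: "t \<in> carrier (sec Q V)" "coh.agree V c (second V t)" by blast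
    obtain k where "k \<in> K V" "second V t = (\<lambda>x. snd (k x))"
      by (rule Q_elim[OF V t(1)])
    then show "\<exists>k\<in>K V. \<forall>y\<in>cone V. c y = snd (k y)"
      using t(2) by (auto simp: coh.agree_def)
  next
    assume "\<exists>k\<in>K V. \<forall>y\<in>cone V. c y = snd (k y)"
    then obtain k where k: "k \<in> K V" "\<forall>y\<in>cone V. c y = snd (k y)" by blast
    then show "\<exists>t\<in>carrier (sec Q V). coh.agree V c (second V t)"
      using fiber_in_Q[OF V k(1)]
      by (intro bexI[of _ "fiber V (\<lambda>x. snd (k x))"]) (simp_all add: coh.agree_def)
  qed
  then show ?thesis unfolding coh.J_def mem_Collect_eq by (metis (no_types, lifting))
qed

end

section \<open>Trivializations\<close>

lemma twist_iso_twist_sum: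
  assumes vs: "complex_vector_space scl" and fin: "finite b" "module.span scl b = UNIV"
  shows "\<exists>a. sheaf_iso P3 O_P3 (twist scl n) (twist_sum n a)"
proof -
  interpret V: complex_vector_space scl by (rule vs)
  obtain B where B: "B \<subseteq> b" "V.independent B" "b \<subseteq> V.span B"
    by (rule V.maximal_independent_subset[of b])
  have finB: "finite B" using B(1) fin(1) by (rule finite_subset)
  have spB: "V.span B = UNIV" using V.span_mono[OF B(3)] fin(2) by (auto simp: V.span_span)
  obtain e where e: "bij_betw e {0..<card B} B" using ex_bij_betw_nat_finite[OF finB] by blast
  define a where "a = card B"
  have e: "bij_betw e {..<a} B" using e by (simp add: a_def atLeast0LessThan)
  define r where "r i v = V.representation B v (e i)" for i v
  have lin_r: "Vector_Spaces.linear scl (*) (r i)" for i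
    by unfold_locales (simp_all add: r_def V.representation_add V.representation_scale B(2) spB)
  have lin_e: "Vector_Spaces.linear (*) scl (\<lambda>c. scl c (e i))" for i
    by unfold_locales (simp_all add: V.scale_left_distrib)
  have expand: "(\<Sum>i<a. scl (r i v) (e i)) = v" for v
  proof -
    have "(\<Sum>i<a. scl (r i v) (e i)) = (\<Sum>u\<in>B. scl (V.representation B v u) u)"
      unfolding r_def by (rule sum.reindex_bij_betw[OF e])
    also have "\<dots> = v" using V.sum_representation_eq[OF B(2) _ finB subset_refl, of v] spB by simp
    finally show ?thesis .
  qed
  have coeff: "r j (\<Sum>i<a. scl (t i) (e i)) = t j" if j: "j < a" for j t
  proof -
    interpret r: Vector_Spaces.linear scl "(*)" "r j" by (rule lin_r)
    have "r j (e i) = (if i = j then 1 else 0)" if "i < a" for i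
      using V.representation_basis[OF B(2), of "e i"] e that j
      by (auto simp: r_def bij_betw_def inj_on_def)
    then have "r j (\<Sum>i<a. scl (t i) (e i)) = (\<Sum>i<a. t i * (if i = j then 1 else 0))"
      unfolding r.sum r.scale by (intro sum.cong) auto
    also have "\<dots> = t j" using j by (simp add: if_distrib[of "(*) _"] cong: if_cong)
    finally show ?thesis .
  qed
  have r_simps: "r i (u + v) = r i u + r i v" "r i (scl c v) = c * r i v" "r i 0 = 0" for i u v c
  proof -
    interpret r: Vector_Spaces.linear scl "(*)" "r i" by (rule lin_r)
    show "r i (u + v) = r i u + r i v" "r i (scl c v) = c * r i v" "r i 0 = 0" by (rule r.add, rule r.scale, rule r.zero)
  qed
  define \<phi> where "\<phi> U s = (\<lambda>i\<in>{..<a}. \<lambda>x. r i (s x))" for U :: "point set" and s :: "complex ^ 4 \<Rightarrow> _"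
  define \<psi> where "\<psi> t = (\<lambda>x. \<Sum>i<a. scl (t i x) (e i))" for t :: "nat \<Rightarrow> complex ^ 4 \<Rightarrow> complex"
  have \<phi>: "\<phi> U s \<in> carrier (sec (twist_sum n a) U)" if U: "openin P3 U" and s: "is_section scl n U s" for U s
    using section_comp_linear[OF vs complex_vector_space_self lin_r U s]
    by (auto simp: twist_sum_def sheaf_power_def \<phi>_def)
  have \<psi>: "\<psi> t \<in> carrier (sec (twist scl n) U)" if U: "openin P3 U" and t: "t \<in> carrier (sec (twist_sum n a) U)" for U t
  proof -
    have "is_section (*) n U (t i)" if "i < a" for i
      using t that by (auto simp: twist_sum_def sheaf_power_def)
    then have "is_section scl n U (\<lambda>x. scl (t i x) (e i))" if "i < a" for i
      using section_comp_linear[OF complex_vector_space_self vs lin_e U] that by blast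
    then show ?thesis unfolding \<psi>_def using V.section_sum[OF U, of "{..<a}"] by simp
  qed
  have "sheaf_hom P3 O_P3 (twist scl n) (twist_sum n a) \<phi>"
    unfolding sheaf_hom_def
  proof (intro allI impI conjI ballI)
    fix U assume U: "openin P3 U"
    fix s assume s: "s \<in> carrier (sec (twist scl n) U)"
    show "\<phi> U s \<in> carrier (sec (twist_sum n a) U)" using \<phi>[OF U] s by simp
    show "\<phi> U (s \<oplus>\<^bsub>sec (twist scl n) U\<^esub> t) = \<phi> U s \<oplus>\<^bsub>sec (twist_sum n a) U\<^esub> \<phi> U t" for t
      by (auto simp: \<phi>_def twist_sum_def sheaf_power_def r_simps fun_eq_iff)
    show "\<phi> U (f \<odot>\<^bsub>sec (twist scl n) U\<^esub> s) = f \<odot>\<^bsub>sec (twist_sum n a) U\<^esub> \<phi> U s" for f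
      by (auto simp: \<phi>_def twist_sum_def sheaf_power_def r_simps fun_eq_iff)
    show "\<phi> V (res (twist scl n) U V s) = res (twist_sum n a) U V (\<phi> U s)" for V
      by (auto simp: \<phi>_def twist_sum_def sheaf_power_def r_simps restrict_to_def fun_eq_iff)
  qed
  moreover have "bij_betw (\<phi> U) (carrier (sec (twist scl n) U)) (carrier (sec (twist_sum n a) U))" if U: "openin P3 U" for U
  proof (rule bij_betw_byWitness[of _ \<psi>])
    show "\<forall>s\<in>carrier (sec (twist scl n) U). \<psi> (\<phi> U s) = s"
      by (simp add: \<phi>_def \<psi>_def expand)
    show "\<forall>t\<in>carrier (sec (twist_sum n a) U). \<phi> U (\<psi> t) = t"
    proof
      fix t assume "t \<in> carrier (sec (twist_sum n a) U)"
      then have "t \<in> extensional {..<a}" by (auto simp: twist_sum_def sheaf_power_def PiE_def)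
      then show "\<phi> U (\<psi> t) = t"
        by (intro extensionalityI[of _ "{..<a}"]) (auto simp: \<phi>_def \<psi>_def coeff)
    qed
    show "\<phi> U ` carrier (sec (twist scl n) U) \<subseteq> carrier (sec (twist_sum n a) U)" using \<phi>[OF U] by auto
    show "\<psi> ` carrier (sec (twist_sum n a) U) \<subseteq> carrier (sec (twist scl n) U)" using \<psi>[OF U] by blast
  qed
  ultimately show ?thesis unfolding sheaf_iso_def by blast
qed

section \<open>Polynomials acting on the coefficient space\<close>

lemma poly_mapping_sum_single: "(\<Sum>m\<in>Poly_Mapping.keys p. Poly_Mapping.single m (Poly_Mapping.lookup p m)) = p"
proof (rule poly_mapping_eqI)
  fix k
  have "Poly_Mapping.lookup (\<Sum>m\<in>Poly_Mapping.keys p. Poly_Mapping.single m (Poly_Mapping.lookup p m)) k =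
    (\<Sum>m\<in>Poly_Mapping.keys p. if m = k then Poly_Mapping.lookup p m else 0)"
    unfolding lookup_sum by (intro sum.cong) (auto simp: lookup_single)
  also have "\<dots> = Poly_Mapping.lookup p k"
    by (simp add: in_keys_iff)
  finally show "Poly_Mapping.lookup (\<Sum>m\<in>Poly_Mapping.keys p. Poly_Mapping.single m (Poly_Mapping.lookup p m)) k = Poly_Mapping.lookup p k" .
qed

abbreviation Z :: "3 \<Rightarrow> (3, complex) polynomials" where
  "Z i \<equiv> Poly_Mapping.single (Poly_Mapping.single i 1) 1"

lemma UNIV_3': "(UNIV :: 3 set) = {0, 1, 2}"
  using UNIV_3 by auto

text \<open>
  Induction along constants, sums and multiplication with a variable. These are the operations that
  evaluation, the action on \<open>V\<^sub>1\<close> and homogenization are compatible with.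
\<close>

lemma polynomial_induct [case_names const add var]:
  fixes p :: "(3, complex) polynomials"
  assumes const: "\<And>a. P (Poly_Mapping.single 0 a)"
    and add: "\<And>p q. P p \<Longrightarrow> P q \<Longrightarrow> P (p + q)"
    and var: "\<And>i p. P p \<Longrightarrow> P (Z i * p)"
  shows "P p"
proof -
  have mono: "P (Poly_Mapping.single m a)" if "(\<Sum>j\<in>UNIV. Poly_Mapping.lookup m j) = n" for n m a
    using that
  proof (induction n arbitrary: m)
    case 0
    then have "m = 0" by (intro poly_mapping_eqI) simp
    then show ?case using const by simp
  next
    case (Suc n)
    then have "\<exists>i. Poly_Mapping.lookup m i \<noteq> 0" by (metis sum.neutral nat.distinct(1))
    then obtain i where i: "Poly_Mapping.lookup m i \<noteq> 0" by blast
    define m' where "m' = m - Poly_Mapping.single i 1"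
    have m: "m = m' + Poly_Mapping.single i 1"
      using i by (intro poly_mapping_eqI) (auto simp: m'_def lookup_add lookup_minus lookup_single when_def)
    then have "(\<Sum>j\<in>UNIV. Poly_Mapping.lookup m' j) = n"
      using Suc.prems sum_lookup_single_add[of m' i] unfolding m[symmetric] by simp
    then have "P (Z i * Poly_Mapping.single m' a)" by (intro var Suc.IH)
    then show ?case by (simp add: mult_single m add.commute)
  qed
  have "P (\<Sum>m\<in>M. Poly_Mapping.single m (Poly_Mapping.lookup p m))" if "finite M" for M
    using that
  proof induction
    case empty
    then show ?case using const[of 0] by simp
  next
    case (insert m M)
    then show ?case using add[OF mono[OF refl]] by simp
  qed
  from this[of "Poly_Mapping.keys p"] show ?thesis by (simp add: poly_mapping_sum_single)
qed

lemma poly_eval_var: "poly_eval (*) (Z i * p) x = x $ i * poly_eval (*) p x"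
proof -
  have "Z i * p = (\<Sum>m\<in>Poly_Mapping.keys p. Poly_Mapping.single (m + Poly_Mapping.single i 1) (Poly_Mapping.lookup p m))"
    by (subst poly_mapping_sum_single[of p, symmetric]) (simp add: sum_distrib_left mult_single add.commute)
  then show ?thesis
    by (simp only: scalars.poly_eval_sum scalars.poly_eval_single prod_coord_single_add)
      (simp add: poly_eval_def sum_distrib_left mult.assoc)
qed

lemma poly_eval_const: "poly_eval (*) (Poly_Mapping.single 0 a) x = a"
  by (simp add: scalars.poly_eval_single)

lemma funpow_commute:
  assumes "T \<circ> T' = T' \<circ> T"
  shows "(T ^^ a) ((T' ^^ b) v) = (T' ^^ b) ((T ^^ a) v)"
proof -
  have c: "T (T' v) = T' (T v)" for v using assms by (metis comp_apply)
  have 1: "T ((T' ^^ b) v) = (T' ^^ b) (T v)" for v by (induction b) (simp_all add: c)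
  show ?thesis by (induction a) (simp_all add: 1)
qed

context adhm
begin

abbreviation act where "act \<equiv> poly_operator scl B0 B1 B2"

definition B :: "3 \<Rightarrow> 'v \<Rightarrow> 'v" where
  "B i = (if i = 0 then B0 else if i = 1 then B1 else B2)"

definition monomial_act :: "(3 \<Rightarrow>\<^sub>0 nat) \<Rightarrow> 'v \<Rightarrow> 'v" where
  "monomial_act m v = (B0 ^^ Poly_Mapping.lookup m 0) ((B1 ^^ Poly_Mapping.lookup m 1) ((B2 ^^ Poly_Mapping.lookup m 2) v))"

lemma act_def: "act p v = (\<Sum>m\<in>Poly_Mapping.keys p. scl (Poly_Mapping.lookup p m) (monomial_act m v))"
  by (simp add: poly_operator_def monomial_act_def)

lemma act_single: "act (Poly_Mapping.single m a) v = scl a (monomial_act m v)"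
  by (cases "a = 0") (auto simp: act_def)

lemma act_const: "act (Poly_Mapping.single 0 a) v = scl a v"
  by (simp add: act_single monomial_act_def)

lemma act_add: "act (p + q) v = act p v + act q v"
proof -
  let ?M = "Poly_Mapping.keys p \<union> Poly_Mapping.keys q"
  have ext: "act r v = (\<Sum>m\<in>?M. scl (Poly_Mapping.lookup r m) (monomial_act m v))"
    if "Poly_Mapping.keys r \<subseteq> ?M" for r
    unfolding act_def using that by (intro sum.mono_neutral_left) (auto simp: in_keys_iff)
  show ?thesis
    using ext[of p] ext[of q] ext[of "p + q"] Poly_Mapping.keys_add[of p q]
    by (simp add: lookup_add scale_left_distrib sum.distrib)
qed

lemma act_0: "act 0 v = 0"
  by (simp add: act_def)

lemma act_sum: "act (\<Sum>j\<in>M. p j) v = (\<Sum>j\<in>M. act (p j) v)"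
  by (induction M rule: infinite_finite_induct) (auto simp: act_add act_0)

lemma linear_B: "Vector_Spaces.linear scl scl (B i)"
  using lin by (simp add: B_def)

lemma monomial_act_Suc: "monomial_act (m + Poly_Mapping.single i 1) v = B i (monomial_act m v)"
proof -
  have "i \<in> {0, 1, 2}" using UNIV_3' by blast
  then consider "i = 0" | "i = 1" | "i = 2" by blast
  then show ?thesis
  proof cases
    case 1
    then show ?thesis by (simp add: monomial_act_def B_def lookup_add lookup_single)
  next
    case 2
    have "B1 ((B0 ^^ a) w) = (B0 ^^ a) (B1 w)" for a w
      using funpow_commute[OF comm(1)[symmetric], of 1 a w] by simp
    then show ?thesis using 2 by (simp add: monomial_act_def B_def lookup_add lookup_single)
  next
    case 3
    have "B2 ((B0 ^^ a) w) = (B0 ^^ a) (B2 w)" "B2 ((B1 ^^ a) w) = (B1 ^^ a) (B2 w)" for a w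
      using funpow_commute[OF comm(2)[symmetric], of 1 a w] funpow_commute[OF comm(3)[symmetric], of 1 a w] by simp_all
    then show ?thesis using 3 by (simp add: monomial_act_def B_def lookup_add lookup_single)
  qed
qed

lemma act_var: "act (Z i * p) v = B i (act p v)"
proof -
  interpret Bi: Vector_Spaces.linear scl scl "B i" by (rule linear_B)
  have "Z i * p = (\<Sum>m\<in>Poly_Mapping.keys p. Poly_Mapping.single (m + Poly_Mapping.single i 1) (Poly_Mapping.lookup p m))"
    by (subst poly_mapping_sum_single[of p, symmetric]) (simp add: sum_distrib_left mult_single add.commute)
  then show ?thesis
    unfolding act_def[of p] Bi.sum Bi.scale by (simp only: act_sum act_single monomial_act_Suc)
qed

text \<open>
  The reason why the kernel of \<open>\<Phi>\<^sub>X\<close> is an ideal: \<open>(q p)(B) v = q(B) (p(B) v)\<close>.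
\<close>

lemma act_mult_eq_0:
  assumes "act p v = 0" shows "act (q * p) v = 0"
proof (induction q rule: polynomial_induct)
  case (const a)
  have "Poly_Mapping.single 0 a * p = (\<Sum>m\<in>Poly_Mapping.keys p. Poly_Mapping.single m (a * Poly_Mapping.lookup p m))"
    by (subst poly_mapping_sum_single[of p, symmetric]) (simp add: sum_distrib_left mult_single)
  then have "act (Poly_Mapping.single 0 a * p) v = scl a (act p v)"
    by (simp add: act_sum act_single) (simp add: act_def scale_sum_right)
  then show ?case using assms by simp
next
  case (add p q)
  then show ?case by (simp add: distrib_right act_add)
next
  case (var i p)
  interpret Bi: Vector_Spaces.linear scl scl "B i" by (rule linear_B)
  show ?case unfolding mult.assoc act_var using var Bi.zero by simp
qed

lemma subspace_kernel: "Modules.module.subspace (*) {p. Phi scl B0 B1 B2 I p = 0}"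
proof -
  interpret M: Modules.module "(*) :: (3, complex) polynomials \<Rightarrow> _"
    by unfold_locales (simp_all add: algebra_simps)
  show ?thesis
    by (rule M.subspaceI) (simp_all add: Phi_def act_0 act_add act_mult_eq_0)
qed

end

section \<open>Homogenization\<close>

definition proj_index :: "3 \<Rightarrow> 4" where
  "proj_index i = (if i = 0 then 0 else if i = 1 then 1 else 2)"

text \<open>
  \<open>homogenization d f p\<close> relates a form \<open>f\<close> of degree \<open>d\<close> in four variables to the polynomial \<open>p\<close> in the affine
  coordinates with \<open>f(z) = z\<^sub>3\<^sup>d p(Z)\<close>. Being generated by the same operations as the polynomials, the
  relation carries facts about \<open>p\<close> over to facts about \<open>f\<close> by rule induction.
\<close>

inductive homogenization :: "nat \<Rightarrow> (complex ^ 4 \<Rightarrow> complex) \<Rightarrow> (3, complex) polynomials \<Rightarrow> bool" where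
  const: "homogenization 0 (\<lambda>x. a) (Poly_Mapping.single 0 a)"
| add: "homogenization d f p \<Longrightarrow> homogenization d g q \<Longrightarrow> homogenization d (\<lambda>x. f x + g x) (p + q)"
| var: "homogenization d f p \<Longrightarrow> homogenization (Suc d) (\<lambda>x. x $ proj_index i * f x) (Z i * p)"
| shift: "homogenization d f p \<Longrightarrow> homogenization (Suc d) (\<lambda>x. x $ 3 * f x) p"

lemma homogenization_form: "homogenization d f p \<Longrightarrow> form (*) UNIV d f"
proof (induction rule: homogenization.induct)
  case (add d f p g q)
  then show ?case by (intro scalars.form_add)
next
  case (var d f p i)
  then show ?case by (intro scalars.form_coord) simp_all
next
  case (shift d f p)
  then show ?case by (intro scalars.form_coord) simp_all
qed simp

lemma homogenization_value:
  "homogenization d f p \<Longrightarrow> x $ 3 \<noteq> 0 \<Longrightarrow> f x = x $ 3 ^ d * poly_eval (*) p (affine_coords x)"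
proof (induction rule: homogenization.induct)
  case (const a)
  then show ?case by (simp add: poly_eval_const)
next
  case (add d f p g q)
  then show ?case by (simp add: scalars.poly_eval_add distrib_left)
next
  case (var d f p i)
  have "i \<in> {0, 1, 2}" using UNIV_3' by blast
  then have "x $ proj_index i = x $ 3 * affine_coords x $ i"
    using var.prems by (auto simp: proj_index_def affine_coords_def)
  then show ?case unfolding poly_eval_var using var by simp
next
  case (shift d f p)
  then show ?case by simp
qed

lemma homogenization_of_form: "form (*) UNIV d f \<Longrightarrow> \<exists>p. homogenization d f p"
proof (induction d arbitrary: f)
  case 0
  then obtain a where "f = (\<lambda>x. a)" by (auto simp: form.simps(1))
  then show ?case using homogenization.const by blast
next
  case (Suc d)
  obtain g where g: "\<forall>i\<in>UNIV. form (*) UNIV d (g i)" "f = (\<lambda>x. \<Sum>i\<in>UNIV. x $ i * g i x)"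
    using Suc.prems unfolding form_Suc by (elim exE conjE)
  have ex: "\<exists>p. homogenization d (g i) p" for i using g(1) Suc.IH by blast
  obtain p0 p1 p2 p3 where p: "homogenization d (g 0) p0" "homogenization d (g 1) p1"
    "homogenization d (g 2) p2" "homogenization d (g 3) p3"
    using ex[of 0] ex[of 1] ex[of 2] ex[of 3] by (elim exE)
  have "f = (\<lambda>x. ((x $ 0 * g 0 x + x $ 1 * g 1 x) + x $ 2 * g 2 x) + x $ 3 * g 3 x)"
    unfolding g(2) UNIV_4' by (simp add: add_ac)
  moreover have "homogenization (Suc d) (\<lambda>x. ((x $ 0 * g 0 x + x $ 1 * g 1 x) + x $ 2 * g 2 x) + x $ 3 * g 3 x)
      (((Z 0 * p0 + Z 1 * p1) + Z 2 * p2) + p3)"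
    using homogenization.var[OF p(1), of 0] homogenization.var[OF p(2), of 1] homogenization.var[OF p(3), of 2]
    by (intro homogenization.add homogenization.shift[OF p(4)]) (simp_all add: proj_index_def)
  ultimately show ?case by blast
qed

lemma homogenization_raise: "homogenization d f p \<Longrightarrow> \<exists>f'. homogenization (d + k) f' p"
  by (induction k) (auto intro: homogenization.shift)

lemma homogenization_exists: "\<exists>d f. homogenization d f p"
proof (induction p rule: polynomial_induct)
  case (const a)
  then show ?case using homogenization.const by blast
next
  case (add p q)
  then obtain d f d' g where "homogenization d f p" "homogenization d' g q" by blast
  then obtain f' g' where "homogenization (d + d') f' p" "homogenization (d' + d) g' q"
    using homogenization_raise by blast
  then show ?case using homogenization.add[of "d + d'" f' p g' q] by (auto simp: add.commute)
next
  case (var i p)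
  then show ?case using homogenization.var by blast
qed

context adhm
begin

abbreviation A_sum :: "complex ^ 4 \<Rightarrow> 'v \<Rightarrow> 'v \<Rightarrow> 'v \<Rightarrow> 'v" where
  "A_sum x u v w \<equiv> A0 x u + A1 x v + A2 x w"

text \<open>
  Congruence of \<open>F\<close> and \<open>z\<^sub>3\<^sup>d v\<close> modulo the image of the \<open>A\<^sub>i\<close>, after multiplication with \<open>z\<^sub>3\<close>. The factor
  \<open>z\<^sub>3\<close> is the one in front of \<open>I\<close>, and it lets the degree \<open>d\<close> of the coefficients be a natural number
  even for constant \<open>F\<close>.
\<close>

definition reduces_to :: "nat \<Rightarrow> (complex ^ 4 \<Rightarrow> 'v) \<Rightarrow> 'v \<Rightarrow> bool" where
  "reduces_to d F v \<longleftrightarrow> (\<exists>a b c. form scl UNIV d a \<and> form scl UNIV d b \<and> form scl UNIV d c \<and>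
     (\<forall>x. scl (x $ 3) (F x) = A_sum x (a x) (b x) (c x) + scl (x $ 3 ^ Suc d) v))"

lemma reduces_toI:
  assumes "form scl UNIV d a" "form scl UNIV d b" "form scl UNIV d c"
    "\<And>x. scl (x $ 3) (F x) = A_sum x (a x) (b x) (c x) + scl (x $ 3 ^ Suc d) v"
  shows "reduces_to d F v"
  unfolding reduces_to_def using assms by (intro exI[of _ a] exI[of _ b] exI[of _ c]) simp

lemma reduces_toE:
  assumes "reduces_to d F v"
  obtains a b c where "form scl UNIV d a" "form scl UNIV d b" "form scl UNIV d c"
    "\<And>x. scl (x $ 3) (F x) = A_sum x (a x) (b x) (c x) + scl (x $ 3 ^ Suc d) v"
  using assms unfolding reduces_to_def by (elim exE conjE) (rule that, auto)

lemma reduces_to_const: "reduces_to 0 (\<lambda>x. v) v"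
  by (rule reduces_toI[of 0 "\<lambda>x. 0" "\<lambda>x. 0" "\<lambda>x. 0"]) (simp_all add: A0.zero A1.zero A2.zero)

lemma reduces_to_add:
  assumes "reduces_to d F v" "reduces_to d F' v'"
  shows "reduces_to d (\<lambda>x. F x + F' x) (v + v')"
proof -
  obtain a b c where abc: "form scl UNIV d a" "form scl UNIV d b" "form scl UNIV d c"
    "\<And>x. scl (x $ 3) (F x) = A_sum x (a x) (b x) (c x) + scl (x $ 3 ^ Suc d) v"
    by (rule reduces_toE[OF assms(1)], rule that)
  obtain a' b' c' where abc': "form scl UNIV d a'" "form scl UNIV d b'" "form scl UNIV d c'"
    "\<And>x. scl (x $ 3) (F' x) = A_sum x (a' x) (b' x) (c' x) + scl (x $ 3 ^ Suc d) v'"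
    by (rule reduces_toE[OF assms(2)], rule that)
  show ?thesis
  proof (rule reduces_toI[OF form_add[OF abc(1) abc'(1)] form_add[OF abc(2) abc'(2)] form_add[OF abc(3) abc'(3)]])
    show "scl (x $ 3) (F x + F' x) = A_sum x (a x + a' x) (b x + b' x) (c x + c' x) + scl (x $ 3 ^ Suc d) (v + v')" for x
      unfolding scale_right_distrib abc(4) abc'(4) A0.add A1.add A2.add by (simp only: add_ac)
  qed
qed

lemma reduces_to_shift:
  assumes "reduces_to d F v"
  shows "reduces_to (Suc d) (\<lambda>x. scl (x $ 3) (F x)) v"
proof -
  obtain a b c where abc: "form scl UNIV d a" "form scl UNIV d b" "form scl UNIV d c"
    "\<And>x. scl (x $ 3) (F x) = A_sum x (a x) (b x) (c x) + scl (x $ 3 ^ Suc d) v"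
    by (rule reduces_toE[OF assms], rule that)
  show ?thesis
  proof (rule reduces_toI)
    show "form scl UNIV (Suc d) (\<lambda>x. scl (x $ 3) (a x))" "form scl UNIV (Suc d) (\<lambda>x. scl (x $ 3) (b x))"
      "form scl UNIV (Suc d) (\<lambda>x. scl (x $ 3) (c x))"
      by (rule form_coord[OF UNIV_I abc(1)], rule form_coord[OF UNIV_I abc(2)], rule form_coord[OF UNIV_I abc(3)])
    show "scl (x $ 3) (scl (x $ 3) (F x)) =
      A_sum x (scl (x $ 3) (a x)) (scl (x $ 3) (b x)) (scl (x $ 3) (c x)) + scl (x $ 3 ^ Suc (Suc d)) v" for x
      unfolding abc(4) A0.scale A1.scale A2.scale scale_right_distrib scale_scale power_Suc[of _ "Suc d"] ..
  qed
qed

text \<open>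
  With \<open>w = z\<^sub>3\<^sup>d\<^sup>+\<^sup>1 v\<close> one has \<open>z\<^sub>i w = - A\<^sub>i w + z\<^sub>3\<^sup>d\<^sup>+\<^sup>2 B\<^sub>i v\<close>.
\<close>

lemma reduces_to_var:
  assumes "reduces_to d F v"
  shows "reduces_to (Suc d) (\<lambda>x. scl (x $ proj_index i) (F x)) (B i v)"
proof -
  obtain a b c where abc: "form scl UNIV d a" "form scl UNIV d b" "form scl UNIV d c"
    "\<And>x. scl (x $ 3) (F x) = A_sum x (a x) (b x) (c x) + scl (x $ 3 ^ Suc d) v"
    by (rule reduces_toE[OF assms], rule that)
  define j where "j = proj_index i"
  have xa: "form scl UNIV (Suc d) (\<lambda>x. scl (x $ j) (a x))" "form scl UNIV (Suc d) (\<lambda>x. scl (x $ j) (b x))"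
      "form scl UNIV (Suc d) (\<lambda>x. scl (x $ j) (c x))"
    by (rule form_coord[OF UNIV_I abc(1)], rule form_coord[OF UNIV_I abc(2)], rule form_coord[OF UNIV_I abc(3)])
  define w where "w x = scl (x $ 3 ^ Suc d) v" for x :: "complex ^ 4"
  have w: "form scl UNIV (Suc d) w"
    unfolding w_def using form_mult[OF coordinate_power_form[OF UNIV_I[of 3], of "Suc d"] form_constant[of scl UNIV v]] by simp
  have xw: "scl (x $ j) (w x) = - A j (B i) x (w x) + scl (x $ 3 ^ Suc (Suc d)) (B i v)" for x
  proof -
    interpret Bi: Vector_Spaces.linear scl scl "B i" by (rule linear_B)
    show ?thesis by (simp add: A_def w_def Bi.scale)
  qed
  have eq: "scl (x $ 3) (scl (x $ j) (F x)) =
      A_sum x (scl (x $ j) (a x)) (scl (x $ j) (b x)) (scl (x $ j) (c x)) - A j (B i) x (w x) + scl (x $ 3 ^ Suc (Suc d)) (B i v)" for x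
  proof -
    have "scl (x $ 3) (scl (x $ j) (F x)) = scl (x $ j) (scl (x $ 3) (F x))" by (rule scale_left_commute)
    also have "\<dots> = A_sum x (scl (x $ j) (a x)) (scl (x $ j) (b x)) (scl (x $ j) (c x)) + scl (x $ j) (w x)"
      unfolding abc(4) w_def A0.scale A1.scale A2.scale scale_right_distrib ..
    finally show ?thesis unfolding xw by simp
  qed
  have "i \<in> {0, 1, 2}" using UNIV_3' by blast
  then consider "i = 0" | "i = 1" | "i = 2" by blast
  then show ?thesis
  proof cases
    case 1
    then have "j = 0" "B i = B0" by (simp_all add: j_def proj_index_def B_def)
    then have "reduces_to (Suc d) (\<lambda>x. scl (x $ j) (F x)) (B i v)"
      by (intro reduces_toI[OF form_diff[OF xa(1) w] xa(2,3)]) (unfold eq, simp add: A0.diff)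
    then show ?thesis unfolding j_def .
  next
    case 2
    then have "j = 1" "B i = B1" by (simp_all add: j_def proj_index_def B_def)
    then have "reduces_to (Suc d) (\<lambda>x. scl (x $ j) (F x)) (B i v)"
      by (intro reduces_toI[OF xa(1) form_diff[OF xa(2) w] xa(3)]) (unfold eq, simp add: A1.diff)
    then show ?thesis unfolding j_def .
  next
    case 3
    then have "j = 2" "B i = B2" by (simp_all add: j_def proj_index_def B_def)
    then have "reduces_to (Suc d) (\<lambda>x. scl (x $ j) (F x)) (B i v)"
      by (intro reduces_toI[OF xa(1,2) form_diff[OF xa(3) w]]) (unfold eq, simp add: A2.diff)
    then show ?thesis unfolding j_def .
  qed
qed

text \<open>
  Modulo the image of the \<open>A\<^sub>i\<close> the coordinate \<open>z\<^sub>i\<close> acts as \<open>z\<^sub>3 B\<^sub>i\<close>, so a homogenization of \<open>p\<close> acts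
  as \<open>z\<^sub>3\<^sup>d p(B)\<close>.
\<close>

lemma homogenization_reduces:
  "homogenization d f p \<Longrightarrow> reduces_to d (\<lambda>x. scl (f x) v) (act p v)"
proof (induction rule: homogenization.induct)
  case (const a)
  then show ?case unfolding act_const by (rule reduces_to_const)
next
  case (add d f p g q)
  then show ?case unfolding act_add scale_left_distrib by (intro reduces_to_add)
next
  case (var d f p i)
  then show ?case unfolding act_var scale_scale[symmetric] by (intro reduces_to_var)
next
  case (shift d f p)
  then show ?case unfolding scale_scale[symmetric] by (intro reduces_to_shift)
qed

end

section \<open>The restriction to the affine chart\<close>

lemma chart_eq: "topspace P3 - hyperplane = nonvanishing (\<lambda>x. x $ 3)"
proof -
  have cone: "x \<in> cone (nonvanishing (\<lambda>x. x $ 3)) \<longleftrightarrow> x $ 3 \<noteq> 0" for x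
    by (rule cone_nonvanishing'[OF coordinate_form]) simp
  show ?thesis
  proof (intro equalityI subsetI)
    fix p assume p: "p \<in> topspace P3 - hyperplane"
    then obtain x where x: "x \<in> cone (topspace P3)" "p = vec.span {x}"
      using open_point[OF openin_topspace] by blast
    then have "x \<noteq> 0" by auto
    moreover have "x $ 3 \<noteq> 0" using p x calculation by (auto simp: hyperplane_def)
    ultimately show "p \<in> nonvanishing (\<lambda>x. x $ 3)" using x by (auto simp: nonvanishing_def)
  next
    fix p assume p: "p \<in> nonvanishing (\<lambda>x. x $ 3)"
    have "p \<in> topspace P3" using p openin_subset[OF openin_nonvanishing[OF coordinate_form]] by blast
    moreover have "p \<notin> hyperplane"
    proof
      assume "p \<in> hyperplane"
      then obtain y where y: "p = vec.span {y}" "y \<noteq> 0" "y $ 3 = 0" by (auto simp: hyperplane_def)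
      then have "y \<in> cone (nonvanishing (\<lambda>x. x $ 3))" using p by (simp add: cone_def)
      then show False using cone y(3) by simp
    qed
    ultimately show "p \<in> topspace P3 - hyperplane" by blast
  qed
qed

lemma openin_affine_chart:
  "openin affine_chart U \<longleftrightarrow> openin P3 U \<and> (\<forall>x\<in>cone U. x $ 3 \<noteq> 0)"
proof -
  have op: "openin P3 (nonvanishing (\<lambda>x. x $ 3))" by (rule openin_nonvanishing[OF coordinate_form])
  have "openin affine_chart U \<longleftrightarrow> openin P3 U \<and> U \<subseteq> nonvanishing (\<lambda>x. x $ 3)"
    unfolding affine_chart_def chart_eq using openin_open_subtopology[OF op] by blast
  moreover have "U \<subseteq> nonvanishing (\<lambda>x. x $ 3) \<longleftrightarrow> (\<forall>x\<in>cone U. x $ 3 \<noteq> 0)" if U: "openin P3 U"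
  proof
    assume "U \<subseteq> nonvanishing (\<lambda>x. x $ 3)"
    then have "cone U \<subseteq> cone (nonvanishing (\<lambda>x. x $ 3))" by (rule cone_mono)
    then show "\<forall>x\<in>cone U. x $ 3 \<noteq> 0"
      using cone_nonvanishing'[OF coordinate_form zero_less_Suc] by auto
  next
    assume r: "\<forall>x\<in>cone U. x $ 3 \<noteq> 0"
    show "U \<subseteq> nonvanishing (\<lambda>x. x $ 3)"
    proof
      fix p assume "p \<in> U"
      then obtain x where "x \<in> cone U" "p = vec.span {x}" using open_point[OF U] by blast
      then show "p \<in> nonvanishing (\<lambda>x. x $ 3)" using r by (auto simp: nonvanishing_def)
    qed
  qed
  ultimately show ?thesis by (simp cong: conj_cong)
qed

lemma cancel_common_factor: "a \<noteq> 0 \<Longrightarrow> inverse (a * g) * (a * f) = f / g"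
  for a f g :: complex
  by (simp add: field_simps)

context adhm
begin

abbreviation ker\<Phi> where "ker\<Phi> \<equiv> {p. Phi scl B0 B1 B2 I p = 0}"

lemma I_eq: "I a = scl a (I 1)"
  using I.scale[of a 1] by simp

text \<open>
  Replacing \<open>z\<^sub>3 f I(1)\<close> by \<open>z\<^sub>3\<^sup>d\<^sup>+\<^sup>2 q(B) I(1)\<close> turns the relation into one between the images of the \<open>A\<^sub>i\<close> and
  a form in \<open>z\<^sub>3\<close> alone, which is zero by \<open>koszul_exact_1\<close>.
\<close>

lemma relation_imp_kernel:
  assumes uvw: "form scl UNIV (Suc d) u" "form scl UNIV (Suc d) v" "form scl UNIV (Suc d) w"
    and f: "homogenization (Suc d) f q"
    and rel: "\<And>x. A_sum x (u x) (v x) (w x) + scl (x $ 3) (I (f x)) = 0"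
  shows "q \<in> ker\<Phi>"
proof -
  define z where "z = act q (I 1)"
  obtain a b c where abc: "form scl UNIV (Suc d) a" "form scl UNIV (Suc d) b" "form scl UNIV (Suc d) c"
    and eq: "\<And>x. scl (x $ 3) (scl (f x) (I 1)) = A_sum x (a x) (b x) (c x) + scl (x $ 3 ^ Suc (Suc d)) z"
    by (rule reduces_toE[OF homogenization_reduces[OF f, of "I 1", folded z_def]], rule that)
  have r: "form scl {3} (Suc (Suc d)) (\<lambda>x. scl (x $ 3 ^ Suc (Suc d)) z)"
    using form_mult[OF coordinate_power_form[OF singletonI[of 3], of "Suc (Suc d)"] form_constant[of scl "{3}" z]] by simp
  have rel': "A0 x (u x + a x) + A1 x (v x + b x) + A2 x (w x + c x) + scl (x $ 3 ^ Suc (Suc d)) z = 0" for x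
  proof -
    have "A0 x (u x + a x) + A1 x (v x + b x) + A2 x (w x + c x) + scl (x $ 3 ^ Suc (Suc d)) z =
      A_sum x (u x) (v x) (w x) + (A_sum x (a x) (b x) (c x) + scl (x $ 3 ^ Suc (Suc d)) z)"
      unfolding A0.add A1.add A2.add by (simp only: add_ac)
    also have "\<dots> = A_sum x (u x) (v x) (w x) + scl (x $ 3) (I (f x))"
      unfolding eq[symmetric] I_eq[of "f x"] ..
    finally show ?thesis using rel by simp
  qed
  obtain zero: "\<And>x :: complex ^ 4. scl (x $ 3 ^ Suc (Suc d)) z = 0"
    by (rule koszul_exact_1[OF lin comm form_add[OF uvw(1) abc(1)] form_add[OF uvw(2) abc(2)] form_add[OF uvw(3) abc(3)] r rel'], rule that)
  have "z = 0" using zero[of "axis 3 1"] by simp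
  then show ?thesis by (simp add: Phi_def z_def)
qed

text \<open>
  If \<open>c = f / h\<close> is the \<open>W\<close>-component of an element of the kernel, clearing denominators gives a relation
  between forms, and the dehomogenization of \<open>f\<close> lies in \<open>ker \<Phi>\<^sub>X\<close>. Conversely, for \<open>p \<in> ker \<Phi>\<^sub>X\<close> a
  homogenization \<open>f\<close> satisfies \<open>z\<^sub>3 f I(1) = A\<^sub>0 a + A\<^sub>1 b + A\<^sub>2 c\<close>, and \<open>((-a, -b, -c), f)\<close> is in the kernel.
\<close>

lemma coh_J_eq_affine:
  assumes U: "openin affine_chart U"
  shows "coh.J U = affine_ideal_sheaf ker\<Phi> U"
proof (intro equalityI subsetI)
  have UP: "openin P3 U" and U3: "\<And>x. x \<in> cone U \<Longrightarrow> x $ 3 \<noteq> 0"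
    using U unfolding openin_affine_chart by auto
  {
    fix s assume s: "s \<in> coh.J U"
    have "\<exists>V. openin affine_chart V \<and> p \<in> V \<and> V \<subseteq> U \<and>
        (\<exists>f\<in>ker\<Phi>. \<exists>g. \<forall>x\<in>cone V. poly_eval (*) g (affine_coords x) \<noteq> 0 \<and>
           s x = poly_eval (*) f (affine_coords x) / poly_eval (*) g (affine_coords x))" if p: "p \<in> U" for p
    proof -
      interpret V3W: complex_vector_space scl3W by (rule vs3W)
      obtain V k where V: "openin P3 V" "p \<in> V" "V \<subseteq> U" "k \<in> K V" and sk: "\<forall>y\<in>cone V. s y = snd (k y)"
        using bspec[OF conjunct2[OF iffD1[OF coh_J_iff s]] p] by (elim exE conjE bexE)
      obtain x where x: "x \<in> cone V" "p = vec.span {x}" using open_point[OF V(1,2)] by blast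
      have k: "is_section scl3W 0 V k" "\<And>x. al0 x (k x) = 0" using V(4) unfolding K_iff by auto
      obtain h F d e where h: "form (*) UNIV e h" and F: "form scl3W UNIV d F" and deg: "int d = int e + 0" "1 \<le> d"
        and h2: "0 < e" "h x \<noteq> 0" "nonvanishing h \<subseteq> V"
        and eq: "\<And>y. h y \<noteq> 0 \<Longrightarrow> k y = V3W.fraction h F y"
        by (rule V3W.section_local[OF V(1) k(1) x(1), of 1], rule that)
      obtain d' where d: "d = Suc d'" using deg(2) by (cases d) auto
      define u v w f where "u = (\<lambda>y. fst (fst (F y)))" and "v = (\<lambda>y. fst (snd (fst (F y))))"
        and "w = (\<lambda>y. snd (snd (fst (F y))))" and "f = (\<lambda>y. snd (F y))"
      have forms: "form scl UNIV (Suc d') u" "form scl UNIV (Suc d') v" "form scl UNIV (Suc d') w" "form (*) UNIV (Suc d') f"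
        using F unfolding form_scl3W form_scl3 d u_def v_def w_def f_def by auto
      have F_eq: "F y = ((u y, v y, w y), f y)" for y by (simp add: u_def v_def w_def f_def)
      have al0_F: "al0 y (F y) = A_sum y (u y) (v y) (w y) + scl (y $ 3) (I (f y))" for y
        unfolding F_eq alpha_A ..
      have rel: "al0 y (F y) = 0" for y
      proof (rule fraction_relation[where M = al0, OF vs linear_al0 h h2(2)])
        show "form scl UNIV (Suc (Suc d')) (\<lambda>y. al0 y (F y))"
          unfolding al0_F by (intro form_add form_A lin forms UNIV_I form_coord form_comp_linear[OF linI])
        show "al0 y (scl3W (inverse (h y)) (F y)) = 0" if "h y \<noteq> 0" for y
          using k(2)[of y] eq[OF that] by (simp add: V3W.fraction_def)
      qed
      obtain q where q: "homogenization (Suc d') f q" using homogenization_of_form[OF forms(4)] by blast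
      obtain g where g: "homogenization e h g" using homogenization_of_form[OF h] by blast
      have "q \<in> ker\<Phi>" using relation_imp_kernel[OF forms(1-3) q] rel unfolding al0_F by blast
      moreover have "poly_eval (*) g (affine_coords y) \<noteq> 0 \<and>
          s y = poly_eval (*) q (affine_coords y) / poly_eval (*) g (affine_coords y)"
        if y: "y \<in> cone (nonvanishing h)" for y
      proof -
        have hy: "h y \<noteq> 0" using y cone_nonvanishing'[OF h h2(1)] by simp
        have yV: "y \<in> cone V" using y cone_mono[OF h2(3)] by blast
        have y3: "y $ 3 \<noteq> 0" using yV cone_mono[OF V(3)] U3 by blast
        have e: "e = Suc d'" using deg d by simp
        have hv: "h y = y $ 3 ^ Suc d' * poly_eval (*) g (affine_coords y)" using homogenization_value[OF g y3] e by simp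
        have fv: "f y = y $ 3 ^ Suc d' * poly_eval (*) q (affine_coords y)" by (rule homogenization_value[OF q y3])
        have "s y = inverse (h y) * f y"
          using bspec[OF sk yV] eq[OF hy] by (simp add: V3W.fraction_def F_eq)
        moreover have "y $ 3 ^ Suc d' \<noteq> 0" using y3 by simp
        moreover have "poly_eval (*) g (affine_coords y) \<noteq> 0" using hy unfolding hv by simp
        ultimately show ?thesis unfolding hv fv using cancel_common_factor by metis
      qed
      moreover have "openin affine_chart (nonvanishing h)"
        unfolding openin_affine_chart using openin_nonvanishing[OF h] cone_mono[OF h2(3)] cone_mono[OF V(3)] U3 by blast
      moreover have "p \<in> nonvanishing h"
        unfolding x(2) by (rule span_in_cone) (simp add: cone_nonvanishing'[OF h h2(1)] h2(2))
      ultimately show ?thesis using h2(3) V(3) by (intro exI[of _ "nonvanishing h"] conjI bexI[of _ q] exI[of _ g]) auto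
    qed
    then show "s \<in> affine_ideal_sheaf ker\<Phi> U"
      unfolding affine_ideal_sheaf_def using coh.J_supp[OF s] by blast
  next
    fix s assume s: "s \<in> affine_ideal_sheaf ker\<Phi> U"
    have "\<exists>V. openin P3 V \<and> p \<in> V \<and> V \<subseteq> U \<and> (\<exists>k\<in>K V. \<forall>y\<in>cone V. s y = snd (k y))" if p: "p \<in> U" for p
    proof -
      interpret V3W: complex_vector_space scl3W by (rule vs3W)
      obtain V f g where V: "openin affine_chart V" "p \<in> V" "V \<subseteq> U" and f: "f \<in> ker\<Phi>"
        and sv': "\<forall>x\<in>cone V. poly_eval (*) g (affine_coords x) \<noteq> 0 \<and>
             s x = poly_eval (*) f (affine_coords x) / poly_eval (*) g (affine_coords x)"
        using bspec[OF conjunct2[OF s[unfolded affine_ideal_sheaf_def mem_Collect_eq]] p] by (elim exE conjE bexE)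
      note sv = bspec[OF sv']
      have VP: "openin P3 V" and V3: "\<And>x. x \<in> cone V \<Longrightarrow> x $ 3 \<noteq> 0" using V(1) unfolding openin_affine_chart by auto
      obtain x where x: "x \<in> cone V" "p = vec.span {x}" using open_point[OF VP V(2)] by blast
      \<comment> \<open>Numerator and denominator are brought to the same degree; the additional \<open>1\<close> makes it positive.\<close>
      obtain m f0 n g0 where "homogenization m f0 f" "homogenization n g0 g" using homogenization_exists by blast
      then obtain F G where FG: "homogenization (m + (n + 1)) F f" "homogenization (n + (m + 1)) G g"
        using homogenization_raise by blast
      define d where "d = m + n + 1"
      have F: "homogenization d F f" and G: "homogenization d G g" and d: "0 < d"
        using FG by (simp_all add: d_def add_ac)
      have Gf: "form (*) UNIV d G" and Ff: "form (*) UNIV d F" by (rule homogenization_form[OF G], rule homogenization_form[OF F])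
      have "act f (I 1) = 0" using f by (simp add: Phi_def)
      then have red: "reduces_to d (\<lambda>x. scl (F x) (I 1)) 0" using homogenization_reduces[OF F, of "I 1"] by simp
      obtain a b c where abc: "form scl UNIV d a" "form scl UNIV d b" "form scl UNIV d c"
        and eq: "\<And>x. scl (x $ 3) (scl (F x) (I 1)) = A_sum x (a x) (b x) (c x) + scl (x $ 3 ^ Suc d) 0"
        by (rule reduces_toE[OF red], rule that)
      define k where "k y = ((- a y, - b y, - c y), F y)" for y
      have kf: "form scl3W UNIV d k"
        unfolding form_scl3W form_scl3 k_def fst_conv snd_conv using abc[THEN form_minus] Ff by blast
      have al0_k: "al0 y (k y) = 0" for y
      proof -
        have "al0 y (k y) = - A_sum y (a y) (b y) (c y) + scl (y $ 3) (I (F y))"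
          unfolding k_def alpha_A by (simp add: A0.neg A1.neg A2.neg)
        then show ?thesis unfolding I_eq[of "F y"] eq by simp
      qed
      have op: "openin P3 (nonvanishing G)" by (rule openin_nonvanishing[OF Gf])
      have "V3W.fraction G k \<in> K (nonvanishing G)"
        unfolding K_iff
        using V3W.section_fraction[OF Gf d kf, of 0] al0_k by (simp add: V3W.fraction_def al0_scale)
      moreover define W where "W = V \<inter> nonvanishing G"
      moreover have W: "openin P3 W" "W \<subseteq> nonvanishing G" "W \<subseteq> V" using VP op by (auto simp: W_def)
      ultimately have kW: "restrict_to W (V3W.fraction G k) \<in> K W" using K_restrict[OF op W(1,2)] by blast
      have Gv: "G y = y $ 3 ^ d * poly_eval (*) g (affine_coords y)" and Fv: "F y = y $ 3 ^ d * poly_eval (*) f (affine_coords y)"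
        if "y \<in> cone V" for y
        using homogenization_value[OF G V3[OF that]] homogenization_value[OF F V3[OF that]] by auto
      have sW: "s y = snd (restrict_to W (V3W.fraction G k) y)" if y: "y \<in> cone W" for y
      proof -
        have yV: "y \<in> cone V" using y cone_mono[OF W(3)] by blast
        have "snd (restrict_to W (V3W.fraction G k) y) = inverse (G y) * F y"
          using y by (simp add: restrict_to_def V3W.fraction_def k_def)
        also have "\<dots> = s y" using sv[OF yV] V3[OF yV] Gv[OF yV] Fv[OF yV] by (simp add: field_simps)
        finally show ?thesis by simp
      qed
      have "G x \<noteq> 0" using sv[OF x(1)] V3[OF x(1)] Gv[OF x(1)] by simp
      then have "x \<in> cone (nonvanishing G)" using cone_nonvanishing'[OF Gf d] by simp
      then have "p \<in> W" using span_in_cone[of x "nonvanishing G"] x(2) V(2) by (simp add: W_def)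
      moreover have "W \<subseteq> U" using W(3) V(3) by (rule subset_trans)
      ultimately show ?thesis
        using W(1) by (intro exI[of _ W] conjI bexI[OF _ kW] ballI sW)
    qed
    then show "s \<in> coh.J U"
      unfolding coh_J_iff using s by (simp add: affine_ideal_sheaf_def)
  }
qed

lemma affine_iso:
  "sheaf_iso affine_chart O_P3 (ideal_module O_P3 coh.J) (ideal_module O_P3 (affine_ideal_sheaf ker\<Phi>))"
  unfolding sheaf_iso_def
proof (intro exI[of _ "\<lambda>U s. s"] conjI allI impI)
  show "sheaf_hom affine_chart O_P3 (ideal_module O_P3 coh.J) (ideal_module O_P3 (affine_ideal_sheaf ker\<Phi>)) (\<lambda>U s. s)"
    unfolding sheaf_hom_def by (simp add: ideal_module_def coh_J_eq_affine)
  show "bij_betw (\<lambda>s. s) (carrier (sec (ideal_module O_P3 coh.J) U)) (carrier (sec (ideal_module O_P3 (affine_ideal_sheaf ker\<Phi>)) U))"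
    if "openin affine_chart U" for U
    using coh_J_eq_affine[OF that] by (simp add: ideal_module_def bij_betw_def)
qed

lemma perfect_monad: "perfect_extended_monad (twist scl (-2)) (matrix_hom al2) (twist scl3 (-1)) (matrix_hom al1)
    (twist scl3W 0) (matrix_hom al0) (twist scl 1)"
proof -
  obtain b where b: "finite b" "span b = UNIV" using finite_dimensional by blast
  have "\<exists>b. finite b \<and> module.span (module_prod.scale scl scl) b = UNIV" by (rule finite_span_prod[OF vs vs b b])
  then obtain b2 where b2: "finite b2" "module.span (module_prod.scale scl scl) b2 = UNIV" by blast
  have "\<exists>b. finite b \<and> module.span scl3 b = UNIV" unfolding scale3_def by (rule finite_span_prod[OF vs vs2 b b2])
  then obtain b3 where b3: "finite b3" "module.span scl3 b3 = UNIV" by blast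
  have one: "module.span (*) {1 :: complex} = UNIV"
    by (auto simp: vector_space_over_itself.span_singleton)
  have "\<exists>b. finite b \<and> module.span scl3W b = UNIV" unfolding scale3W_def
    by (rule finite_span_prod[OF vs3 complex_vector_space_self b3 _ one]) simp
  then obtain b4 where b4: "finite b4" "module.span scl3W b4 = UNIV" by blast
  show ?thesis
    unfolding perfect_extended_monad_def
  proof (intro conjI allI impI)
    show "\<exists>a. sheaf_iso P3 O_P3 (twist scl (-2)) (twist_sum (-2) a)" by (rule twist_iso_twist_sum[OF vs b])
    show "\<exists>a. sheaf_iso P3 O_P3 (twist scl3 (-1)) (twist_sum (-1) a)" by (rule twist_iso_twist_sum[OF vs3 b3])
    show "\<exists>a. sheaf_iso P3 O_P3 (twist scl3W 0) (twist_sum 0 a)" by (rule twist_iso_twist_sum[OF vs3W b4])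
    show "\<exists>a. sheaf_iso P3 O_P3 (twist scl 1) (twist_sum 1 a)" by (rule twist_iso_twist_sum[OF vs b])
    fix U assume U: "openin P3 U"
    show "ker_sheaf (twist scl (-2)) (twist scl3 (-1)) (matrix_hom al2) U = {\<zero>\<^bsub>sec (twist scl (-2)) U\<^esub>}"
      using kernel_al2[OF U] by simp
    show "ker_sheaf (twist scl3 (-1)) (twist scl3W 0) (matrix_hom al1) U =
      im_sheaf P3 (twist scl (-2)) (twist scl3 (-1)) (matrix_hom al2) U" by (rule kernel_al1[OF U])
    show "im_sheaf P3 (twist scl3 (-1)) (twist scl3W 0) (matrix_hom al1) U \<subseteq>
      ker_sheaf (twist scl3W 0) (twist scl 1) (matrix_hom al0) U" using image_al1_iff[OF U] by blast
    show "im_sheaf P3 (twist scl3W 0) (twist scl 1) (matrix_hom al0) U = carrier (sec (twist scl 1) U)"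
      by (rule image_al0[OF U])
  qed (rule sheaf_hom_al2 sheaf_hom_al1 sheaf_hom_al0)+
qed

end

theorem theorem4p5:
  fixes scl :: "complex \<Rightarrow> 'v \<Rightarrow> 'v::ab_group_add"
    and c :: nat
    and B0 B1 B2 :: "'v \<Rightarrow> 'v"
    and I :: "complex \<Rightarrow> 'v"
  assumes "c > 0"
    and "vector_space scl"
    and "vector_space.dim scl (UNIV :: 'v set) = c"
    and "(B0, B1, B2, I) \<in> stable_adhm_data scl"
  defines "\<alpha>2 \<equiv> matrix_hom (alpha_m2 scl B0 B1 B2)"
    and "\<alpha>1 \<equiv> matrix_hom (alpha_m1 scl B0 B1 B2)"
    and "\<alpha>0 \<equiv> matrix_hom (alpha_0 scl B0 B1 B2 I)"
    and "ker\<Phi> \<equiv> {p. Phi scl B0 B1 B2 I p = 0}"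
  shows "perfect_extended_monad
           (twist scl (-2)) \<alpha>2 (twist (scale3 scl) (-1)) \<alpha>1 (twist (scale3W scl) 0) \<alpha>0 (twist scl 1)
       \<and> Modules.module.subspace (*) ker\<Phi>
       \<and> (\<exists>J. ideal_sheaf P3 O_P3 J
            \<and> sheaf_iso P3 O_P3
                (cohomology_sheaf P3 O_P3
                   (twist (scale3 scl) (-1)) \<alpha>1 (twist (scale3W scl) 0) \<alpha>0 (twist scl 1))
                (ideal_module O_P3 J)
            \<and> sheaf_iso affine_chart O_P3
                (ideal_module O_P3 J) (ideal_module O_P3 (affine_ideal_sheaf ker\<Phi>)))"
proof -
  interpret V: complex_vector_space scl using assms(2) by (rule complex_vector_space.intro)
  obtain b where b: "UNIV \<subseteq> V.span b" "card b = V.dim UNIV"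
    by (rule V.basis_exists[of UNIV], rule that)
  have "finite b" using b(2) assms(1,3) card_gt_0_iff[of b] by simp
  moreover have "V.span b = UNIV" using b(1) by blast
  ultimately have fin: "\<exists>b. finite b \<and> V.span b = UNIV" by blast
  interpret adhm scl B0 B1 B2 I
    by (intro adhm.intro adhm_axioms.intro V.complex_vector_space_axioms assms(4) fin)
  show ?thesis
    unfolding \<alpha>2_def \<alpha>1_def \<alpha>0_def ker\<Phi>_def
    by (rule conjI[OF perfect_monad conjI[OF subspace_kernel exI[of _ coh.J]]])
      (rule conjI[OF coh.ideal_sheaf_J conjI[OF cohomology_iso affine_iso]])
qed

end
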